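(* Let $\Gamma\subset\mathrm{Sol}$ be a lattice, and equip $M=\Gamma\backslash\mathrm{Sol}$ with the metric $g$ induced by the standard $\mathrm{Sol}$ metric. Then $$\mathrm{CS}(M,g)\equiv0\pmod{\mathbb Z}.$$
   Context: $\mathrm{Sol}=\mathbb R^3$ with group law given by matrix multiplication when $(x,y,z)$ corresponds to $\begin{pmatrix}e^{-z}&0&x\\0&e^z&y\\0&0&1\end{pmatrix}$; left-invariant frame $X=e^{-z}\partial_x$, $Y=e^z\partial_y$, $Z=\partial_z$. The standard metric $e^{2z}dx^2+e^{-2z}dy^2+dz^2$ is the left-invariant metric making $X,Y,Z$ orthonormal; $\mathrm{Sol}$ is oriented so that $(X,Y,Z)$ is positive, and $M$ carries the induced orientation. A lattice is a discrete cocompact subgroup, acting by left translations. For a closed oriented Riemannian $3$-manifold $(M,g)$ with oriented orthonormal frame bundle $F(M,g)$ (a trivial $\mathrm{SO}(3)$-bundle), Levi-Civita connection form $\omega_{\mathrm{LC}}$ ($\mathfrak{so}(3)$-valued) and any section $s$ of $F(M,g)$, $$\mathrm{CS}(M,g)=-\frac1{16\pi^2}\int_Ms^*\mathrm{Tr}\Big(\omega_{\mathrm{LC}}\wedge d\omega_{\mathrm{LC}}+\frac23\omega_{\mathrm{LC}}\wedge\omega_{\mathrm{LC}}\wedge\omega_{\mathrm{LC}}\Big)\bmod\mathbb Z,$$ independent of $s$. *)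

theory Defs
  imports "HOL-Analysis.Analysis" "HOL-Algebra.Coset" "HOL-Library.Real_Mod"
begin

section \<open>Smooth functions of three real variables\<close>

definition partial :: "3 \<Rightarrow> (real^3 \<Rightarrow> 'b::real_normed_vector) \<Rightarrow> real^3 \<Rightarrow> 'b" where
  "partial a f x = frechet_derivative f (at x) (axis a 1)"

primrec Ck_on :: "nat \<Rightarrow> (real^3) set \<Rightarrow> (real^3 \<Rightarrow> 'b::real_normed_vector) \<Rightarrow> bool" where
  "Ck_on 0 D f \<longleftrightarrow> continuous_on D f"
| "Ck_on (Suc k) D f \<longleftrightarrow> (\<forall>x\<in>D. f differentiable at x) \<and> (\<forall>a. Ck_on k D (partial a f))"

definition smooth_on :: "(real^3) set \<Rightarrow> (real^3 \<Rightarrow> 'b::real_normed_vector) \<Rightarrow> bool" where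
  "smooth_on D f \<longleftrightarrow> (\<forall>k. Ck_on k D f)"


section \<open>Closed oriented Riemannian 3-manifolds\<close>

text \<open>
  A chart \<open>(D, \<psi>)\<close> is given by the inverse of the usual coordinate map: an injective
  parametrization \<open>\<psi>\<close> of part of the manifold by the open set \<open>D\<close> of coordinates. A manifold is
  given by its atlas; its points are those covered by the charts.
\<close>

type_synonym 'p chart = "(real^3) set \<times> (real^3 \<Rightarrow> 'p)"

definition points :: "'p chart set \<Rightarrow> 'p set" where
  "points \<A> = (\<Union>(D, \<psi>)\<in>\<A>. \<psi> ` D)"

definition manifold_topology :: "'p chart set \<Rightarrow> 'p topology" where
  "manifold_topology \<A> =
     topology (\<lambda>U. U \<subseteq> points \<A> \<and> (\<forall>(D, \<psi>)\<in>\<A>. open {x\<in>D. \<psi> x \<in> U}))"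

definition overlap :: "'p chart \<Rightarrow> 'p chart \<Rightarrow> (real^3) set" where
  "overlap c d = {x \<in> fst c. snd c x \<in> snd d ` fst d}"

definition transition :: "'p chart \<Rightarrow> 'p chart \<Rightarrow> real^3 \<Rightarrow> real^3" where
  "transition c d x = inv_into (fst d) (snd d) (snd c x)"

definition closed_oriented_3manifold :: "'p chart set \<Rightarrow> bool" where
  "closed_oriented_3manifold \<A> \<longleftrightarrow>
     (\<forall>(D, \<psi>)\<in>\<A>. open D \<and> inj_on \<psi> D) \<and>
     (\<forall>c\<in>\<A>. \<forall>d\<in>\<A>. open (overlap c d) \<and> smooth_on (overlap c d) (transition c d) \<and>
        (\<forall>x\<in>overlap c d. det (jacobian (transition c d) (at x)) > 0)) \<and>
     Hausdorff_space (manifold_topology \<A>) \<and> compact_space (manifold_topology \<A>)"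

text \<open>
  Tensor fields on the manifold are families, indexed by the charts, of their coordinate
  expressions. A metric is represented in each chart by its Gram matrix, a frame by the matrix
  whose \<open>j\<close>-th column holds the coordinates of its \<open>j\<close>-th vector.
\<close>

definition riemannian_metric :: "'p chart set \<Rightarrow> ('p chart \<Rightarrow> real^3 \<Rightarrow> real^3^3) \<Rightarrow> bool" where
  "riemannian_metric \<A> g \<longleftrightarrow>
     (\<forall>c\<in>\<A>. smooth_on (fst c) (g c) \<and>
        (\<forall>x\<in>fst c. transpose (g c x) = g c x \<and> (\<forall>v. v \<noteq> 0 \<longrightarrow> v \<bullet> (g c x *v v) > 0))) \<and>
     (\<forall>c\<in>\<A>. \<forall>d\<in>\<A>. \<forall>x\<in>overlap c d.
        let J = jacobian (transition c d) (at x)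
        in g c x = transpose J ** g d (transition c d x) ** J)"

text \<open>Smooth global sections of the oriented orthonormal frame bundle:\<close>

definition frame_section ::
  "'p chart set \<Rightarrow> ('p chart \<Rightarrow> real^3 \<Rightarrow> real^3^3) \<Rightarrow> ('p chart \<Rightarrow> real^3 \<Rightarrow> real^3^3) \<Rightarrow> bool" where
  "frame_section \<A> g s \<longleftrightarrow>
     (\<forall>c\<in>\<A>. smooth_on (fst c) (s c) \<and>
        (\<forall>x\<in>fst c. transpose (s c x) ** g c x ** s c x = mat 1 \<and> det (s c x) > 0)) \<and>
     (\<forall>c\<in>\<A>. \<forall>d\<in>\<A>. \<forall>x\<in>overlap c d.
        s d (transition c d x) = jacobian (transition c d) (at x) ** s c x)"

text \<open>
  A 3-form \<open>\<eta>\<close> is represented in each chart by its coefficient with respect to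
  \<open>dx\<^sub>1 \<and> dx\<^sub>2 \<and> dx\<^sub>3\<close>. It is integrated over an oriented manifold by cutting the manifold into finitely
  many disjoint Borel pieces, each contained in a chart (\<open>B c\<close> is the set of coordinates of the
  piece in the chart \<open>c\<close>); the sum does not depend on how this is done, since the transition maps
  preserve the orientation.
\<close>

definition has_form_integral :: "'p chart set \<Rightarrow> ('p chart \<Rightarrow> real^3 \<Rightarrow> real) \<Rightarrow> real \<Rightarrow> bool" where
  "has_form_integral \<A> \<eta> I \<longleftrightarrow>
     (\<exists>C B. finite C \<and> C \<subseteq> \<A> \<and>
        (\<forall>c\<in>C. B c \<subseteq> fst c \<and> B c \<in> sets borel \<and> \<eta> c absolutely_integrable_on B c) \<and>
        disjoint_family_on (\<lambda>c. snd c ` B c) C \<and> (\<Union>c\<in>C. snd c ` B c) = points \<A> \<and>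
        I = (\<Sum>c\<in>C. integral (B c) (\<eta> c)))"


section \<open>The Levi-Civita connection and the Chern--Simons invariant\<close>

definition christoffel :: "(real^3 \<Rightarrow> real^3^3) \<Rightarrow> 3 \<Rightarrow> 3 \<Rightarrow> 3 \<Rightarrow> real^3 \<Rightarrow> real" where
  "christoffel G k a b x =
     1/2 * (\<Sum>l\<in>UNIV. matrix_inv (G x) $ k $ l *
        (partial a G x $ b $ l + partial b G x $ a $ l - partial l G x $ a $ b))"

definition cov_deriv :: "(real^3 \<Rightarrow> real^3^3) \<Rightarrow> 3 \<Rightarrow> (real^3 \<Rightarrow> real^3) \<Rightarrow> real^3 \<Rightarrow> real^3" where
  "cov_deriv G a V x =
     (\<chi> k. partial a V x $ k + (\<Sum>b\<in>UNIV. christoffel G k a b x * V x $ b))"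

text \<open>
  The pullback of the Levi-Civita connection form along the frame \<open>s = (e\<^sub>1, e\<^sub>2, e\<^sub>3)\<close>, evaluated on
  the \<open>a\<close>-th coordinate field, is the matrix \<open>(\<omega>\<^sub>i\<^sub>j)\<close> with \<open>\<nabla>\<^sub>a e\<^sub>j = \<Sum>\<^sub>i \<omega>\<^sub>i\<^sub>j e\<^sub>i\<close>, that is,
  \<open>\<omega>\<^sub>i\<^sub>j = g(e\<^sub>i, \<nabla>\<^sub>a e\<^sub>j)\<close>.
\<close>

definition lc_form :: "(real^3 \<Rightarrow> real^3^3) \<Rightarrow> (real^3 \<Rightarrow> real^3^3) \<Rightarrow> 3 \<Rightarrow> real^3 \<Rightarrow> real^3^3" where
  "lc_form G E a x =
     (\<chi> i j. column i (E x) \<bullet> (G x *v cov_deriv G a (\<lambda>y. column j (E y)) x))"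

text \<open>
  The coefficient of \<open>Tr (A \<and> dA + 2/3 A \<and> A \<and> A)\<close> for a matrix-valued 1-form
  \<open>A = \<Sum>\<^sub>a A\<^sub>a dx\<^sub>a\<close>, from \<open>dA = \<Sum>\<^sub>b\<^sub>c \<partial>\<^sub>b A\<^sub>c dx\<^sub>b \<and> dx\<^sub>c\<close> and
  \<open>dx\<^sub>p\<^sub>1 \<and> dx\<^sub>p\<^sub>2 \<and> dx\<^sub>p\<^sub>3 = sign p dx\<^sub>1 \<and> dx\<^sub>2 \<and> dx\<^sub>3\<close>. Pullback commutes with \<open>d\<close>, \<open>\<and>\<close> and the
  trace, so with \<open>A\<close> the pullback of the connection form this is the pullback of the
  Chern--Simons form.
\<close>

definition cs_coeff :: "(3 \<Rightarrow> real^3 \<Rightarrow> real^3^3) \<Rightarrow> real^3 \<Rightarrow> real" where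
  "cs_coeff A x = (\<Sum>p | p permutes (UNIV :: 3 set). of_int (sign p) *
     trace (A (p 1) x ** partial (p 2) (A (p 3)) x +
            (2/3) *\<^sub>R (A (p 1) x ** A (p 2) x ** A (p 3) x)))"

definition cs_form ::
  "('p chart \<Rightarrow> real^3 \<Rightarrow> real^3^3) \<Rightarrow> ('p chart \<Rightarrow> real^3 \<Rightarrow> real^3^3) \<Rightarrow> 'p chart \<Rightarrow> real^3 \<Rightarrow> real" where
  "cs_form g s c = cs_coeff (lc_form (g c) (s c))"

text \<open>
  An element of \<open>\<real>/\<int>\<close> is represented by the set of its real representatives. All sections are
  allowed here: that the set below is a single residue class is the independence of the section.
\<close>

definition mod_Z :: "real \<Rightarrow> real set" where
  "mod_Z r = {t. [t = r] (rmod 1)}"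

definition chern_simons :: "'p chart set \<Rightarrow> ('p chart \<Rightarrow> real^3 \<Rightarrow> real^3^3) \<Rightarrow> real set" where
  "chern_simons \<A> g =
     (\<Union>{mod_Z (- 1 / (16 * pi\<^sup>2) * I) | s I.
        frame_section \<A> g s \<and> has_form_integral \<A> (cs_form g s) I})"


section \<open>The group Sol and its quotients by lattices\<close>

definition sol_mult :: "real^3 \<Rightarrow> real^3 \<Rightarrow> real^3" where
  "sol_mult p q = vector [p$1 + exp (- p$3) * q$1, p$2 + exp (p$3) * q$2, p$3 + q$3]"

definition sol_matrix :: "real^3 \<Rightarrow> real^3^3" where
  "sol_matrix p = vector [vector [exp (- p$3), 0, p$1], vector [0, exp (p$3), p$2], vector [0, 0, 1]]"

lemma sol_matrix_mult: "sol_matrix (sol_mult p q) = sol_matrix p ** sol_matrix q"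
  by (simp add: vec_eq_iff forall_3 sol_matrix_def sol_mult_def matrix_matrix_mult_def sum_3
      exp_add exp_diff exp_minus field_simps)

definition Sol :: "(real^3) monoid" where
  "Sol = \<lparr>carrier = UNIV, mult = sol_mult, one = 0\<rparr>"

text \<open>The quotient of Sol by the left translations in \<open>\<Gamma>\<close> consists of the right cosets \<open>\<Gamma>p\<close>.\<close>

definition sol_quotient_topology :: "(real^3) set \<Rightarrow> (real^3) set topology" where
  "sol_quotient_topology \<Gamma> =
     topology (\<lambda>U. U \<subseteq> rcosets\<^bsub>Sol\<^esub> \<Gamma> \<and> open {p. \<Gamma> #>\<^bsub>Sol\<^esub> p \<in> U})"

definition sol_lattice :: "(real^3) set \<Rightarrow> bool" where
  "sol_lattice \<Gamma> \<longleftrightarrow>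
     subgroup \<Gamma> Sol \<and> discrete \<Gamma> \<and> compact_space (sol_quotient_topology \<Gamma>)"

text \<open>
  The projection restricted to any open set on which it is injective is a chart, so charts use the
  coordinates \<open>x, y, z\<close> of Sol. These are positively oriented, as is the frame \<open>X, Y, Z\<close>.
\<close>

definition sol_quotient :: "(real^3) set \<Rightarrow> (real^3) set chart set" where
  "sol_quotient \<Gamma> = {(D, \<lambda>p. \<Gamma> #>\<^bsub>Sol\<^esub> p) | D. open D \<and> inj_on (\<lambda>p. \<Gamma> #>\<^bsub>Sol\<^esub> p) D}"

definition sol_metric :: "real^3 \<Rightarrow> real^3^3" where
  "sol_metric p =
     vector [vector [exp (2 * p$3), 0, 0], vector [0, exp (- 2 * p$3), 0], vector [0, 0, 1]]"

definition sol_quotient_metric :: "(real^3) set chart \<Rightarrow> real^3 \<Rightarrow> real^3^3" where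
  "sol_quotient_metric c = sol_metric"

text \<open>The columns are the left-invariant fields \<open>X\<close>, \<open>Y\<close>, \<open>Z\<close>.\<close>

definition sol_frame :: "real^3 \<Rightarrow> real^3^3" where
  "sol_frame p =
     vector [vector [exp (- p$3), 0, 0], vector [0, exp (p$3), 0], vector [0, 0, 1]]"

lemma sol_frame_orthonormal: "transpose (sol_frame p) ** sol_metric p ** sol_frame p = mat 1"
  by (simp add: vec_eq_iff forall_3 sol_metric_def sol_frame_def matrix_matrix_mult_def sum_3
      transpose_def mat_def flip: exp_add)

lemma sol_frame_positive: "det (sol_frame p) = 1"
  by (simp add: det_3 sol_frame_def flip: exp_add)


section \<open>The quotient by a lattice is a closed oriented Riemannian 3-manifold\<close>

lemma sol_mult_nth [simp]:
  "sol_mult p q $ 1 = p$1 + exp (- p$3) * q$1"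
  "sol_mult p q $ 2 = p$2 + exp (p$3) * q$2"
  "sol_mult p q $ 3 = p$3 + q$3"
  by (simp_all add: sol_mult_def)

definition sol_inv :: "real^3 \<Rightarrow> real^3" where
  "sol_inv p = vector [- exp (p$3) * p$1, - exp (- p$3) * p$2, - p$3]"

lemma sol_inv_nth [simp]:
  "sol_inv p $ 1 = - exp (p$3) * p$1"
  "sol_inv p $ 2 = - exp (- p$3) * p$2"
  "sol_inv p $ 3 = - p$3"
  by (simp_all add: sol_inv_def)

lemma sol_mult_assoc: "sol_mult (sol_mult p q) r = sol_mult p (sol_mult q r)"
  by (simp add: vec_eq_iff forall_3 distrib_left add.assoc flip: exp_add mult.assoc)

lemma sol_mult_0 [simp]: "sol_mult 0 p = p" "sol_mult p 0 = p"
  by (simp_all add: vec_eq_iff forall_3)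

lemma sol_mult_inv [simp]: "sol_mult (sol_inv p) p = 0" "sol_mult p (sol_inv p) = 0"
  by (simp_all add: vec_eq_iff forall_3 exp_minus)

lemma Sol_simps [simp]: "carrier Sol = UNIV" "mult Sol = sol_mult" "one Sol = 0"
  by (simp_all add: Sol_def)

lemma group_Sol: "group Sol"
proof (rule groupI)
  fix x assume "x \<in> carrier Sol"
  show "\<exists>y\<in>carrier Sol. y \<otimes>\<^bsub>Sol\<^esub> x = \<one>\<^bsub>Sol\<^esub>"
    by (rule bexI[of _ "sol_inv x"]) auto
qed (auto simp: sol_mult_assoc)

lemma Sol_inv [simp]: "inv\<^bsub>Sol\<^esub> p = sol_inv p"
  by (rule group.inv_equality[OF group_Sol]) auto

lemma continuous_on_vec3:
  fixes f :: "'a::topological_space \<Rightarrow> real^3"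
  assumes "continuous_on S (\<lambda>x. f x $ 1)" "continuous_on S (\<lambda>x. f x $ 2)" "continuous_on S (\<lambda>x. f x $ 3)"
  shows "continuous_on S f"
proof -
  have "continuous_on S (\<lambda>x. \<chi> i. f x $ i)"
    using assms by (intro continuous_on_vec_lambda) (metis exhaust_3)
  then show ?thesis by simp
qed

lemma continuous_on_sol_mult [continuous_intros]:
  "continuous_on S f \<Longrightarrow> continuous_on S g \<Longrightarrow> continuous_on S (\<lambda>x. sol_mult (f x) (g x))"
  by (rule continuous_on_vec3) (auto intro!: continuous_intros)

lemma continuous_on_sol_inv [continuous_intros]:
  "continuous_on S f \<Longrightarrow> continuous_on S (\<lambda>x. sol_inv (f x))"
  by (rule continuous_on_vec3) (auto intro!: continuous_intros)

lemma sol_near: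
  assumes "open W" "sol_mult p (sol_inv q) \<in> W"
  obtains e where "e > 0" "\<And>x y. x \<in> ball p e \<Longrightarrow> y \<in> ball q e \<Longrightarrow> sol_mult x (sol_inv y) \<in> W"
proof -
  let ?F = "\<lambda>z. sol_mult (fst z) (sol_inv (snd z))"
  have "open (?F -` W)"
    by (intro open_vimage assms continuous_intros)
  moreover have "(p, q) \<in> ?F -` W" using assms by auto
  ultimately obtain A B where AB: "open A" "open B" "p \<in> A" "q \<in> B" "A \<times> B \<subseteq> ?F -` W"
    by (elim open_prod_elim) auto
  obtain a where a: "a > 0" "ball p a \<subseteq> A" using AB(1,3) open_contains_ball by blast
  obtain b where b: "b > 0" "ball q b \<subseteq> B" using AB(2,4) open_contains_ball by blast
  show ?thesis
  proof (rule that)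
    show "min a b > 0" using a b by simp
    fix x y assume "x \<in> ball p (min a b)" "y \<in> ball q (min a b)"
    then have "(x, y) \<in> A \<times> B" using a b by auto
    with AB(5) have "(x, y) \<in> ?F -` W" by blast
    then show "sol_mult x (sol_inv y) \<in> W" by simp
  qed
qed

lemma sol_coset_eq_iff:
  assumes "subgroup \<Gamma> Sol"
  shows "\<Gamma> #>\<^bsub>Sol\<^esub> p = \<Gamma> #>\<^bsub>Sol\<^esub> q \<longleftrightarrow> (\<exists>\<gamma>\<in>\<Gamma>. q = sol_mult \<gamma> p)"
proof
  have 0: "0 \<in> \<Gamma>" using subgroup.one_closed[OF assms] by simp
  { assume "\<Gamma> #>\<^bsub>Sol\<^esub> p = \<Gamma> #>\<^bsub>Sol\<^esub> q"
    moreover have "q \<in> \<Gamma> #>\<^bsub>Sol\<^esub> q" using 0 unfolding r_coset_def by force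
    ultimately show "\<exists>\<gamma>\<in>\<Gamma>. q = sol_mult \<gamma> p" unfolding r_coset_def by auto }
  assume "\<exists>\<gamma>\<in>\<Gamma>. q = sol_mult \<gamma> p"
  then have "q \<in> \<Gamma> #>\<^bsub>Sol\<^esub> p" unfolding r_coset_def by auto
  then show "\<Gamma> #>\<^bsub>Sol\<^esub> p = \<Gamma> #>\<^bsub>Sol\<^esub> q"
    using group.repr_independence[OF group_Sol _ _ assms] by simp
qed

lemma discrete_subgroup_ball:
  assumes "subgroup \<Gamma> Sol" "discrete \<Gamma>"
  obtains W where "open W" "W \<inter> \<Gamma> = {0}"
  using assms subgroup.one_closed[OF assms(1)] unfolding discrete_def isolated_in_def by auto

lemma sol_quotient_inj_near:
  assumes "subgroup \<Gamma> Sol" "discrete \<Gamma>"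
  obtains e where "e > 0" "inj_on (\<lambda>p. \<Gamma> #>\<^bsub>Sol\<^esub> p) (ball p e)"
    "\<And>x y. x \<in> ball p e \<Longrightarrow> y \<in> ball p e \<Longrightarrow> sol_mult x (sol_inv y) \<in> \<Gamma> \<Longrightarrow> x = y"
proof -
  obtain W where W: "open W" "W \<inter> \<Gamma> = {0}" by (rule discrete_subgroup_ball[OF assms])
  obtain e where e: "e > 0" "\<And>x y. x \<in> ball p e \<Longrightarrow> y \<in> ball p e \<Longrightarrow> sol_mult x (sol_inv y) \<in> W"
    by (rule sol_near[of W p p]) (use W in auto)
  have *: "x = y" if "x \<in> ball p e" "y \<in> ball p e" "sol_mult x (sol_inv y) \<in> \<Gamma>" for x y
  proof -
    have "sol_mult x (sol_inv y) = 0" using e(2)[OF that(1,2)] that(3) W by auto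
    then have "sol_mult (sol_mult x (sol_inv y)) y = y" by simp
    then show ?thesis by (simp only: sol_mult_assoc sol_mult_inv sol_mult_0)
  qed
  have "inj_on (\<lambda>p. \<Gamma> #>\<^bsub>Sol\<^esub> p) (ball p e)"
  proof (rule inj_onI)
    fix x y assume xy: "x \<in> ball p e" "y \<in> ball p e" "\<Gamma> #>\<^bsub>Sol\<^esub> x = \<Gamma> #>\<^bsub>Sol\<^esub> y"
    then obtain g where g: "g \<in> \<Gamma>" "y = sol_mult g x" using sol_coset_eq_iff[OF assms(1)] by auto
    have "sol_mult y (sol_inv x) = g" unfolding g by (simp add: sol_mult_assoc)
    with g xy *[of y x] show "x = y" by auto
  qed
  with e * show ?thesis using that by blast
qed

lemma discrete_subgroup_closed:
  assumes "subgroup \<Gamma> Sol" "discrete \<Gamma>"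
  shows "closed \<Gamma>"
  unfolding closed_limpt
proof (intro allI impI)
  fix w assume w: "w islimpt \<Gamma>"
  obtain e where e: "e > 0"
    "\<And>x y. x \<in> ball w e \<Longrightarrow> y \<in> ball w e \<Longrightarrow> sol_mult x (sol_inv y) \<in> \<Gamma> \<Longrightarrow> x = y"
    using sol_quotient_inj_near[OF assms] by metis
  obtain x where x: "x \<in> \<Gamma>" "x \<noteq> w" "dist x w < e" using w e(1) unfolding islimpt_approachable by blast
  then have "dist x w > 0" by simp
  then obtain y where y: "y \<in> \<Gamma>" "y \<noteq> w" "dist y w < dist x w"
    using w unfolding islimpt_approachable by blast
  have "sol_mult x (sol_inv y) \<in> \<Gamma>"
    using subgroup.m_closed[OF assms(1) x(1) subgroup.m_inv_closed[OF assms(1) y(1)]] by simp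
  with e(2)[of x y] x y show "w \<in> \<Gamma>" by (auto simp: dist_commute)
qed

lemma sol_quotient_overlap:
  assumes "subgroup \<Gamma> Sol" "c \<in> sol_quotient \<Gamma>" "d \<in> sol_quotient \<Gamma>"
  shows "overlap c d = (\<Union>\<gamma>\<in>\<Gamma>. {x \<in> fst c. sol_mult \<gamma> x \<in> fst d})"
    and "\<gamma> \<in> \<Gamma> \<Longrightarrow> x \<in> fst c \<Longrightarrow> sol_mult \<gamma> x \<in> fst d \<Longrightarrow> transition c d x = sol_mult \<gamma> x"
proof -
  obtain D D' where [simp]: "c = (D, \<lambda>p. \<Gamma> #>\<^bsub>Sol\<^esub> p)" "d = (D', \<lambda>p. \<Gamma> #>\<^bsub>Sol\<^esub> p)"
    and inj: "inj_on (\<lambda>p. \<Gamma> #>\<^bsub>Sol\<^esub> p) D'"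
    using assms unfolding sol_quotient_def by auto
  show "overlap c d = (\<Union>\<gamma>\<in>\<Gamma>. {x \<in> fst c. sol_mult \<gamma> x \<in> fst d})"
    unfolding overlap_def by (auto simp: image_iff sol_coset_eq_iff[OF assms(1)])
  assume "\<gamma> \<in> \<Gamma>" "x \<in> fst c" "sol_mult \<gamma> x \<in> fst d"
  moreover from this have "\<Gamma> #>\<^bsub>Sol\<^esub> x = \<Gamma> #>\<^bsub>Sol\<^esub> sol_mult \<gamma> x"
    using sol_coset_eq_iff[OF assms(1)] by blast
  ultimately show "transition c d x = sol_mult \<gamma> x"
    using inj by (simp add: transition_def)
qed

lemma open_sol_left: "open D \<Longrightarrow> open {x. sol_mult \<gamma> x \<in> D}"
  using open_vimage[of D "sol_mult \<gamma>"] continuous_on_sol_mult[of UNIV "\<lambda>_. \<gamma>" "\<lambda>x. x"]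
  by (simp add: vimage_def)

lemma sol_left_translation:
  "(sol_mult \<gamma> has_derivative (\<lambda>h. vector [exp (- \<gamma>$3) * h$1, exp (\<gamma>$3) * h$2, h$3])) (at x)"
proof -
  let ?L = "\<lambda>h::real^3. vector [exp (- \<gamma>$3) * h$1, exp (\<gamma>$3) * h$2, h$3] :: real^3"
  have "sol_mult \<gamma> = (\<lambda>x. \<gamma> + ?L x)"
    by (simp add: fun_eq_iff vec_eq_iff forall_3)
  moreover have "linear ?L"
    by (rule linearI) (simp_all add: vec_eq_iff forall_3 algebra_simps)
  then have "(?L has_derivative ?L) (at x)"
    by (simp add: linear_imp_has_derivative)
  then have "((\<lambda>x. \<gamma> + ?L x) has_derivative ?L) (at x)"
    by (auto intro!: derivative_eq_intros)
  ultimately show ?thesis by simp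
qed

lemma partial_eqI: "(f has_derivative f') (at x) \<Longrightarrow> partial a f x = f' (axis a 1)"
  by (simp add: partial_def flip: frechet_derivative_at)

lemma Ck_on_const: "Ck_on k D (\<lambda>_. c)"
proof (induction k arbitrary: c)
  case (Suc k)
  have "partial a (\<lambda>_. c) = (\<lambda>_. 0)" for a
    by (rule ext, rule partial_eqI[THEN trans]) (rule has_derivative_const, simp)
  with Suc show ?case by simp
qed simp

lemma Ck_on_sol_left: "Ck_on k D (sol_mult \<gamma>)"
proof (cases k)
  case 0
  then show ?thesis by (auto intro!: continuous_intros)
next
  case (Suc m)
  have "partial a (sol_mult \<gamma>) =
     (\<lambda>_. vector [exp (- \<gamma>$3) * axis a 1$1, exp (\<gamma>$3) * axis a 1$2, axis a 1$3])" for a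
    using partial_eqI[OF sol_left_translation] by blast
  with Suc show ?thesis using sol_left_translation by (auto simp: differentiable_def Ck_on_const)
qed

lemma has_derivative_cong_open:
  assumes "open U" "x \<in> U" "\<And>y. y \<in> U \<Longrightarrow> f y = h y"
  shows "(f has_derivative L) (at x) \<longleftrightarrow> (h has_derivative L) (at x)"
  using assms has_derivative_transform_within_open by metis

lemma partial_cong_open:
  assumes "open U" "x \<in> U" "\<And>y. y \<in> U \<Longrightarrow> f y = h y"
  shows "partial a f x = partial a h x"
  by (simp add: partial_def frechet_derivative_def has_derivative_cong_open[OF assms])

lemma Ck_on_local:
  assumes "\<And>x. x \<in> D \<Longrightarrow> \<exists>U h. open U \<and> x \<in> U \<and> Ck_on k U h \<and> (\<forall>y\<in>U. f y = h y)"
  shows "Ck_on k D f"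
  using assms
proof (induction k arbitrary: f)
  case 0
  have "continuous (at x within D) f" if x: "x \<in> D" for x
  proof -
    obtain U h where U: "open U" "x \<in> U" "continuous_on U h" "\<forall>y\<in>U. f y = h y"
      using 0[OF x] by auto
    then have "continuous_on U f" by (metis continuous_on_cong)
    with U have "isCont f x" using continuous_on_eq_continuous_at[OF U(1)] by blast
    then show ?thesis by (rule continuous_at_imp_continuous_at_within)
  qed
  then show ?case by (simp add: continuous_on_eq_continuous_within)
next
  case (Suc k)
  have "f differentiable at x" if x: "x \<in> D" for x
  proof -
    obtain U h where "open U" "x \<in> U" "h differentiable at x" "\<And>y. y \<in> U \<Longrightarrow> f y = h y"
      using Suc.prems[OF x] by (auto simp: Ball_def)
    then show ?thesis unfolding differentiable_def using has_derivative_cong_open by metis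
  qed
  moreover have "Ck_on k D (partial a f)" for a
  proof (rule Suc.IH)
    fix x assume "x \<in> D"
    then obtain U h where U: "open U" "x \<in> U" "Ck_on (Suc k) U h" "\<And>y. y \<in> U \<Longrightarrow> f y = h y"
      using Suc.prems by meson
    then show "\<exists>U h. open U \<and> x \<in> U \<and> Ck_on k U h \<and> (\<forall>y\<in>U. partial a f y = h y)"
      using partial_cong_open[of U _ f h a] by (intro exI[of _ U] exI[of _ "partial a h"]) auto
  qed
  ultimately show ?case by simp
qed

lemma jacobian_transition:
  assumes "subgroup \<Gamma> Sol" "c \<in> sol_quotient \<Gamma>" "d \<in> sol_quotient \<Gamma>"
    and "\<gamma> \<in> \<Gamma>" "x \<in> fst c" "sol_mult \<gamma> x \<in> fst d"
  shows "jacobian (transition c d) (at x) =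
    vector [vector [exp (- \<gamma>$3), 0, 0], vector [0, exp (\<gamma>$3), 0], vector [0, 0, 1]]"
proof -
  have o: "open (fst c)" "open (fst d)" using assms unfolding sol_quotient_def by auto
  let ?U = "{y \<in> fst c. sol_mult \<gamma> y \<in> fst d}"
  have "open ?U" using o open_sol_left open_Int[of "fst c" "{y. sol_mult \<gamma> y \<in> fst d}"]
    by (simp add: Collect_conj_eq)
  moreover have "x \<in> ?U" using assms by simp
  moreover have "transition c d y = sol_mult \<gamma> y" if "y \<in> ?U" for y
    using that sol_quotient_overlap(2)[OF assms(1-4)] by simp
  ultimately have "(transition c d has_derivative
      (\<lambda>h. vector [exp (- \<gamma>$3) * h$1, exp (\<gamma>$3) * h$2, h$3])) (at x)"
    using has_derivative_cong_open[of ?U x "transition c d" "sol_mult \<gamma>"] sol_left_translation by blast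
  from frechet_derivative_at[OF this, symmetric] show ?thesis
    by (simp add: jacobian_def matrix_def vec_eq_iff forall_3 axis_def)
qed

lemma istopology_sol_quotient:
  "istopology (\<lambda>U. U \<subseteq> rcosets\<^bsub>Sol\<^esub> \<Gamma> \<and> open {p. \<Gamma> #>\<^bsub>Sol\<^esub> p \<in> U})"
  unfolding istopology_def
proof (intro conjI allI impI)
  fix S T assume "S \<subseteq> rcosets\<^bsub>Sol\<^esub> \<Gamma> \<and> open {p. \<Gamma> #>\<^bsub>Sol\<^esub> p \<in> S}" "T \<subseteq> rcosets\<^bsub>Sol\<^esub> \<Gamma> \<and> open {p. \<Gamma> #>\<^bsub>Sol\<^esub> p \<in> T}"
  then show "S \<inter> T \<subseteq> rcosets\<^bsub>Sol\<^esub> \<Gamma>" "open {p. \<Gamma> #>\<^bsub>Sol\<^esub> p \<in> S \<inter> T}"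
    using open_Int[of "{p. \<Gamma> #>\<^bsub>Sol\<^esub> p \<in> S}" "{p. \<Gamma> #>\<^bsub>Sol\<^esub> p \<in> T}"] by (auto simp: Collect_conj_eq)
next
  fix K assume K: "\<forall>S\<in>K. S \<subseteq> rcosets\<^bsub>Sol\<^esub> \<Gamma> \<and> open {p. \<Gamma> #>\<^bsub>Sol\<^esub> p \<in> S}"
  then show "\<Union>K \<subseteq> rcosets\<^bsub>Sol\<^esub> \<Gamma>" by auto
  have "{p. \<Gamma> #>\<^bsub>Sol\<^esub> p \<in> \<Union>K} = (\<Union>S\<in>K. {p. \<Gamma> #>\<^bsub>Sol\<^esub> p \<in> S})" by auto
  with K show "open {p. \<Gamma> #>\<^bsub>Sol\<^esub> p \<in> \<Union>K}" by auto
qed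

lemma openin_sol_quotient:
  "openin (sol_quotient_topology \<Gamma>) U \<longleftrightarrow> U \<subseteq> rcosets\<^bsub>Sol\<^esub> \<Gamma> \<and> open {p. \<Gamma> #>\<^bsub>Sol\<^esub> p \<in> U}"
  unfolding sol_quotient_topology_def by (simp add: topology_inverse'[OF istopology_sol_quotient])

lemma rcosets_Sol: "rcosets\<^bsub>Sol\<^esub> \<Gamma> = range (\<lambda>p. \<Gamma> #>\<^bsub>Sol\<^esub> p)"
  by (auto simp: RCOSETS_def)

lemma points_sol_quotient:
  assumes "subgroup \<Gamma> Sol" "discrete \<Gamma>"
  shows "points (sol_quotient \<Gamma>) = rcosets\<^bsub>Sol\<^esub> \<Gamma>"
proof
  show "points (sol_quotient \<Gamma>) \<subseteq> rcosets\<^bsub>Sol\<^esub> \<Gamma>"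
    by (auto simp: points_def sol_quotient_def rcosets_Sol)
  show "rcosets\<^bsub>Sol\<^esub> \<Gamma> \<subseteq> points (sol_quotient \<Gamma>)"
    unfolding rcosets_Sol
  proof (rule image_subsetI)
    fix p
    obtain e where "e > 0" "inj_on (\<lambda>p. \<Gamma> #>\<^bsub>Sol\<^esub> p) (ball p e)" using sol_quotient_inj_near[OF assms] by metis
    then show "\<Gamma> #>\<^bsub>Sol\<^esub> p \<in> points (sol_quotient \<Gamma>)"
      unfolding points_def sol_quotient_def by (auto intro!: exI[of _ "ball p e"])
  qed
qed

lemma manifold_topology_sol_quotient:
  assumes "subgroup \<Gamma> Sol" "discrete \<Gamma>"
  shows "manifold_topology (sol_quotient \<Gamma>) = sol_quotient_topology \<Gamma>"
proof -
  have "(\<forall>(D, \<psi>)\<in>sol_quotient \<Gamma>. open {x\<in>D. \<psi> x \<in> U}) \<longleftrightarrow> open {p. \<Gamma> #>\<^bsub>Sol\<^esub> p \<in> U}" for U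
  proof
    assume "open {p. \<Gamma> #>\<^bsub>Sol\<^esub> p \<in> U}"
    from open_Int[OF _ this] show "\<forall>(D, \<psi>)\<in>sol_quotient \<Gamma>. open {x\<in>D. \<psi> x \<in> U}"
      by (auto simp: sol_quotient_def Int_def)
  next
    assume *: "\<forall>(D, \<psi>)\<in>sol_quotient \<Gamma>. open {x\<in>D. \<psi> x \<in> U}"
    show "open {p. \<Gamma> #>\<^bsub>Sol\<^esub> p \<in> U}"
    proof (subst open_subopen, rule ballI)
      fix p assume p: "p \<in> {p. \<Gamma> #>\<^bsub>Sol\<^esub> p \<in> U}"
      obtain e where e: "e > 0" "inj_on (\<lambda>p. \<Gamma> #>\<^bsub>Sol\<^esub> p) (ball p e)" using sol_quotient_inj_near[OF assms] by metis
      then have "(ball p e, \<lambda>p. \<Gamma> #>\<^bsub>Sol\<^esub> p) \<in> sol_quotient \<Gamma>" by (auto simp: sol_quotient_def)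
      with * have "open {x\<in>ball p e. \<Gamma> #>\<^bsub>Sol\<^esub> x \<in> U}" by auto
      with p e(1) show "\<exists>T. open T \<and> p \<in> T \<and> T \<subseteq> {p. \<Gamma> #>\<^bsub>Sol\<^esub> p \<in> U}" by (intro exI[of _ "{x\<in>ball p e. \<Gamma> #>\<^bsub>Sol\<^esub> x \<in> U}"]) auto
    qed
  qed
  then show ?thesis
    unfolding manifold_topology_def sol_quotient_topology_def points_sol_quotient[OF assms] by presburger
qed

lemma Hausdorff_sol_quotient:
  assumes "subgroup \<Gamma> Sol" "discrete \<Gamma>"
  shows "Hausdorff_space (sol_quotient_topology \<Gamma>)"
  unfolding Hausdorff_space_def
proof (intro allI impI, elim conjE)
  fix P Q assume "P \<in> topspace (sol_quotient_topology \<Gamma>)" "Q \<in> topspace (sol_quotient_topology \<Gamma>)" "P \<noteq> Q"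
  then obtain p q where pq: "P = \<Gamma> #>\<^bsub>Sol\<^esub> p" "Q = \<Gamma> #>\<^bsub>Sol\<^esub> q"
    unfolding topspace_def openin_sol_quotient rcosets_Sol by blast
  let ?O = "\<lambda>B. (\<lambda>p. \<Gamma> #>\<^bsub>Sol\<^esub> p) ` B"
  have op: "openin (sol_quotient_topology \<Gamma>) (?O B)" if "open B" for B
  proof -
    have "{p. \<Gamma> #>\<^bsub>Sol\<^esub> p \<in> ?O B} = (\<Union>\<gamma>\<in>\<Gamma>. {x. sol_mult \<gamma> x \<in> B})"
      by (auto simp: image_iff sol_coset_eq_iff[OF assms(1)])
    then show ?thesis using open_sol_left[OF that] unfolding openin_sol_quotient rcosets_Sol by auto
  qed
  have "sol_mult p (sol_inv q) \<notin> \<Gamma>"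
  proof
    assume g: "sol_mult p (sol_inv q) \<in> \<Gamma>"
    have "p = sol_mult (sol_mult p (sol_inv q)) q" by (simp add: sol_mult_assoc)
    with g have "Q = P" unfolding pq using sol_coset_eq_iff[OF assms(1)] by blast
    with \<open>P \<noteq> Q\<close> show False by simp
  qed
  then obtain e where e: "e > 0" "\<And>x y. x \<in> ball p e \<Longrightarrow> y \<in> ball q e \<Longrightarrow> sol_mult x (sol_inv y) \<in> - \<Gamma>"
    using sol_near[of "- \<Gamma>" p q] discrete_subgroup_closed[OF assms] by auto
  have "disjnt (?O (ball p e)) (?O (ball q e))"
  proof (clarsimp simp: disjnt_iff)
    fix x y assume xy: "dist p x < e" "dist q y < e" "\<Gamma> #>\<^bsub>Sol\<^esub> x = \<Gamma> #>\<^bsub>Sol\<^esub> y"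
    then obtain g where "g \<in> \<Gamma>" "x = sol_mult g y" using sol_coset_eq_iff[OF assms(1)] by metis
    moreover from this have "sol_mult x (sol_inv y) = g" by (simp add: sol_mult_assoc)
    ultimately show False using e(2)[of x y] xy by auto
  qed
  then show "\<exists>U V. openin (sol_quotient_topology \<Gamma>) U \<and> openin (sol_quotient_topology \<Gamma>) V \<and> P \<in> U \<and> Q \<in> V \<and> disjnt U V"
    using e(1) op[OF open_ball] pq by (intro exI[of _ "?O (ball p e)"] exI[of _ "?O (ball q e)"]) auto
qed

lemma smooth_on_sol_metric: "smooth_on D sol_metric"
proof -
  define F :: "real \<Rightarrow> real \<Rightarrow> real \<Rightarrow> real^3 \<Rightarrow> real^3^3" where
    "F a b c p = exp (2 * p$3) *\<^sub>R vector [vector [a, 0, 0], 0, 0]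
       + exp (- 2 * p$3) *\<^sub>R vector [0, vector [0, b, 0], 0] + vector [0, 0, vector [0, 0, c]]" for a b c p
  have d: "(F a b c has_derivative (\<lambda>h. h$3 *\<^sub>R F (2 * a) (- 2 * b) 0 x)) (at x)" for a b c x
    unfolding F_def
    by (auto intro!: derivative_eq_intros bounded_linear.has_derivative[OF bounded_linear_vec_nth]
        simp: fun_eq_iff vec_eq_iff forall_3 algebra_simps)
  have "Ck_on k D (F a b c)" for k a b c
  proof (induction k arbitrary: a b c)
    case 0
    show ?case using has_derivative_continuous[OF d] by (simp add: continuous_at_imp_continuous_on)
  next
    case (Suc k)
    have "partial i (F a b c) = (if i = 3 then F (2 * a) (- 2 * b) 0 else F 0 0 0)" for i
      using partial_eqI[OF d]
      by (auto simp: fun_eq_iff axis_def F_def vec_eq_iff forall_3)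
    with Suc show ?case using differentiableI[OF d] by simp
  qed
  moreover have *: "sol_metric = F 1 1 1"
    by (simp add: fun_eq_iff sol_metric_def F_def vec_eq_iff forall_3)
  ultimately show ?thesis unfolding smooth_on_def by (subst *) blast
qed

lemma sol_quotient_closed_oriented:
  assumes "sol_lattice \<Gamma>"
  shows "closed_oriented_3manifold (sol_quotient \<Gamma>)"
proof -
  have G: "subgroup \<Gamma> Sol" "discrete \<Gamma>" "compact_space (sol_quotient_topology \<Gamma>)"
    using assms by (auto simp: sol_lattice_def)
  have op: "open {x \<in> fst c. sol_mult \<gamma> x \<in> fst d}"
    if "c \<in> sol_quotient \<Gamma>" "d \<in> sol_quotient \<Gamma>" for c d \<gamma>
  proof -
    have "open (fst c)" "open (fst d)" using that by (auto simp: sol_quotient_def)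
    then show ?thesis using open_Int[of "fst c" "{y. sol_mult \<gamma> y \<in> fst d}"] open_sol_left
      by (simp add: Collect_conj_eq)
  qed
  show ?thesis
    unfolding closed_oriented_3manifold_def
  proof (intro conjI ballI)
    show "case c of (D, \<psi>) \<Rightarrow> open D \<and> inj_on \<psi> D" if "c \<in> sol_quotient \<Gamma>" for c
      using that by (auto simp: sol_quotient_def)
    show "Hausdorff_space (manifold_topology (sol_quotient \<Gamma>))"
      "compact_space (manifold_topology (sol_quotient \<Gamma>))"
      using G Hausdorff_sol_quotient by (simp_all add: manifold_topology_sol_quotient)
  next
    fix c d assume cd: "c \<in> sol_quotient \<Gamma>" "d \<in> sol_quotient \<Gamma>"
    note ov = sol_quotient_overlap[OF G(1) cd]
    show "open (overlap c d)" unfolding ov(1) using op[OF cd] by blast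
    show "smooth_on (overlap c d) (transition c d)" unfolding smooth_on_def
    proof (intro allI Ck_on_local)
      fix k x assume "x \<in> overlap c d"
      then obtain \<gamma> where g: "\<gamma> \<in> \<Gamma>" "x \<in> fst c" "sol_mult \<gamma> x \<in> fst d" unfolding ov(1) by auto
      then show "\<exists>U h. open U \<and> x \<in> U \<and> Ck_on k U h \<and> (\<forall>y\<in>U. transition c d y = h y)"
        using op[OF cd, of \<gamma>] ov(2)[OF g(1)]
        by (intro exI[of _ "{x \<in> fst c. sol_mult \<gamma> x \<in> fst d}"] exI[of _ "sol_mult \<gamma>"])
           (auto intro: Ck_on_sol_left)
    qed
    fix x assume "x \<in> overlap c d"
    then obtain \<gamma> where g: "\<gamma> \<in> \<Gamma>" "x \<in> fst c" "sol_mult \<gamma> x \<in> fst d" unfolding ov(1) by auto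
    then show "det (jacobian (transition c d) (at x)) > 0"
      by (simp add: jacobian_transition[OF G(1) cd g] det_3)
  qed
qed

lemma sol_quotient_riemannian:
  assumes "sol_lattice \<Gamma>"
  shows "riemannian_metric (sol_quotient \<Gamma>) sol_quotient_metric"
  unfolding riemannian_metric_def Let_def
proof (intro conjI ballI allI impI)
  have G: "subgroup \<Gamma> Sol" using assms by (auto simp: sol_lattice_def)
  fix c assume c: "c \<in> sol_quotient \<Gamma>"
  show "smooth_on (fst c) (sol_quotient_metric c)"
    by (simp add: sol_quotient_metric_def smooth_on_sol_metric)
  show "transpose (sol_quotient_metric c x) = sol_quotient_metric c x" for x
    by (simp add: sol_quotient_metric_def sol_metric_def transpose_def vec_eq_iff forall_3)
  show "v \<bullet> (sol_quotient_metric c x *v v) > 0" if "v \<noteq> 0" for x v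
  proof -
    have "v \<bullet> (sol_quotient_metric c x *v v) = exp (2 * x$3) * (v$1)\<^sup>2 + exp (- 2 * x$3) * (v$2)\<^sup>2 + (v$3)\<^sup>2"
      by (simp add: sol_quotient_metric_def sol_metric_def inner_vec_def sum_3
          matrix_vector_mult_def power2_eq_square)
    moreover have "v$1 \<noteq> 0 \<or> v$2 \<noteq> 0 \<or> v$3 \<noteq> 0" using that by (auto simp: vec_eq_iff forall_3)
    ultimately show ?thesis
      by (auto simp: add_pos_nonneg add_nonneg_pos)
  qed
  fix d x assume d: "d \<in> sol_quotient \<Gamma>" and "x \<in> overlap c d"
  then obtain \<gamma> where g: "\<gamma> \<in> \<Gamma>" "x \<in> fst c" "sol_mult \<gamma> x \<in> fst d"
    unfolding sol_quotient_overlap(1)[OF G c d] by auto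
  show "sol_quotient_metric c x = transpose (jacobian (transition c d) (at x)) **
      sol_quotient_metric d (transition c d x) ** jacobian (transition c d) (at x)"
    unfolding jacobian_transition[OF G c d g] sol_quotient_overlap(2)[OF G c d g]
    by (simp add: sol_quotient_metric_def sol_metric_def transpose_def vec_eq_iff forall_3
        matrix_matrix_mult_def sum_3 distrib_left flip: exp_add)
qed

end

theory Submission
  imports Defs
begin

text \<open>
  A section of the frame bundle is the left-invariant frame \<open>X, Y, Z\<close> rotated by a \<open>\<Gamma>\<close>-invariant map
  \<open>h\<close> from Sol to SO(3). The Chern--Simons form of the left-invariant frame vanishes, so that of the
  rotated frame is an exact form plus twice the pullback under \<open>h\<close> of the Haar volume form of SO(3)
  with total mass \<open>8\<pi>\<^sup>2\<close>. It remains to see that the integral of this pullback over a fundamental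
  domain \<open>F\<close> is an integer multiple of \<open>8\<pi>\<^sup>2\<close>.

  Instead of de Rham theory we use the trace \<open>t\<close> of \<open>h\<close>. By Stokes the moments
  \<open>\<integral>\<^sub>F t\<^sup>n h\<^sup>*vol\<close> satisfy the same three-term recursion as the moments of the trace under Haar measure,
  so that, by Weierstrass approximation, \<open>\<integral>\<^sub>F q(t) h\<^sup>*vol\<close> is the integral of \<open>q(trace)\<close> over SO(3) times
  the degree \<open>\<integral>\<^sub>F h\<^sup>*vol / 8\<pi>\<^sup>2\<close>, for every continuous \<open>q\<close>. By Sard's theorem we may translate \<open>h\<close> so
  that the identity is a regular value. If \<open>q\<close> is supported near \<open>3\<close>, the trace of the identity, then
  the left-hand side is a sum over the finitely many preimages of the identity modulo \<open>\<Gamma>\<close>, each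
  contributing plus or minus the integral of \<open>q(trace)\<close> over SO(3); so the degree is an integer.
\<close>

section \<open>Calculus of partial derivatives\<close>

text \<open>Everything lives on R^3 and is invariant under \<Gamma>. A fundamental domain is merely
  a Borel set, without a boundary to which Stokes could be applied. The divergence theorem comes
  from flows instead: those of X, Y, Z are right translations, which commute with \<Gamma> and
  preserve volume.

  The trace works as a test function because its derivative along \<open>hat u ** h\<close> is minus
  the scalar product of u with \<open>axial h\<close>, while both the squared length of
  \<open>axial h\<close> and its divergence are polynomials in the trace. Contracting the volume
  form with t^n times \<open>axial\<close> therefore produces nothing but moments of t. The
  recursion leaves only the zeroth moment free, and this is the unknown degree.

  Functions of the trace can localise at a single rotation only, the identity, the unique rotation
  of trace 3. Hence the regular value has to be moved there; a constant rotation does this without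
  changing the pulled back volume form.

  The normalisation then fits: a degree N contributes 2 * 8 pi^2 N to the integral, and the factor
  -1/(16 pi^2) makes it the integer -N.\<close>

lemma differentiable_frechet:
  assumes "f differentiable at x"
  shows "(f has_derivative frechet_derivative f (at x)) (at x)"
  using assms by (simp add: frechet_derivative_works)

lemma vec3_eq_sum_axis: "(v::real^3) = (\<Sum>a\<in>UNIV. v $ a *\<^sub>R axis a 1)"
  by (simp add: vec_eq_iff sum_3 axis_def forall_3)

lemma frechet_derivative_partial:
  assumes "f differentiable at x"
  shows "frechet_derivative f (at x) v = (\<Sum>a\<in>UNIV. v $ a *\<^sub>R partial a f x)"
proof -
  interpret linear "frechet_derivative f (at x)"
    using differentiable_frechet[OF assms] by (rule has_derivative_linear)
  show ?thesis
    by (subst vec3_eq_sum_axis[of v]) (simp add: sum scale partial_def)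
qed

lemma has_derivative_partial:
  assumes "f differentiable at x"
  shows "(f has_derivative (\<lambda>v. \<Sum>a\<in>UNIV. v $ a *\<^sub>R partial a f x)) (at x)"
  using differentiable_frechet[OF assms] frechet_derivative_partial[OF assms]
  by (simp add: has_derivative_eq_rhs fun_eq_iff)

lemma partial_const [simp]: "partial a (\<lambda>_. c) x = 0"
  by (rule partial_eqI[THEN trans], rule has_derivative_const) simp

lemma partial_add:
  assumes "f differentiable at x" "g differentiable at x"
  shows "partial a (\<lambda>y. f y + g y) x = partial a f x + partial a g x"
  using partial_eqI[OF has_derivative_add[OF assms[THEN differentiable_frechet]]]
  by (simp add: partial_def)

lemma partial_diff:
  assumes "f differentiable at x" "g differentiable at x"
  shows "partial a (\<lambda>y. f y - g y) x = partial a f x - partial a g x"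
  using partial_eqI[OF has_derivative_diff[OF assms[THEN differentiable_frechet]]]
  by (simp add: partial_def)

lemma partial_bounded_linear:
  assumes "bounded_linear L" "f differentiable at x"
  shows "partial a (\<lambda>y. L (f y)) x = L (partial a f x)"
  using partial_eqI[OF bounded_linear.has_derivative[OF assms(1) differentiable_frechet[OF assms(2)]]]
  by (simp add: partial_def)

lemma partial_bilinear:
  assumes "bounded_bilinear B" "f differentiable at x" "g differentiable at x"
  shows "partial a (\<lambda>y. B (f y) (g y)) x = B (f x) (partial a g x) + B (partial a f x) (g x)"
  using partial_eqI[OF bounded_bilinear.FDERIV[OF assms(1) assms(2,3)[THEN differentiable_frechet]]]
  by (simp add: partial_def)

lemmas partial_mult = partial_bilinear[OF bounded_bilinear_mult]
lemmas partial_inner = partial_bilinear[OF bounded_bilinear_inner]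

lemma bounded_bilinear_matrix_mult:
  "bounded_bilinear ((**) :: real^3^3 \<Rightarrow> real^3^3 \<Rightarrow> real^3^3)"
  unfolding bilinear_conv_bounded_bilinear[symmetric] bilinear_def
  by (auto intro!: linearI simp: vec_eq_iff matrix_matrix_mult_def sum_3 algebra_simps)

lemma bounded_bilinear_matrix_vector_mult:
  "bounded_bilinear ((*v) :: real^3^3 \<Rightarrow> real^3 \<Rightarrow> real^3)"
  unfolding bilinear_conv_bounded_bilinear[symmetric] bilinear_def
  by (auto intro!: linearI simp: vec_eq_iff matrix_vector_mult_def sum_3 algebra_simps)

lemma bounded_bilinear_cross3: "bounded_bilinear cross3"
  unfolding bilinear_conv_bounded_bilinear[symmetric] by (rule bilinear_cross)

lemma bounded_linear_transpose: "bounded_linear (transpose :: real^3^3 \<Rightarrow> real^3^3)"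
  unfolding linear_conv_bounded_linear[symmetric]
  by (auto intro!: linearI simp: vec_eq_iff transpose_def)

lemma bounded_linear_trace: "bounded_linear (trace :: real^3^3 \<Rightarrow> real)"
  unfolding linear_conv_bounded_linear[symmetric]
  by (auto intro!: linearI simp: trace_def sum_3 algebra_simps)

lemma bounded_linear_axis: "bounded_linear (axis i :: 'a::real_normed_vector \<Rightarrow> 'a^3)"
  by (rule bounded_linear_intro[where K = 1])
     (auto simp: vec_eq_iff axis_def norm_vec_def L2_set_def if_distrib[of norm] if_distrib[of "\<lambda>x. x^2"] cong: if_cong)

section \<open>Closure properties of the classes \<open>Ck_on\<close>\<close>

lemma Ck_on_lower: "Ck_on (Suc k) D f \<Longrightarrow> Ck_on k D f"
proof (induction k arbitrary: f)
  case 0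
  then show ?case
    by (auto intro!: continuous_at_imp_continuous_on differentiable_imp_continuous_within)
next
  case (Suc k)
  then show ?case by (metis Ck_on.simps(2))
qed

lemma Ck_on_partial: "Ck_on (Suc k) D f \<Longrightarrow> Ck_on k D (partial a f)"
  by simp

lemma Ck_on_0: "Ck_on k D f \<Longrightarrow> continuous_on D f"
  by (induction k) (auto intro!: continuous_at_imp_continuous_on differentiable_imp_continuous_within)

text \<open>Like the other closure rules, on the whole space: \<open>partial\<close> is meaningful
  only where its function is differentiable, and the induction needs the sum rule as an equation
  between functions.\<close>

lemma Ck_on_add:
  "Ck_on k UNIV f \<Longrightarrow> Ck_on k UNIV g \<Longrightarrow> Ck_on k UNIV (\<lambda>x. f x + g x)"
proof (induction k arbitrary: f g)
  case (Suc k)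
  have "partial a (\<lambda>x. f x + g x) = (\<lambda>x. partial a f x + partial a g x)" for a
    using Suc.prems by (auto simp: fun_eq_iff intro!: partial_add)
  with Suc show ?case by (auto intro: differentiable_add)
qed (auto intro: continuous_on_add)

lemma Ck_on_bounded_linear:
  assumes "bounded_linear L"
  shows "Ck_on k UNIV f \<Longrightarrow> Ck_on k UNIV (\<lambda>x. L (f x))"
proof (induction k arbitrary: f)
  case 0
  then show ?case using bounded_linear.continuous_on[OF assms] by auto
next
  case (Suc k)
  have "partial a (\<lambda>x. L (f x)) = (\<lambda>x. L (partial a f x))" for a
    using Suc.prems by (auto simp: fun_eq_iff intro!: partial_bounded_linear assms)
  moreover have "(\<lambda>x. L (f x)) differentiable at x" for x
    using differentiableI[OF bounded_linear.has_derivative[OF assms differentiable_frechet]] Suc.prems by auto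
  ultimately show ?case using Suc by auto
qed

lemma Ck_on_bilinear:
  assumes "bounded_bilinear B"
  shows "Ck_on k UNIV f \<Longrightarrow> Ck_on k UNIV g \<Longrightarrow> Ck_on k UNIV (\<lambda>x. B (f x) (g x))"
proof (induction k arbitrary: f g)
  case 0
  then show ?case using bounded_bilinear.continuous_on[OF assms] by auto
next
  case (Suc k)
  have "partial a (\<lambda>x. B (f x) (g x)) = (\<lambda>x. B (f x) (partial a g x) + B (partial a f x) (g x))" for a
    using Suc.prems by (auto simp: fun_eq_iff intro!: partial_bilinear assms)
  \<comment> \<open>The induction hypothesis wants both factors in the same class, so the
    undifferentiated one is lowered from \<open>Suc k\<close> to \<open>k\<close>.\<close>
  moreover have "Ck_on k UNIV (\<lambda>x. B (f x) (partial a g x) + B (partial a f x) (g x))" for a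
    using Suc.prems Ck_on_lower[OF Suc.prems(1)] Ck_on_lower[OF Suc.prems(2)]
    by (intro Ck_on_add Suc.IH) (auto simp del: Ck_on.simps(2) intro: Ck_on_partial)
  moreover have "(\<lambda>x. B (f x) (g x)) differentiable at x" for x
    by (rule differentiableI[OF bounded_bilinear.FDERIV[OF assms differentiable_frechet differentiable_frechet]])
      (use Suc.prems in auto)
  ultimately show ?case by auto
qed

lemmas Ck_on_mult = Ck_on_bilinear[OF bounded_bilinear_mult]

lemma Ck_on_sum:
  "(\<And>i. i \<in> I \<Longrightarrow> Ck_on k UNIV (f i)) \<Longrightarrow> Ck_on k UNIV (\<lambda>x. \<Sum>i\<in>I. f i x)"
  by (induction I rule: infinite_finite_induct) (auto simp: Ck_on_const intro: Ck_on_add)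

text \<open>The component type is an arbitrary normed space, so two applications reduce a
  matrix-valued function to its entries.\<close>

lemma Ck_on_componentwise:
  fixes f :: "real^3 \<Rightarrow> 'a::real_normed_vector^3"
  assumes "\<And>i. Ck_on k UNIV (\<lambda>x. f x $ i)"
  shows "Ck_on k UNIV f"
proof -
  have "f = (\<lambda>x. \<Sum>i\<in>UNIV. axis i (f x $ i))"
    by (simp add: fun_eq_iff vec_eq_iff sum_3 axis_def forall_3)
  moreover have "Ck_on k UNIV (\<lambda>x. \<Sum>i\<in>UNIV. axis i (f x $ i))"
    by (intro Ck_on_sum Ck_on_bounded_linear[OF bounded_linear_axis] assms)
  ultimately show ?thesis by simp
qed

lemma has_derivative_exp_nth:
  "((\<lambda>x::real^3. exp (c * x $ i)) has_derivative (\<lambda>v. c * v $ i * exp (c * x $ i))) (at x)"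
proof -
  have "((\<lambda>x::real^3. x $ i) has_derivative (\<lambda>v. v $ i)) (at x)"
    by (rule bounded_linear_imp_has_derivative) (rule bounded_linear_vec_nth)
  then show ?thesis by (auto intro!: derivative_eq_intros simp: fun_eq_iff)
qed

text \<open>The factor \<open>d\<close> makes the family closed under \<open>partial\<close>, as the
  induction requires: every derivative is again a multiple of the same exponential.\<close>

lemma Ck_on_exp: "Ck_on k UNIV (\<lambda>x. d * exp (c * x $ i))"
proof (induction k arbitrary: d)
  case 0
  show ?case by (auto intro!: continuous_intros)
next
  case (Suc k)
  have D: "(\<lambda>x::real^3. exp (c * x $ i)) differentiable at x" for x
    unfolding differentiable_def using has_derivative_exp_nth by blast
  have "partial a (\<lambda>x. d * exp (c * x $ i)) = (\<lambda>x. (d * c * axis a 1 $ i) * exp (c * x $ i))" for a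
    by (rule ext, subst partial_mult[OF _ D]) (auto simp: partial_eqI[OF has_derivative_exp_nth])
  then show ?case using Suc D by (auto intro: differentiable_mult)
qed

section \<open>Symmetry of second partial derivatives\<close>

lemma DERIV_partial_line:
  fixes f :: "real^3 \<Rightarrow> real"
  assumes "f differentiable at (p + u *\<^sub>R axis a 1)"
  shows "((\<lambda>u. f (p + u *\<^sub>R axis a 1)) has_real_derivative partial a f (p + u *\<^sub>R axis a 1)) (at u)"
proof -
  have "((\<lambda>u. p + u *\<^sub>R axis a 1) has_derivative (\<lambda>v. v *\<^sub>R (axis a 1::real^3))) (at u)"
    by (auto intro!: derivative_eq_intros)
  from has_derivative_compose[OF this has_derivative_partial[OF assms]]
  have "((\<lambda>u. f (p + u *\<^sub>R axis a 1)) has_derivative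
     (\<lambda>v. \<Sum>b\<in>UNIV. (v *\<^sub>R (axis a 1::real^3)) $ b *\<^sub>R partial b f (p + u *\<^sub>R axis a 1))) (at u)" .
  moreover have "(\<Sum>b\<in>UNIV. (v *\<^sub>R (axis a 1::real^3)) $ b *\<^sub>R partial b f (p + u *\<^sub>R axis a 1)) =
      partial a f (p + u *\<^sub>R axis a 1) * v" for v
    by (simp add: axis_def if_distrib if_distribR cong: if_cong)
  ultimately show ?thesis by (simp add: has_field_derivative_def)
qed

text \<open>Two applications of the mean value theorem, first in direction \<open>a\<close> to the
  difference of \<open>f\<close> in direction \<open>b\<close>, then in direction \<open>b\<close>.
  The left-hand side is symmetric in \<open>a\<close> and \<open>b\<close>, so the two orders of
  differentiation can be compared at nearby points.\<close>

lemma mixed_difference: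
  fixes f :: "real^3 \<Rightarrow> real"
  assumes f: "Ck_on 2 UNIV f" and s: "s > 0"
  obtains \<xi> \<eta> where "0 < \<xi>" "\<xi> < s" "0 < \<eta>" "\<eta> < s"
    "f (x + s *\<^sub>R axis a 1 + s *\<^sub>R axis b 1) - f (x + s *\<^sub>R axis a 1) - f (x + s *\<^sub>R axis b 1) + f x =
      s\<^sup>2 * partial b (partial a f) (x + \<xi> *\<^sub>R axis a 1 + \<eta> *\<^sub>R axis b 1)"
proof -
  have d: "f differentiable at y" "partial a f differentiable at y" for y
    using f by (auto simp: numeral_2_eq_2)
  let ?g = "\<lambda>u. f (x + s *\<^sub>R axis b 1 + u *\<^sub>R axis a 1) - f (x + u *\<^sub>R axis a 1)"
  have "\<exists>\<xi>>0. \<xi> < s \<and> ?g s - ?g 0 = (s - 0) *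
      (partial a f (x + s *\<^sub>R axis b 1 + \<xi> *\<^sub>R axis a 1) - partial a f (x + \<xi> *\<^sub>R axis a 1))"
    using MVT2[OF s, of ?g "\<lambda>u. partial a f (x + s *\<^sub>R axis b 1 + u *\<^sub>R axis a 1) - partial a f (x + u *\<^sub>R axis a 1)"]
    by (fastforce intro!: DERIV_diff DERIV_partial_line d)
  then obtain \<xi> where \<xi>: "0 < \<xi>" "\<xi> < s" "?g s - ?g 0 = (s - 0) *
      (partial a f (x + s *\<^sub>R axis b 1 + \<xi> *\<^sub>R axis a 1) - partial a f (x + \<xi> *\<^sub>R axis a 1))"
    by auto
  let ?k = "\<lambda>u. partial a f (x + \<xi> *\<^sub>R axis a 1 + u *\<^sub>R axis b 1)"
  have "\<exists>\<eta>>0. \<eta> < s \<and> ?k s - ?k 0 = (s - 0) * partial b (partial a f) (x + \<xi> *\<^sub>R axis a 1 + \<eta> *\<^sub>R axis b 1)"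
    using MVT2[OF s, of ?k "\<lambda>u. partial b (partial a f) (x + \<xi> *\<^sub>R axis a 1 + u *\<^sub>R axis b 1)"]
    by (fastforce intro!: DERIV_partial_line d)
  then obtain \<eta> where \<eta>: "0 < \<eta>" "\<eta> < s"
    "?k s - ?k 0 = (s - 0) * partial b (partial a f) (x + \<xi> *\<^sub>R axis a 1 + \<eta> *\<^sub>R axis b 1)"
    by auto
  show ?thesis
    by (rule that[OF \<xi>(1,2) \<eta>(1,2)])
       (use \<xi>(3) \<eta>(3) in \<open>simp add: power2_eq_square add_ac\<close>)
qed

lemma partial_commute_real:
  fixes f :: "real^3 \<Rightarrow> real"
  assumes f: "Ck_on 2 UNIV f"
  shows "partial a (partial b f) x = partial b (partial a f) x"
proof -
  have cont: "continuous_on UNIV (partial a (partial b f))" for a b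
    using f by (auto simp: numeral_2_eq_2)
  have "\<bar>partial a (partial b f) x - partial b (partial a f) x\<bar> \<le> 0 + e" if e: "e > 0" for e
  proof -
    have "\<exists>d>0. \<forall>y. dist y x < d \<longrightarrow> dist (partial i (partial j f) y) (partial i (partial j f) x) < e/2" for i j
      using cont[of i j] e unfolding continuous_on_iff by (metis UNIV_I half_gt_zero)
    then obtain d1 d2 where d: "d1 > 0" "d2 > 0"
      "\<And>y. dist y x < d1 \<Longrightarrow> dist (partial a (partial b f) y) (partial a (partial b f) x) < e/2"
      "\<And>y. dist y x < d2 \<Longrightarrow> dist (partial b (partial a f) y) (partial b (partial a f) x) < e/2"
      by metis
    \<comment> \<open>Each intermediate point is within \<xi> + \<eta> < 2 s of
      \<open>x\<close>.\<close>
    define s where "s = min d1 d2 / 2"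
    have s: "s > 0" using d by (simp add: s_def)
    have near: "dist (x + \<xi> *\<^sub>R axis i 1 + \<eta> *\<^sub>R axis j 1) x < min d1 d2"
      if "0 < \<xi>" "\<xi> < s" "0 < \<eta>" "\<eta> < s" for \<xi> \<eta> i j
    proof -
      have "dist (x + \<xi> *\<^sub>R axis i 1 + \<eta> *\<^sub>R axis j 1) x = norm (\<xi> *\<^sub>R axis i (1::real) + \<eta> *\<^sub>R axis j 1)"
        by (simp add: dist_norm algebra_simps)
      also have "\<dots> \<le> \<xi> + \<eta>" using that by (intro norm_triangle_le) (simp add: norm_axis_1)
      also have "\<dots> < min d1 d2" using that unfolding s_def by linarith
      finally show ?thesis .
    qed
    obtain \<xi> \<eta> where 1: "0 < \<xi>" "\<xi> < s" "0 < \<eta>" "\<eta> < s"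
      "f (x + s *\<^sub>R axis a 1 + s *\<^sub>R axis b 1) - f (x + s *\<^sub>R axis a 1) - f (x + s *\<^sub>R axis b 1) + f x =
      s\<^sup>2 * partial b (partial a f) (x + \<xi> *\<^sub>R axis a 1 + \<eta> *\<^sub>R axis b 1)"
      using mixed_difference[OF f s] by metis
    obtain \<xi>' \<eta>' where 2: "0 < \<xi>'" "\<xi>' < s" "0 < \<eta>'" "\<eta>' < s"
      "f (x + s *\<^sub>R axis b 1 + s *\<^sub>R axis a 1) - f (x + s *\<^sub>R axis b 1) - f (x + s *\<^sub>R axis a 1) + f x =
      s\<^sup>2 * partial a (partial b f) (x + \<xi>' *\<^sub>R axis b 1 + \<eta>' *\<^sub>R axis a 1)"
      using mixed_difference[OF f s] by metis
    have perm: "x + s *\<^sub>R axis b 1 + s *\<^sub>R axis a 1 = x + s *\<^sub>R axis a 1 + s *\<^sub>R axis b 1"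
      by (simp add: add_ac)
    have "s\<^sup>2 * partial b (partial a f) (x + \<xi> *\<^sub>R axis a 1 + \<eta> *\<^sub>R axis b 1) =
      s\<^sup>2 * partial a (partial b f) (x + \<xi>' *\<^sub>R axis b 1 + \<eta>' *\<^sub>R axis a 1)"
      using 1(5) 2(5)[unfolded perm] by linarith
    then have "partial b (partial a f) (x + \<xi> *\<^sub>R axis a 1 + \<eta> *\<^sub>R axis b 1) =
      partial a (partial b f) (x + \<xi>' *\<^sub>R axis b 1 + \<eta>' *\<^sub>R axis a 1)"
      using s by simp
    moreover have "dist (partial b (partial a f) (x + \<xi> *\<^sub>R axis a 1 + \<eta> *\<^sub>R axis b 1)) (partial b (partial a f) x) < e/2"
      by (rule d(4)) (use near[OF 1(1-4), of a b] in linarith)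
    moreover have "dist (partial a (partial b f) (x + \<xi>' *\<^sub>R axis b 1 + \<eta>' *\<^sub>R axis a 1)) (partial a (partial b f) x) < e/2"
      by (rule d(3)) (use near[OF 2(1-4), of b a] in linarith)
    ultimately have "dist (partial a (partial b f) x) (partial b (partial a f) x) < e/2 + e/2"
      by (metis dist_commute dist_triangle_lt add_strict_mono dist_triangle_less_add)
    then show ?thesis unfolding dist_real_def by linarith
  qed
  then have "\<bar>partial a (partial b f) x - partial b (partial a f) x\<bar> \<le> 0"
    by (rule field_le_epsilon)
  then show ?thesis by simp
qed

lemma partial_commute:
  fixes f :: "real^3 \<Rightarrow> 'a::euclidean_space"
  assumes f: "Ck_on 2 UNIV f"
  shows "partial a (partial b f) x = partial b (partial a f) x"
proof (rule euclidean_eqI)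
  fix e :: 'a
  have d: "f differentiable at y" "partial i f differentiable at y" for y i
    using f by (auto simp: numeral_2_eq_2)
  have L: "bounded_linear (\<lambda>v. v \<bullet> e)" by (rule bounded_linear_inner_left)
  have *: "partial i (\<lambda>y. f y \<bullet> e) = (\<lambda>y. partial i f y \<bullet> e)" for i
    using partial_bounded_linear[OF L d(1)] by auto
  have **: "partial j (\<lambda>y. partial i f y \<bullet> e) y = partial j (partial i f) y \<bullet> e" for i j y
    using partial_bounded_linear[OF L d(2)] by auto
  show "partial a (partial b f) x \<bullet> e = partial b (partial a f) x \<bullet> e"
    using partial_commute_real[OF Ck_on_bounded_linear[OF L f], of a b x] by (simp only: * **)
qed

section \<open>Rotations of three-space\<close>

text \<open>The isomorphism of R^3 with the skew matrices so(3): \<open>hat u\<close> acts as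
  \<open>cross3 u\<close>, and the commutator becomes the cross product.\<close>

definition hat :: "real^3 \<Rightarrow> real^3^3" where
  "hat u = vector [vector [0, - u$3, u$2], vector [u$3, 0, - u$1], vector [- u$2, u$1, 0]]"

text \<open>Twice the vector of the skew part. For the rotation by the angle \<theta> about a unit
  vector n this is 2 sin \<theta> n.\<close>

definition axial :: "real^3^3 \<Rightarrow> real^3" where
  "axial m = vector [m$3$2 - m$2$3, m$1$3 - m$3$1, m$2$1 - m$1$2]"

lemmas expand3 = vec_eq_iff forall_3 sum_3 matrix_matrix_mult_def matrix_vector_mult_def
  transpose_def trace_def inner_vec_def hat_def axial_def cross3_def mat_def

lemma axial_hat: "axial (hat u) = 2 *\<^sub>R u"
  by (simp add: expand3)

lemma hat_inject: "hat u = hat w \<longleftrightarrow> u = w"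
  by (auto simp: expand3)

lemma hat_axial_skew:
  assumes "transpose m = - m"
  shows "hat ((1/2) *\<^sub>R axial m) = m"
proof -
  have e: "m$j$i = - (m$i$j)" for i j
  proof -
    have "m$j$i = transpose m $ i $ j" by (simp add: transpose_def)
    then show ?thesis unfolding assms by simp
  qed
  have "m$i$i = 0" for i using e[of i i] by linarith
  then show ?thesis unfolding vec_eq_iff forall_3 hat_def axial_def
    using e[of 1 2] e[of 1 3] e[of 2 3] by simp
qed

lemma hat_commutator: "hat u ** hat w - hat w ** hat u = hat (cross3 u w)"
  by (simp add: expand3)

lemma hat_diff: "hat (u - w) = hat u - hat w"
  by (simp add: expand3)

lemma trace_hat_mult: "trace (hat u ** m) = - (u \<bullet> axial m)"
  by (simp add: expand3 algebra_simps)

lemma axial_hat_mult: "axial (hat u ** m) = trace m *\<^sub>R u - m *v u"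
  by (simp add: expand3 algebra_simps)

lemma bounded_linear_hat: "bounded_linear hat"
  unfolding linear_conv_bounded_linear[symmetric]
  by (auto intro!: linearI simp: expand3 algebra_simps)

lemma bounded_linear_axial: "bounded_linear axial"
  unfolding linear_conv_bounded_linear[symmetric]
  by (auto intro!: linearI simp: expand3 algebra_simps)

text \<open>The derivative of det (u, v, w) when the three vectors move by \<open>m\<close>. It will
  turn the derivative of \<open>axial\<close> into a trace.\<close>

lemma cross3_matrix_trace:
  "(m *v u) \<bullet> cross3 v w + (m *v v) \<bullet> cross3 w u + (m *v w) \<bullet> cross3 u v = trace m * (u \<bullet> cross3 v w)"
  by (simp add: expand3 algebra_simps)

section \<open>Algebra of rotation matrices\<close>

lemma rotation_inner_cross:
  assumes "rotation_matrix (R :: real^3^3)"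
  shows "(R *v u) \<bullet> (R *v v) = u \<bullet> v" "cross3 (R *v u) (R *v v) = R *v cross3 u v"
proof -
  have O: "orthogonal_matrix R" "det R = 1" using assms by (auto simp: rotation_matrix_def)
  have "orthogonal_transformation ((*v) R)"
    unfolding orthogonal_transformation_matrix using O(1) by simp
  then show "(R *v u) \<bullet> (R *v v) = u \<bullet> v" unfolding orthogonal_transformation_def by blast
  show "cross3 (R *v u) (R *v v) = R *v cross3 u v" using cross_orthogonal_matrix[OF O(1)] O(2) by simp
qed

text \<open>The adjoint action of SO(3) on so(3) is the standard action on R^3, because a rotation
  commutes with the cross product.\<close>

lemma rotation_hat_conjugate:
  fixes h :: "real^3^3"
  assumes "rotation_matrix h"
  shows "hat (h *v u) = h ** hat u ** transpose h"
proof -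
  have h: "orthogonal_matrix h" "det h = 1" using assms by (auto simp: rotation_matrix_def)
  have hatv: "hat u *v w = cross3 u w" for u w by (simp add: expand3)
  have "(hat (h *v u) ** h) *v w = (h ** hat u) *v w" for w
    using cross_orthogonal_matrix[OF h(1), of u w] h(2)
    by (simp add: hatv flip: matrix_vector_mul_assoc)
  then have "hat (h *v u) ** h = h ** hat u" using matrix_eq by blast
  then have "hat (h *v u) ** (h ** transpose h) = h ** hat u ** transpose h"
    by (simp add: matrix_mul_assoc)
  with h(1) show ?thesis by (simp add: orthogonal_matrix_def)
qed

lemma rotation_transpose:
  fixes h :: "real^3^3"
  shows "rotation_matrix h \<Longrightarrow> rotation_matrix (transpose h)"
  by (simp add: rotation_matrix_def orthogonal_matrix_transpose)

lemma rotation_mult: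
  fixes g h :: "real^3^3"
  shows "rotation_matrix g \<Longrightarrow> rotation_matrix h \<Longrightarrow> rotation_matrix (g ** h)"
  by (auto simp: rotation_matrix_def det_mul intro: orthogonal_matrix_mul)

lemma rotation_inverse:
  fixes h :: "real^3^3"
  assumes "rotation_matrix h"
  shows "transpose h ** h = mat 1" "h ** transpose h = mat 1"
  using assms by (simp_all add: rotation_matrix_def orthogonal_matrix_def)

text \<open>A rotation is its own cofactor matrix: each column is the cross product of the other two
  in cyclic order.\<close>

lemma rotation_entries:
  fixes h :: "real^3^3"
  assumes "rotation_matrix h"
  shows "h$1$1 = h$2$2 * h$3$3 - h$2$3 * h$3$2" "h$1$2 = h$2$3 * h$3$1 - h$2$1 * h$3$3"
    "h$1$3 = h$2$1 * h$3$2 - h$2$2 * h$3$1"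
    "h$2$1 = h$3$2 * h$1$3 - h$3$3 * h$1$2" "h$2$2 = h$3$3 * h$1$1 - h$3$1 * h$1$3"
    "h$2$3 = h$3$1 * h$1$2 - h$3$2 * h$1$1"
    "h$3$1 = h$1$2 * h$2$3 - h$1$3 * h$2$2" "h$3$2 = h$1$3 * h$2$1 - h$1$1 * h$2$3"
    "h$3$3 = h$1$1 * h$2$2 - h$1$2 * h$2$1"
proof -
  have h: "orthogonal_matrix h" "det h = 1" using assms by (auto simp: rotation_matrix_def)
  have "cross3 (h *v axis 1 1) (h *v axis 2 1) = h *v axis 3 1"
    "cross3 (h *v axis 2 1) (h *v axis 3 1) = h *v axis 1 1"
    "cross3 (h *v axis 3 1) (h *v axis 1 1) = h *v axis 2 1"
    by (simp_all add: cross_orthogonal_matrix[OF h(1)] h(2) cross_basis)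
  then show "h$1$1 = h$2$2 * h$3$3 - h$2$3 * h$3$2" "h$1$2 = h$2$3 * h$3$1 - h$2$1 * h$3$3"
    "h$1$3 = h$2$1 * h$3$2 - h$2$2 * h$3$1"
    "h$2$1 = h$3$2 * h$1$3 - h$3$3 * h$1$2" "h$2$2 = h$3$3 * h$1$1 - h$3$1 * h$1$3"
    "h$2$3 = h$3$1 * h$1$2 - h$3$2 * h$1$1"
    "h$3$1 = h$1$2 * h$2$3 - h$1$3 * h$2$2" "h$3$2 = h$1$3 * h$2$1 - h$1$1 * h$2$3"
    "h$3$3 = h$1$1 * h$2$2 - h$1$2 * h$2$1"
    by (simp_all add: expand3 axis_def algebra_simps)
qed

text \<open>With angle \<theta> and unit axis n one has \<open>1 + trace h\<close> = 2 (1 + cos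
  \<theta>), and n n^T enters the symmetric part of \<open>h\<close> with coefficient 1 - cos
  \<theta>; all six equations read off entries of 4 sin^2 \<theta> n n^T. The proof needs no axis,
  only orthonormality of rows and columns and the cofactor relations.\<close>

lemma rotation_axial_outer:
  fixes h :: "real^3^3"
  assumes "rotation_matrix h"
  shows "(1 + trace h) * (h$1$2 + h$2$1) = axial h $ 1 * axial h $ 2"
    "(1 + trace h) * (h$1$3 + h$3$1) = axial h $ 1 * axial h $ 3"
    "(1 + trace h) * (h$2$3 + h$3$2) = axial h $ 2 * axial h $ 3"
    "2 * (1 + trace h) * (1 - h$1$1) = axial h $ 2 * axial h $ 2 + axial h $ 3 * axial h $ 3"
    "2 * (1 + trace h) * (1 - h$2$2) = axial h $ 1 * axial h $ 1 + axial h $ 3 * axial h $ 3"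
    "2 * (1 + trace h) * (1 - h$3$3) = axial h $ 1 * axial h $ 1 + axial h $ 2 * axial h $ 2"
proof -
  have c: "(\<Sum>k\<in>UNIV. h$k$i * h$k$j) = mat 1$i$j" for i j
    using rotation_inverse(1)[OF assms] by (simp add: vec_eq_iff matrix_matrix_mult_def transpose_def)
  have r: "(\<Sum>k\<in>UNIV. h$i$k * h$j$k) = mat 1$i$j" for i j
    using rotation_inverse(2)[OF assms] by (simp add: vec_eq_iff matrix_matrix_mult_def transpose_def)
  note c' = c[unfolded sum_3 mat_def, of 1 2, simplified] c[unfolded sum_3 mat_def, of 1 3, simplified]
    c[unfolded sum_3 mat_def, of 2 3, simplified] c[unfolded sum_3 mat_def, of 1 1, simplified]
    c[unfolded sum_3 mat_def, of 2 2, simplified] c[unfolded sum_3 mat_def, of 3 3, simplified]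
  note r' = r[unfolded sum_3 mat_def, of 1 2, simplified] r[unfolded sum_3 mat_def, of 1 3, simplified]
    r[unfolded sum_3 mat_def, of 2 3, simplified] r[unfolded sum_3 mat_def, of 1 1, simplified]
    r[unfolded sum_3 mat_def, of 2 2, simplified] r[unfolded sum_3 mat_def, of 3 3, simplified]
  note e = rotation_entries[OF assms]
  have t: "trace h = h$1$1 + h$2$2 + h$3$3" by (simp add: trace_def sum_3)
  have v: "axial h $ 1 = h$3$2 - h$2$3" "axial h $ 2 = h$1$3 - h$3$1" "axial h $ 3 = h$2$1 - h$1$2"
    by (simp_all add: axial_def)
  show "(1 + trace h) * (h$1$2 + h$2$1) = axial h $ 1 * axial h $ 2"
    unfolding t v using c'(1) r'(1) e(2,4) by ((simp (no_asm_use) only: algebra_simps)?, linarith?)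
  show "(1 + trace h) * (h$1$3 + h$3$1) = axial h $ 1 * axial h $ 3"
    unfolding t v using c'(2) r'(2) e(3,7) by ((simp (no_asm_use) only: algebra_simps)?, linarith?)
  show "(1 + trace h) * (h$2$3 + h$3$2) = axial h $ 2 * axial h $ 3"
    unfolding t v using c'(3) r'(3) e(6,8) by ((simp (no_asm_use) only: algebra_simps)?, linarith?)
  show "2 * (1 + trace h) * (1 - h$1$1) = axial h $ 2 * axial h $ 2 + axial h $ 3 * axial h $ 3"
    unfolding t v using c'(4) r'(4) e(5,9) by ((simp (no_asm_use) only: algebra_simps)?, linarith?)
  show "2 * (1 + trace h) * (1 - h$2$2) = axial h $ 1 * axial h $ 1 + axial h $ 3 * axial h $ 3"
    unfolding t v using c'(5) r'(5) e(1,9) by ((simp (no_asm_use) only: algebra_simps)?, linarith?)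
  show "2 * (1 + trace h) * (1 - h$3$3) = axial h $ 1 * axial h $ 1 + axial h $ 2 * axial h $ 2"
    unfolding t v using c'(6) r'(6) e(1,5) by ((simp (no_asm_use) only: algebra_simps)?, linarith?)
qed

text \<open>Both sides are 4 sin^2 of the rotation angle. That this length is a polynomial in the
  trace is what closes the moment recursion.\<close>

lemma rotation_axial_norm:
  fixes h :: "real^3^3"
  assumes "rotation_matrix h"
  shows "axial h \<bullet> axial h = (3 - trace h) * (1 + trace h)"
proof -
  have "2 * (1 + trace h) * (1 - h$1$1) + 2 * (1 + trace h) * (1 - h$2$2) + 2 * (1 + trace h) * (1 - h$3$3)
     = 2 * (axial h \<bullet> axial h)"
    unfolding rotation_axial_outer[OF assms] by (simp add: inner_vec_def sum_3)
  moreover have "2 * (1 + trace h) * (1 - h$1$1) + 2 * (1 + trace h) * (1 - h$2$2) + 2 * (1 + trace h) * (1 - h$3$3)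
     = 2 * ((3 - trace h) * (1 + trace h))"
    by (simp add: trace_def sum_3 algebra_simps)
  ultimately show ?thesis by simp
qed

lemma rotation_trace_bounds:
  fixes h :: "real^3^3"
  assumes "rotation_matrix h"
  shows "- 1 \<le> trace h" "trace h \<le> 3"
proof -
  have "0 \<le> (3 - trace h) * (1 + trace h)" using rotation_axial_norm[OF assms] by (metis inner_ge_zero)
  then show "- 1 \<le> trace h" "trace h \<le> 3" by (auto simp: zero_le_mult_iff)
qed

text \<open>
  The rotation by the angle \<open>\<theta>\<close> around the unit vector \<open>n\<close> is \<open>cayley (tan (\<theta>/2) n)\<close>.
\<close>

definition cayley :: "real^3 \<Rightarrow> real^3^3" where
  "cayley k = (1 / (1 + k \<bullet> k)) *\<^sub>R vector
    [vector [1 + k$1 * k$1 - k$2 * k$2 - k$3 * k$3, 2 * (k$1 * k$2 - k$3), 2 * (k$1 * k$3 + k$2)],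
     vector [2 * (k$1 * k$2 + k$3), 1 - k$1 * k$1 + k$2 * k$2 - k$3 * k$3, 2 * (k$2 * k$3 - k$1)],
     vector [2 * (k$1 * k$3 - k$2), 2 * (k$2 * k$3 + k$1), 1 - k$1 * k$1 - k$2 * k$2 + k$3 * k$3]]"

lemma one_plus_inner_pos: "1 + k \<bullet> k > (0::real)"
  by (simp add: add_pos_nonneg)

lemma rotation_cayley: "rotation_matrix (cayley k)"
proof -
  have s: "1 + k \<bullet> k \<noteq> 0" using one_plus_inner_pos[of k] by simp
  define a b c where "a = k$1" and "b = k$2" and "c = k$3"
  define N :: "real^3^3" where "N = vector
    [vector [1 + a * a - b * b - c * c, 2 * (a * b - c), 2 * (a * c + b)],
     vector [2 * (a * b + c), 1 - a * a + b * b - c * c, 2 * (b * c - a)],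
     vector [2 * (a * c - b), 2 * (b * c + a), 1 - a * a - b * b + c * c]]"
  have c: "cayley k = (1 / (1 + k \<bullet> k)) *\<^sub>R N" by (simp add: N_def cayley_def a_def b_def c_def)
  have kk: "k \<bullet> k = a * a + b * b + c * c" by (simp add: a_def b_def c_def inner_vec_def sum_3)
  have N: "transpose N ** N = (1 + k \<bullet> k)\<^sup>2 *\<^sub>R mat 1"
    unfolding kk
    by (simp add: N_def vec_eq_iff forall_3 sum_3 matrix_matrix_mult_def transpose_def mat_def power2_eq_square)
       (intro conjI; algebra)
  have N': "det N = (1 + k \<bullet> k)^3"
    unfolding kk by (simp add: N_def det_3) algebra
  have scale: "transpose (r *\<^sub>R N) ** (r *\<^sub>R N) = r\<^sup>2 *\<^sub>R (transpose N ** N)" "det (r *\<^sub>R N) = r^3 * det N" for r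
    by (simp_all add: expand3 det_3 power2_eq_square power3_eq_cube algebra_simps)
  have "transpose (cayley k) ** cayley k = (1 / (1 + k \<bullet> k))\<^sup>2 *\<^sub>R (transpose N ** N)"
    unfolding c scale ..
  then have "transpose (cayley k) ** cayley k = mat 1"
    unfolding N using s by (simp add: power_divide)
  moreover have "det (cayley k) = (1 / (1 + k \<bullet> k))^3 * det N"
    unfolding c scale ..
  then have "det (cayley k) = 1" unfolding N' using s by (simp add: power_divide)
  ultimately show ?thesis by (simp add: rotation_matrix_def orthogonal_matrix)
qed

lemma trace_cayley: "trace (cayley k) = (3 - k \<bullet> k) / (1 + k \<bullet> k)"
proof -
  have scale: "trace (r *\<^sub>R N) = r * trace N" for r and N :: "real^3^3"
    by (simp add: trace_def sum_3 algebra_simps)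
  show ?thesis unfolding cayley_def scale by (simp add: trace_def inner_vec_def sum_3)
qed

lemma one_plus_trace_cayley: "1 + trace (cayley k) = 4 / (1 + k \<bullet> k)"
  using one_plus_inner_pos[of k] by (simp add: trace_cayley field_simps)

lemma axial_cayley: "axial (cayley k) = (1 + trace (cayley k)) *\<^sub>R k"
proof -
  have scale: "axial (r *\<^sub>R N) = r *\<^sub>R axial N" for r N
    by (simp add: axial_def vec_eq_iff forall_3 algebra_simps)
  have "axial (cayley k) = (4 / (1 + k \<bullet> k)) *\<^sub>R k" unfolding cayley_def scale
    by (simp add: axial_def vec_eq_iff forall_3)
  then show ?thesis unfolding one_plus_trace_cayley .
qed

text \<open>For angle \<theta> and unit axis n this is tan (\<theta>/2) n, a chart about the
  identity that omits the half turns, where the trace is -1 and the division degenerates. Hence the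
  hypothesis \<open>trace h > - 1\<close> in what follows.\<close>

definition cayley_coord :: "real^3^3 \<Rightarrow> real^3" where
  "cayley_coord h = (1 / (1 + trace h)) *\<^sub>R axial h"

lemma cayley_coord_cayley: "cayley_coord (cayley k) = k"
proof -
  have "1 + trace (cayley k) \<noteq> 0"
    using one_plus_inner_pos[of k] by (simp add: one_plus_trace_cayley)
  then show ?thesis by (simp add: cayley_coord_def axial_cayley)
qed

text \<open>Off the half turns \<open>axial h\<close> and the trace determine \<open>h\<close>:
  dividing \<open>rotation_axial_outer\<close> by \<open>1 + trace h\<close> gives the symmetric
  part, and \<open>axial h\<close> is the skew part.\<close>

lemma rotation_eq_cayley:
  fixes h :: "real^3^3"
  assumes h: "rotation_matrix h" and t: "trace h > - 1"
  shows "h = cayley (cayley_coord h)"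
proof -
  define s where "s = 1 + trace h"
  define k where "k = cayley_coord h"
  have s: "s > 0" using t by (simp add: s_def)
  have v: "axial h = s *\<^sub>R k" using s by (simp add: k_def cayley_coord_def s_def)
  have "axial h \<bullet> axial h = (4 - s) * s" by (simp add: rotation_axial_norm[OF h] s_def)
  then have "s * (k \<bullet> k) = 4 - s" using s by (simp add: v)
  then have k: "1 / (1 + k \<bullet> k) = s / 4" using s one_plus_inner_pos[of k] by (simp add: field_simps)
  have kk: "s * (k$1 * k$1 + k$2 * k$2 + k$3 * k$3) = 4 - s"
    using \<open>s * (k \<bullet> k) = 4 - s\<close> by (simp add: inner_vec_def sum_3)
  note o = rotation_axial_outer[OF h, folded s_def, unfolded v vector_scaleR_component real_scaleR_def]
  have off: "h$1$2 + h$2$1 = s * (k$1 * k$2)" "h$1$3 + h$3$1 = s * (k$1 * k$3)" "h$2$3 + h$3$2 = s * (k$2 * k$3)"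
    "2 * (1 - h$1$1) = s * (k$2 * k$2 + k$3 * k$3)" "2 * (1 - h$2$2) = s * (k$1 * k$1 + k$3 * k$3)"
    "2 * (1 - h$3$3) = s * (k$1 * k$1 + k$2 * k$2)"
  proof -
    have cancel: "a = b" if "s * a = s * b" for a b using that s by simp
    show "h$1$2 + h$2$1 = s * (k$1 * k$2)" "h$1$3 + h$3$1 = s * (k$1 * k$3)" "h$2$3 + h$3$2 = s * (k$2 * k$3)"
    "2 * (1 - h$1$1) = s * (k$2 * k$2 + k$3 * k$3)" "2 * (1 - h$2$2) = s * (k$1 * k$1 + k$3 * k$3)"
    "2 * (1 - h$3$3) = s * (k$1 * k$1 + k$2 * k$2)"
      by (rule cancel, insert o, simp (no_asm_use) only: algebra_simps)+
  qed
  have skew: "h$3$2 - h$2$3 = s * k$1" "h$1$3 - h$3$1 = s * k$2" "h$2$1 - h$1$2 = s * k$3"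
    using v by (simp_all add: axial_def vec_eq_iff forall_3)
  have "4 * h$1$1 = s * (1 + k$1 * k$1 - k$2 * k$2 - k$3 * k$3)" using off(4) kk by algebra
  moreover have "4 * h$2$2 = s * (1 - k$1 * k$1 + k$2 * k$2 - k$3 * k$3)" using off(5) kk by algebra
  moreover have "4 * h$3$3 = s * (1 - k$1 * k$1 - k$2 * k$2 + k$3 * k$3)" using off(6) kk by algebra
  moreover have "4 * h$1$2 = s * (2 * (k$1 * k$2 - k$3))" "4 * h$2$1 = s * (2 * (k$1 * k$2 + k$3))"
    using off(1) skew(3) by algebra+
  moreover have "4 * h$1$3 = s * (2 * (k$1 * k$3 + k$2))" "4 * h$3$1 = s * (2 * (k$1 * k$3 - k$2))"
    using off(2) skew(2) by algebra+
  moreover have "4 * h$2$3 = s * (2 * (k$2 * k$3 - k$1))" "4 * h$3$2 = s * (2 * (k$2 * k$3 + k$1))"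
    using off(3) skew(1) by algebra+
  ultimately have "4 *\<^sub>R h = s *\<^sub>R ((1 + k \<bullet> k) *\<^sub>R cayley k)"
    using one_plus_inner_pos[of k] unfolding cayley_def scaleR_scaleR
    by (simp add: vec_eq_iff forall_3 del: distrib_left_numeral right_diff_distrib_numeral)
  also have "\<dots> = 4 *\<^sub>R cayley k"
  proof -
    have "s * (1 + k \<bullet> k) = 4" using k one_plus_inner_pos[of k] by (simp add: field_simps)
    then show ?thesis by (simp only: scaleR_scaleR)
  qed
  finally show ?thesis by (simp add: k_def)
qed

lemma trace_cayley_coord:
  fixes h :: "real^3^3"
  assumes "rotation_matrix h" "trace h > - 1"
  shows "1 + trace h = 4 / (1 + cayley_coord h \<bullet> cayley_coord h)"
  using one_plus_trace_cayley rotation_eq_cayley[OF assms] by metis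

text \<open>
  The differential of \<open>cayley_coord\<close> at \<open>h\<close> in the direction \<open>hat u ** h\<close> is
  \<open>cayley_diff (cayley_coord h) u\<close>.
\<close>

definition cayley_diff :: "real^3 \<Rightarrow> real^3 \<Rightarrow> real^3" where
  "cayley_diff k u = (1/2) *\<^sub>R (u - cross3 k u + (k \<bullet> u) *\<^sub>R k)"

text \<open>The left-hand side is the quotient rule for \<open>axial\<close> divided by
  \<open>1 + trace\<close> in the direction \<open>hat u ** h\<close>: there \<open>axial\<close>
  changes by \<open>trace h *\<^sub>R u - h *v u\<close> and \<open>trace\<close> by
  \<open>- (u \<bullet> axial h)\<close>.\<close>

lemma cayley_diff_eq:
  fixes h :: "real^3^3"
  assumes "rotation_matrix h" "trace h > - 1"
  shows "(1 / (1 + trace h)) *\<^sub>R (trace h *\<^sub>R u - h *v u) + (cayley_coord h \<bullet> u) *\<^sub>R cayley_coord h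
    = cayley_diff (cayley_coord h) u"
proof -
  define k where "k = cayley_coord h"
  define s where "s = 1 + k \<bullet> k"
  have s: "s > 0" using one_plus_inner_pos by (simp add: s_def)
  have t: "1 + trace h = 4 / s" using trace_cayley_coord[OF assms] by (simp add: s_def k_def)
  then have t': "1 / (1 + trace h) = s / 4" using s by simp
  have tr: "s * trace h = 4 - s" using t s by (simp add: field_simps)
  have "s *\<^sub>R (trace h *\<^sub>R u - h *v u) = (4 - s) *\<^sub>R u - (s *\<^sub>R h) *v u"
    by (simp add: tr scaleR_diff_right flip: scaleR_matrix_vector_assoc)
  also have "s *\<^sub>R h = s *\<^sub>R cayley k" using rotation_eq_cayley[OF assms] by (simp add: k_def)
  also have "\<dots> = vector
    [vector [1 + k$1 * k$1 - k$2 * k$2 - k$3 * k$3, 2 * (k$1 * k$2 - k$3), 2 * (k$1 * k$3 + k$2)],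
     vector [2 * (k$1 * k$2 + k$3), 1 - k$1 * k$1 + k$2 * k$2 - k$3 * k$3, 2 * (k$2 * k$3 - k$1)],
     vector [2 * (k$1 * k$3 - k$2), 2 * (k$2 * k$3 + k$1), 1 - k$1 * k$1 - k$2 * k$2 + k$3 * k$3]]" (is "_ = ?N")
    using s unfolding cayley_def s_def[symmetric] by simp
  also have "(4 - s) *\<^sub>R u - ?N *v u = 2 *\<^sub>R u - 2 *\<^sub>R cross3 k u - 2 *\<^sub>R ((k \<bullet> u) *\<^sub>R k)"
    unfolding vec_eq_iff forall_3
    by (simp add: matrix_vector_mult_def sum_3 cross3_def s_def inner_vec_def) (intro conjI; algebra)
  finally have eq: "s *\<^sub>R (trace h *\<^sub>R u - h *v u) = 2 *\<^sub>R u - 2 *\<^sub>R cross3 k u - 2 *\<^sub>R ((k \<bullet> u) *\<^sub>R k)" .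
  have "(s / 4) *\<^sub>R (trace h *\<^sub>R u - h *v u) = (1/4) *\<^sub>R (s *\<^sub>R (trace h *\<^sub>R u - h *v u))" by simp
  also note eq
  finally have eq': "(s / 4) *\<^sub>R (trace h *\<^sub>R u - h *v u) = (1/4) *\<^sub>R (2 *\<^sub>R u - 2 *\<^sub>R cross3 k u - 2 *\<^sub>R ((k \<bullet> u) *\<^sub>R k))" .
  have "(1/4) *\<^sub>R (2 *\<^sub>R a - 2 *\<^sub>R b - 2 *\<^sub>R c) + c = (1/2) *\<^sub>R (a - b + c)" for a b c :: "real^3"
    by (simp add: vec_eq_iff field_simps)
  then show ?thesis unfolding k_def[symmetric] t' cayley_diff_def eq' .
qed

text \<open>On row vectors \<open>cayley_diff k\<close> is right multiplication by half of 1 +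
  \<open>hat k\<close> + k k^T, a matrix whose determinant is (1 + |k|^2)^2. The resulting factor is
  the reciprocal of the Haar density in these coordinates.\<close>

lemma det_cayley_diff:
  "det (vector [cayley_diff k u, cayley_diff k v, cayley_diff k w]) =
    (1 + k \<bullet> k)\<^sup>2 / 8 * (u \<bullet> cross3 v w)"
proof -
  define C :: "real^3^3" where "C = (\<chi> i j. (if i = j then 1 else 0) + hat k $ i $ j + k $ i * k $ j)"
  have 1: "vector [cayley_diff k u, cayley_diff k v, cayley_diff k w] = (vector [u, v, w] :: real^3^3) ** ((1/2) *\<^sub>R C)"
  proof -
    have row: "vector [u, v, w] $ i = x \<Longrightarrow> cayley_diff k x $ j = ((vector [u, v, w] :: real^3^3) ** ((1/2) *\<^sub>R C)) $ i $ j"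
      for i j x
      using exhaust_3[of j]
      by (auto simp: matrix_matrix_mult_def sum_3 cayley_diff_def C_def hat_def cross3_def inner_vec_def field_simps)
    show ?thesis
      unfolding vec_eq_iff[where 'b = 3 and 'a = "real^3"] forall_3 by (simp add: vec_eq_iff row)
  qed
  have 2: "det ((1/2) *\<^sub>R C) = (1/8) * det C" by (simp add: det_3)
  have 3: "det C = (1 + k \<bullet> k)\<^sup>2"
    by (simp add: det_3 C_def hat_def inner_vec_def sum_3) algebra
  show ?thesis unfolding 1 det_mul 2 3 dot_cross_det by simp
qed

lemma rotation_trace_3:
  fixes h :: "real^3^3"
  assumes "rotation_matrix h" "trace h = 3"
  shows "h = mat 1"
proof -
  have "axial h = 0" using rotation_axial_norm[OF assms(1)] assms(2) by simp
  then have "cayley_coord h = 0" by (simp add: cayley_coord_def)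
  with rotation_eq_cayley[OF assms(1)] assms(2) have "h = cayley 0" by simp
  then show ?thesis by (simp add: cayley_def expand3)
qed

section \<open>Maps to the rotation group\<close>

lemma permutation_sum_3:
  "(\<Sum>p | p permutes (UNIV :: 3 set). of_int (sign p) * f (p 1) (p 2) (p 3)) =
    (f 1 2 3 + f 2 3 1 + f 3 1 2 - f 1 3 2 - f 2 1 3 - f 3 2 1 :: real)"
proof -
  have f123: "finite {2::3, 3}" "1 \<notin> {2::3, 3}" by auto
  have f23: "finite {3::3}" "2 \<notin> {3::3}" by auto
  show ?thesis
    unfolding UNIV_3 sum_over_permutations_insert[OF f123] sum_over_permutations_insert[OF f23] permutes_sing
    by (simp add: sign_swap_id permutation_swap_id sign_compose sign_id swap_id_eq)
qed

lemma trace_hat_hat: "trace (hat u ** hat v) = - 2 * (u \<bullet> v)"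
  by (simp add: trace_hat_mult axial_hat)

lemma trace_hat_hat_hat: "trace (hat u ** hat v ** hat w) = - (u \<bullet> cross3 v w)"
  by (simp add: trace_def sum_3 matrix_matrix_mult_def hat_def cross3_def inner_vec_def) algebra

text \<open>Under \<open>hat\<close> the double trace becomes -2 times the scalar product and the
  triple trace minus the triple product. The six permutations contribute equal triple products
  weighted 2/3, whence the 4.\<close>

lemma cs_coeff_hat:
  assumes "\<And>a. A a = (\<lambda>x. hat (\<beta> a x))" and "\<And>a. \<beta> a differentiable at x"
  shows "cs_coeff A x = - 2 * (\<beta> 1 x \<bullet> (partial 2 (\<beta> 3) x - partial 3 (\<beta> 2) x)
      + \<beta> 2 x \<bullet> (partial 3 (\<beta> 1) x - partial 1 (\<beta> 3) x)
      + \<beta> 3 x \<bullet> (partial 1 (\<beta> 2) x - partial 2 (\<beta> 1) x)) - 4 * (\<beta> 1 x \<bullet> cross3 (\<beta> 2 x) (\<beta> 3 x))"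
proof -
  define f where "f a b c = trace (A a x ** partial b (A c) x + (2/3) *\<^sub>R (A a x ** A b x ** A c x))" for a b c
  have f: "f a b c = - 2 * (\<beta> a x \<bullet> partial b (\<beta> c) x) - (2/3) * (\<beta> a x \<bullet> cross3 (\<beta> b x) (\<beta> c x))" for a b c
  proof -
    have "partial b (A c) x = hat (partial b (\<beta> c) x)"
      unfolding assms(1) by (rule partial_bounded_linear[OF bounded_linear_hat assms(2)])
    moreover have "trace (m + (2/3) *\<^sub>R n) = trace m + (2/3) * trace n" for m n :: "real^3^3"
      by (simp add: trace_def sum_3)
    ultimately show ?thesis
      by (simp add: f_def assms(1) trace_hat_hat trace_hat_hat_hat)
  qed
  have cyc: "u \<bullet> cross3 v w = w \<bullet> cross3 u v" "cross3 v w = - cross3 w v" for u v w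
    by (simp_all add: cross3_def inner_vec_def sum_3 vec_eq_iff forall_3 algebra_simps)
  let ?t = "\<beta> 1 x \<bullet> cross3 (\<beta> 2 x) (\<beta> 3 x)"
  have t: "\<beta> 2 x \<bullet> cross3 (\<beta> 3 x) (\<beta> 1 x) = ?t" "\<beta> 3 x \<bullet> cross3 (\<beta> 1 x) (\<beta> 2 x) = ?t"
    "\<beta> 1 x \<bullet> cross3 (\<beta> 3 x) (\<beta> 2 x) = - ?t" "\<beta> 2 x \<bullet> cross3 (\<beta> 1 x) (\<beta> 3 x) = - ?t"
    "\<beta> 3 x \<bullet> cross3 (\<beta> 2 x) (\<beta> 1 x) = - ?t"
    by (metis cyc inner_minus_right)+
  show ?thesis
    unfolding cs_coeff_def f_def[symmetric] unfolding permutation_sum_3 unfolding f t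
    by (simp add: inner_diff_right)
qed

locale rotation_map =
  fixes h :: "real^3 \<Rightarrow> real^3^3"
  assumes Ck_h: "\<And>k. Ck_on k UNIV h"
    and rotation_h: "\<And>x. rotation_matrix (h x)"
begin

text \<open>The angular velocity of \<open>h\<close> in the direction of the \<open>a\<close>-th coordinate.\<close>

definition rate :: "3 \<Rightarrow> real^3 \<Rightarrow> real^3" where
  "rate a x = (1/2) *\<^sub>R axial (partial a h x ** transpose (h x))"

lemma h_differentiable: "h differentiable at x"
  using Ck_h[of "Suc 0"] by simp

lemma Ck_partial_h: "Ck_on k UNIV (partial a h)"
  using Ck_h[of "Suc k"] by simp

text \<open>Differentiating \<open>h x ** transpose (h x) = mat 1\<close> shows that
  \<open>partial a h x ** transpose (h x)\<close> is skew, hence the \<open>hat\<close> of half its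
  axial vector.\<close>

lemma partial_h: "partial a h x = hat (rate a x) ** h x"
proof -
  have T: "partial a (\<lambda>y. transpose (h y)) x = transpose (partial a h x)"
    by (rule partial_bounded_linear[OF bounded_linear_transpose h_differentiable])
  have dT: "(\<lambda>y. transpose (h y)) differentiable at x"
    using Ck_on_bounded_linear[OF bounded_linear_transpose Ck_h[of "Suc 0"]] by simp
  have "partial a (\<lambda>y. h y ** transpose (h y)) x = 0"
    by (simp add: rotation_inverse(2)[OF rotation_h])
  then have "h x ** transpose (partial a h x) + partial a h x ** transpose (h x) = 0"
    unfolding partial_bilinear[OF bounded_bilinear_matrix_mult h_differentiable dT] T .
  then have "transpose (partial a h x ** transpose (h x)) = - (partial a h x ** transpose (h x))"
    by (simp add: matrix_transpose_mul eq_neg_iff_add_eq_0)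
  then have "hat (rate a x) = partial a h x ** transpose (h x)"
    unfolding rate_def by (rule hat_axial_skew)
  then have "hat (rate a x) ** h x = partial a h x ** (transpose (h x) ** h x)"
    by (simp add: matrix_mul_assoc)
  then show ?thesis by (simp add: rotation_inverse(1)[OF rotation_h])
qed

lemma Ck_rate: "Ck_on k UNIV (rate a)"
proof -
  have "rate a = (\<lambda>x. (1/2) *\<^sub>R axial (partial a h x ** transpose (h x)))"
    by (simp add: fun_eq_iff rate_def)
  moreover have "Ck_on k UNIV (\<lambda>x. (1/2) *\<^sub>R axial (partial a h x ** transpose (h x)))"
    by (rule Ck_on_bounded_linear[OF bounded_linear_scaleR_right],
        rule Ck_on_bounded_linear[OF bounded_linear_axial],
        rule Ck_on_bilinear[OF bounded_bilinear_matrix_mult Ck_partial_h],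
        rule Ck_on_bounded_linear[OF bounded_linear_transpose Ck_h])
  ultimately show ?thesis by simp
qed

lemma rate_differentiable: "rate a differentiable at x"
  using Ck_rate[of "Suc 0"] by simp

lemma partial_trace: "partial a (\<lambda>x. trace (h x)) x = - (rate a x \<bullet> axial (h x))"
  by (simp add: partial_bounded_linear[OF bounded_linear_trace h_differentiable] partial_h trace_hat_mult)

lemma partial_axial:
  "partial a (\<lambda>x. axial (h x)) x = trace (h x) *\<^sub>R rate a x - h x *v rate a x"
  by (simp add: partial_bounded_linear[OF bounded_linear_axial h_differentiable] partial_h axial_hat_mult)

text \<open>The Maurer-Cartan equation for dh h^(-1): equate the mixed second derivatives of
  \<open>h\<close> and cancel \<open>h\<close>.\<close>

lemma structure_equation:
  "partial a (rate b) x - partial b (rate a) x = cross3 (rate a x) (rate b x)"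
proof -
  have *: "partial a (partial b h) x =
      hat (rate b x) ** (hat (rate a x) ** h x) + hat (partial a (rate b) x) ** h x" for a b
  proof -
    have "partial b h = (\<lambda>x. hat (rate b x) ** h x)" by (simp add: fun_eq_iff partial_h)
    moreover have "(\<lambda>x. hat (rate b x)) differentiable at x"
      using Ck_on_bounded_linear[OF bounded_linear_hat Ck_rate[of "Suc 0" b]] by simp
    ultimately show ?thesis
      by (simp add: partial_bilinear[OF bounded_bilinear_matrix_mult _ h_differentiable] partial_h
          partial_bounded_linear[OF bounded_linear_hat rate_differentiable])
  qed
  have "hat (partial a (rate b) x) ** h x - hat (partial b (rate a) x) ** h x
      = hat (rate a x) ** (hat (rate b x) ** h x) - hat (rate b x) ** (hat (rate a x) ** h x)"
    using partial_commute[OF Ck_h, of a b x] unfolding * by (simp add: algebra_simps)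
  then have "(hat (partial a (rate b) x) - hat (partial b (rate a) x)) ** h x =
      (hat (rate a x) ** hat (rate b x) - hat (rate b x) ** hat (rate a x)) ** h x"
    by (simp add: bounded_bilinear.diff_left[OF bounded_bilinear_matrix_mult] matrix_mul_assoc)
  then have "hat (partial a (rate b) x - partial b (rate a) x) ** h x = hat (cross3 (rate a x) (rate b x)) ** h x"
    by (simp only: hat_commutator hat_diff)
  then have "hat (partial a (rate b) x - partial b (rate a) x) ** (h x ** transpose (h x)) =
      hat (cross3 (rate a x) (rate b x)) ** (h x ** transpose (h x))"
    by (simp add: matrix_mul_assoc)
  then show ?thesis by (simp add: rotation_inverse(2)[OF rotation_h] hat_inject)
qed

text \<open>The coefficient of the pullback under \<open>h\<close> of the Haar volume form of total mass \<open>8\<pi>\<^sup>2\<close>.\<close>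

definition jac :: "real^3 \<Rightarrow> real" where
  "jac x = rate 1 x \<bullet> cross3 (rate 2 x) (rate 3 x)"

lemma Ck_jac: "Ck_on k UNIV jac"
proof -
  have "jac = (\<lambda>x. rate 1 x \<bullet> cross3 (rate 2 x) (rate 3 x))"
    by (simp add: fun_eq_iff jac_def)
  moreover have "Ck_on k UNIV (\<lambda>x. rate 1 x \<bullet> cross3 (rate 2 x) (rate 3 x))"
    by (intro Ck_on_bilinear[OF bounded_bilinear_inner Ck_rate] Ck_on_bilinear[OF bounded_bilinear_cross3] Ck_rate)
  ultimately show ?thesis by simp
qed

end


section \<open>The Chern--Simons form of a rotated frame\<close>

lemma matrix_inv_eqI:
  fixes A B :: "real^3^3"
  assumes "A ** B = mat 1" "B ** A = mat 1"
  shows "matrix_inv A = B"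
  unfolding matrix_inv_def
proof (rule some_equality)
  fix C assume "A ** C = mat 1 \<and> C ** A = mat 1"
  then have "C = C ** (A ** B)" "B = (C ** A) ** B" using assms by simp_all
  then show "C = B" by (simp add: matrix_mul_assoc)
qed (use assms in simp)

lemma matrix_inv_sol_metric:
  "matrix_inv (sol_metric x) =
    vector [vector [exp (- 2 * x$3), 0, 0], vector [0, exp (2 * x$3), 0], vector [0, 0, 1]]"
  by (rule matrix_inv_eqI)
     (simp_all add: vec_eq_iff forall_3 sol_metric_def matrix_matrix_mult_def sum_3 mat_def flip: exp_add)

lemma partial_sol_metric:
  "partial a sol_metric x = (if a = 3 then
     vector [vector [2 * exp (2 * x$3), 0, 0], vector [0, - 2 * exp (- 2 * x$3), 0], 0] else 0)"
proof -
  define A B C :: "real^3^3" where "A = vector [vector [1, 0, 0], 0, 0]"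
    and "B = vector [0, vector [0, 1, 0], 0]" and "C = vector [0, 0, vector [0, 0, 1]]"
  have "sol_metric = (\<lambda>x. exp (2 * x$3) *\<^sub>R A + exp ((- 2) * x$3) *\<^sub>R B + C)"
    by (simp add: fun_eq_iff sol_metric_def A_def B_def C_def vec_eq_iff forall_3)
  moreover have "((\<lambda>x. exp (2 * x$3) *\<^sub>R A + exp ((- 2) * x$3) *\<^sub>R B + C) has_derivative
      (\<lambda>v. (2 * v$3 * exp (2 * x$3)) *\<^sub>R A + ((- 2) * v$3 * exp ((- 2) * x$3)) *\<^sub>R B + 0)) (at x)"
    by (intro has_derivative_add has_derivative_scaleR_left has_derivative_exp_nth has_derivative_const)
  ultimately have "(sol_metric has_derivative
      (\<lambda>v. (2 * v$3 * exp (2 * x$3)) *\<^sub>R A + ((- 2) * v$3 * exp ((- 2) * x$3)) *\<^sub>R B + 0)) (at x)"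
    by simp
  from partial_eqI[OF this, of a] show ?thesis
    using exhaust_3[of a] by (auto simp: A_def B_def vec_eq_iff forall_3 axis_def)
qed

lemma christoffel_sol_metric:
  "christoffel sol_metric k a b x =
    (if k = 1 \<and> (a = 1 \<and> b = 3 \<or> a = 3 \<and> b = 1) then 1
     else if k = 2 \<and> (a = 2 \<and> b = 3 \<or> a = 3 \<and> b = 2) then - 1
     else if k = 3 \<and> a = 1 \<and> b = 1 then - exp (2 * x$3)
     else if k = 3 \<and> a = 2 \<and> b = 2 then exp (- 2 * x$3) else 0)"
proof -
  define E where "E = exp (2 * x$3)"
  define E' where "E' = exp (- 2 * x$3)"
  have EE: "E * E' = 1" "E' * E = 1" by (simp_all add: E_def E'_def flip: exp_add)
  have inv: "matrix_inv (sol_metric x) $ i $ j = (if i = j then (if i = 1 then E' else if i = 2 then E else 1) else 0)" for i j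
    using exhaust_3[of i] exhaust_3[of j] by (auto simp: matrix_inv_sol_metric E_def E'_def)
  have par: "partial c sol_metric x $ i $ j =
      (if c = 3 \<and> i = j then (if i = 1 then 2 * E else if i = 2 then - 2 * E' else 0) else 0)" for c i j
    using exhaust_3[of i] exhaust_3[of j] by (auto simp: partial_sol_metric E_def E'_def)
  \<comment> \<open>The inverse metric is diagonal, so only \<open>l = k\<close> survives in the
    sum.\<close>
  have "christoffel sol_metric k a b x = 1/2 * ((if k = 1 then E' else if k = 2 then E else 1) *
      (partial a sol_metric x $ b $ k + partial b sol_metric x $ a $ k - partial k sol_metric x $ a $ b))"
    unfolding christoffel_def inv sum_3 using exhaust_3[of k] by (elim disjE; simp)
  then show ?thesis
    unfolding par E_def[symmetric] E'_def[symmetric]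
    using exhaust_3[of k] exhaust_3[of a] exhaust_3[of b] EE by (elim disjE; simp)
qed

text \<open>The Levi-Civita connection form of the frame \<open>X, Y, Z\<close> is \<open>hat \<circ> sol_connection a\<close>.\<close>

definition sol_connection :: "3 \<Rightarrow> real^3 \<Rightarrow> real^3" where
  "sol_connection a x = (if a = 1 then vector [0, exp (x$3), 0] else if a = 2 then vector [exp (- x$3), 0, 0] else 0)"

context rotation_map
begin

text \<open>
  The components of the 2-form \<open>\<alpha> \<and> r\<close> obtained with the scalar product from \<open>\<alpha> = sol_connection\<close> and
  \<open>r = rate\<close>. Here and below a 2-form is given by the coefficients of \<open>dy \<and> dz\<close>, \<open>dz \<and> dx\<close> and
  \<open>dx \<and> dy\<close>, so that its exterior derivative is a divergence.
\<close>

definition cs_flux :: "3 \<Rightarrow> real^3 \<Rightarrow> real" where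
  "cs_flux a x = (if a = 1 then exp (- x$3) * rate 3 x $ 1 else if a = 2 then - exp (x$3) * rate 3 x $ 2
     else exp (x$3) * rate 2 x $ 2 - exp (- x$3) * rate 1 x $ 1)"

text \<open>The gauge change of a connection, from A to h^T A h + h^T dh. With A the
  \<open>hat\<close> of \<open>sol_connection\<close> and dh = \<open>hat (rate a x) ** h x\<close>
  the two terms combine, and conjugation by h^T acts on the vector inside
  \<open>hat\<close>.\<close>

lemma lc_form_rotated:
  "lc_form sol_metric (\<lambda>x. sol_frame x ** h x) a x = hat (transpose (h x) *v (sol_connection a x + rate a x))"
proof -
  \<comment> \<open>The diagonal of \<open>sol_frame\<close>, with the exponents in the form that
    \<open>has_derivative_exp_nth\<close> and \<open>Ck_on_exp\<close> expect.\<close>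
  let ?f = "\<lambda>k::3. \<lambda>x::real^3. if k = 1 then exp ((- 1) * x$3) else if k = 2 then exp (1 * x$3) else 1"
  have col: "column j (sol_frame y ** h y) $ k = ?f k y * h y $ k $ j" for j k y
    using exhaust_3[of k] by (auto simp: column_def sol_frame_def matrix_matrix_mult_def sum_3)
  have df: "?f k differentiable at y" for k y
  proof -
    have "(\<lambda>x::real^3. exp (c * x$3)) differentiable at y" for c
      using has_derivative_exp_nth unfolding differentiable_def by blast
    from this[of "-1"] this[of 1] show ?thesis using exhaust_3[of k] by auto
  qed
  have dh: "(\<lambda>y. h y $ k $ j) differentiable at x" "partial a (\<lambda>y. h y $ k $ j) x = partial a h x $ k $ j" for k j
  proof -
    have L: "bounded_linear (\<lambda>m::real^3^3. m $ k $ j)"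
      by (intro bounded_linear_compose[OF bounded_linear_vec_nth] bounded_linear_vec_nth)
    show "partial a (\<lambda>y. h y $ k $ j) x = partial a h x $ k $ j"
      by (rule partial_bounded_linear[OF L h_differentiable])
    show "(\<lambda>y. h y $ k $ j) differentiable at x"
      using Ck_on_bounded_linear[OF L Ck_h[of "Suc 0"]] by simp
  qed
  have pf: "partial a (?f k) x = (if a = 3 then (if k = 1 then - exp (- x$3) else if k = 2 then exp (x$3) else 0) else 0)" for k
    using exhaust_3[of k] partial_eqI[OF has_derivative_exp_nth[of "-1" 3 x], of a] partial_eqI[OF has_derivative_exp_nth[of 1 3 x], of a]
    by (auto simp: axis_def)
  have pcol: "partial a (\<lambda>y. column j (sol_frame y ** h y)) x $ k =
      ?f k x * partial a h x $ k $ j + partial a (?f k) x * h x $ k $ j" for j k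
  proof -
    have "Ck_on 1 UNIV (\<lambda>y. column j (sol_frame y ** h y))"
    proof (rule Ck_on_componentwise)
      fix k
      have L: "bounded_linear (\<lambda>m::real^3^3. m $ k $ j)"
        by (intro bounded_linear_compose[OF bounded_linear_vec_nth] bounded_linear_vec_nth)
      have "Ck_on 1 UNIV (?f k)"
        using exhaust_3[of k] Ck_on_exp[of 1 1 "-1" 3] Ck_on_exp[of 1 1 1 3] Ck_on_const[of 1 UNIV "1::real"]
        by (elim disjE; simp del: Ck_on.simps One_nat_def)
      then show "Ck_on 1 UNIV (\<lambda>y. column j (sol_frame y ** h y) $ k)"
        unfolding col by (rule Ck_on_mult[OF _ Ck_on_bounded_linear[OF L Ck_h]])
    qed
    then have d: "(\<lambda>y. column j (sol_frame y ** h y)) differentiable at x" by simp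
    have "partial a (\<lambda>y. column j (sol_frame y ** h y)) x $ k = partial a (\<lambda>y. column j (sol_frame y ** h y) $ k) x"
      by (rule partial_bounded_linear[OF bounded_linear_vec_nth d, symmetric])
    also have "\<dots> = ?f k x * partial a h x $ k $ j + partial a (?f k) x * h x $ k $ j"
      unfolding col partial_mult[OF df dh(1)] dh(2) ..
    finally show ?thesis .
  qed
  \<comment> \<open>The weight on the left is the reciprocal of \<open>?f k x\<close>, so this is
    the k-th component of the covariant derivative with respect to X, Y, Z.\<close>
  have cov: "?f k x * sol_metric x $ k $ k * cov_deriv sol_metric a (\<lambda>y. column j (sol_frame y ** h y)) x $ k =
      partial a h x $ k $ j + (hat (sol_connection a x) ** h x) $ k $ j" for k j
  proof -
    have e: "exp (x$3) * exp (x$3) = exp (2 * x$3)" "exp (- x$3) * exp (- x$3) = exp (- (2 * x$3))"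
      by (simp_all flip: exp_add)
    have S: "(hat (sol_connection a x) ** h x) $ k $ j = (if a = 1 then (if k = 1 then exp (x$3) * h x $ 3 $ j
          else if k = 3 then - (exp (x$3) * h x $ 1 $ j) else 0)
        else if a = 2 then (if k = 2 then - (exp (- x$3) * h x $ 3 $ j)
          else if k = 3 then exp (- x$3) * h x $ 2 $ j else 0) else 0)"
      using exhaust_3[of k] exhaust_3[of a]
      by (elim disjE; simp add: sol_connection_def hat_def matrix_matrix_mult_def sum_3)
    have G: "sol_metric x $ k $ k = (if k = 1 then exp (x$3) * exp (x$3) else if k = 2 then exp (- x$3) * exp (- x$3) else 1)"
      using exhaust_3[of k] by (elim disjE; simp add: sol_metric_def e)
    have i: "exp (x$3) * exp (- x$3) = 1" by (simp flip: exp_add)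
    define p q where "p = exp (x$3)" and "q = exp (- x$3)"
    have pq: "p * q = 1" "q * p = 1" by (simp_all add: p_def q_def flip: exp_add)
    have e2: "exp (2 * x$3) = p * p" "exp (- 2 * x$3) = q * q"
      using e by (simp_all add: p_def q_def)
    have cancel: "p * (q * z) = z" "q * (p * z) = z" for z
      using pq by (simp_all flip: mult.assoc)
    show ?thesis
      unfolding cov_deriv_def pcol christoffel_sol_metric sum_3 col pf S G
      unfolding vec_lambda_beta mult_1 mult_minus1 e2 p_def[symmetric] q_def[symmetric]
      using exhaust_3[of k] exhaust_3[of a]
      by (elim disjE; simp add: cancel pq distrib_left right_diff_distrib mult.assoc)
  qed
  have "lc_form sol_metric (\<lambda>x. sol_frame x ** h x) a x $ i $ j =
      (transpose (h x) ** (partial a h x + hat (sol_connection a x) ** h x)) $ i $ j" for i j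
  proof -
    have "lc_form sol_metric (\<lambda>x. sol_frame x ** h x) a x $ i $ j =
      (\<Sum>k\<in>UNIV. h x $ k $ i * (?f k x * sol_metric x $ k $ k * cov_deriv sol_metric a (\<lambda>y. column j (sol_frame y ** h y)) x $ k))"
      unfolding lc_form_def inner_vec_def
      by (simp add: sum_3 matrix_vector_mult_def col sol_metric_def mult_ac del: exp_minus)
    then show ?thesis unfolding cov
      by (simp add: matrix_matrix_mult_def transpose_def)
  qed
  then have "lc_form sol_metric (\<lambda>x. sol_frame x ** h x) a x =
      transpose (h x) ** (hat (rate a x) ** h x + hat (sol_connection a x) ** h x)"
    by (simp add: vec_eq_iff partial_h)
  also have "hat (rate a x) ** h x + hat (sol_connection a x) ** h x = hat (sol_connection a x + rate a x) ** h x"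
    by (simp add: linear_add[OF bounded_linear.linear[OF bounded_linear_hat]]
        bounded_bilinear.add_left[OF bounded_bilinear_matrix_mult])
  finally show ?thesis
    using rotation_hat_conjugate[OF rotation_transpose[OF rotation_h]] by (simp add: matrix_mul_assoc)
qed

section \<open>Gauge variation of the Chern-Simons form\<close>

lemma Ck_sol_connection: "Ck_on k UNIV (sol_connection a)"
proof (rule Ck_on_componentwise)
  fix i :: 3
  show "Ck_on k UNIV (\<lambda>x. sol_connection a x $ i)"
    using exhaust_3[of a] exhaust_3[of i] Ck_on_exp[of k 1 "-1" 3] Ck_on_exp[of k 1 1 3] Ck_on_const[of k UNIV "0::real"]
    by (elim disjE; simp add: sol_connection_def del: Ck_on.simps)
qed

lemma partial_sol_connection:
  "partial b (sol_connection a) x = (if b = 3 then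
     (if a = 1 then vector [0, exp (x$3), 0] else if a = 2 then vector [- exp (- x$3), 0, 0] else 0) else 0)"
proof -
  have d: "sol_connection a differentiable at x" using Ck_sol_connection[of "Suc 0"] by simp
  have "partial b (sol_connection a) x $ i = partial b (\<lambda>x. sol_connection a x $ i) x" for i
    by (rule partial_bounded_linear[OF bounded_linear_vec_nth d, symmetric])
  then show ?thesis
    using exhaust_3[of a] partial_eqI[OF has_derivative_exp_nth[of "-1" 3 x], of b] partial_eqI[OF has_derivative_exp_nth[of 1 3 x], of b]
    by (elim disjE; simp add: vec_eq_iff forall_3 sol_connection_def axis_def)
qed

lemma Ck_exp_rate: "Ck_on k UNIV (\<lambda>x. exp (c * x$3) * rate a x $ i)"
  using Ck_on_mult[OF Ck_on_exp[of k 1 c 3] Ck_on_bounded_linear[OF bounded_linear_vec_nth Ck_rate]] by simp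

lemma Ck_cs_flux: "Ck_on k UNIV (cs_flux a)"
proof -
  have "cs_flux a = (\<lambda>x. if a = 1 then exp ((- 1) * x$3) * rate 3 x $ 1 else if a = 2 then - (exp (1 * x$3) * rate 3 x $ 2)
     else exp (1 * x$3) * rate 2 x $ 2 + - (exp ((- 1) * x$3) * rate 1 x $ 1))"
    by (simp add: fun_eq_iff cs_flux_def)
  then show ?thesis
    using exhaust_3[of a] Ck_exp_rate[of k "-1" 3 1]
      Ck_on_bounded_linear[OF bounded_linear_minus[OF bounded_linear_ident] Ck_exp_rate[of k 1 3 2]]
      Ck_on_add[OF Ck_exp_rate[of k 1 2 2] Ck_on_bounded_linear[OF bounded_linear_minus[OF bounded_linear_ident] Ck_exp_rate[of k "-1" 1 1]]]
    by (elim disjE; simp del: Ck_on.simps)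
qed

lemma partial_exp_rate:
  "partial b (\<lambda>x. exp (c * x$3) * rate a x $ i) x =
    exp (c * x$3) * partial b (rate a) x $ i + (if b = 3 then c * exp (c * x$3) else 0) * rate a x $ i"
proof -
  have "(\<lambda>x::real^3. exp (c * x$3)) differentiable at x"
    using has_derivative_exp_nth unfolding differentiable_def by blast
  moreover have "(\<lambda>x. rate a x $ i) differentiable at x"
    using Ck_on_bounded_linear[OF bounded_linear_vec_nth Ck_rate[of "Suc 0"]] by simp
  moreover have "partial b (\<lambda>x. rate a x $ i) x = partial b (rate a) x $ i"
    by (rule partial_bounded_linear[OF bounded_linear_vec_nth rate_differentiable])
  ultimately show ?thesis
    by (simp add: partial_mult partial_eqI[OF has_derivative_exp_nth] axis_def)
qed

text \<open>This is d(\<alpha> \<and> r) = d\<alpha> \<and> r - \<alpha> \<and> dr; the structure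
  equation replaces dr by cross products, so that no derivative of \<open>rate\<close>
  remains.\<close>

lemma divergence_cs_flux:
  "partial 1 (cs_flux 1) x + partial 2 (cs_flux 2) x + partial 3 (cs_flux 3) x =
    exp (- x$3) * cross3 (rate 1 x) (rate 3 x) $ 1 - exp (x$3) * cross3 (rate 2 x) (rate 3 x) $ 2
    + exp (x$3) * rate 2 x $ 2 + exp (- x$3) * rate 1 x $ 1"
proof -
  have d: "(\<lambda>x. exp (c * x$3) * rate a x $ i) differentiable at x" for c a i
    using Ck_exp_rate[of "Suc 0"] by simp
  have "cs_flux 1 = (\<lambda>x. exp ((- 1) * x$3) * rate 3 x $ 1)"
    "cs_flux 2 = (\<lambda>x. - (exp (1 * x$3) * rate 3 x $ 2))"
    "cs_flux 3 = (\<lambda>x. exp (1 * x$3) * rate 2 x $ 2 - exp ((- 1) * x$3) * rate 1 x $ 1)"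
    by (simp_all add: fun_eq_iff cs_flux_def)
  then show ?thesis
    by (simp only: partial_diff[OF d d] partial_exp_rate
        partial_bounded_linear[OF bounded_linear_minus[OF bounded_linear_ident] d]
        structure_equation[symmetric]) (simp add: algebra_simps)
qed

text \<open>Here \<open>a\<close>, \<open>b\<close>, \<open>c\<close> stand for the values of
  \<open>sol_connection\<close>, \<open>dbc\<close>, \<open>dca\<close>, \<open>dab\<close> for its
  curl, and \<open>u\<close>, \<open>v\<close>, \<open>w\<close> for the rates. For
  \<open>u = v = w = 0\<close> both sides vanish, which is the vanishing of the Chern-Simons form of
  X, Y, Z.\<close>

lemma cs_identity:
  fixes u v w a b c :: "real^3" and p q :: real
  assumes "a = vector [0, p, 0]" "b = vector [q, 0, 0]" "c = 0"
    "dbc = vector [q, 0, 0]" "dca = vector [0, p, 0]" "dab = 0"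
  shows "- 2 * ((a + u) \<bullet> (dbc + cross3 v w - cross3 v (c + w) + cross3 w (b + v))
      + (b + v) \<bullet> (dca + cross3 w u - cross3 w (a + u) + cross3 u (c + w))
      + (c + w) \<bullet> (dab + cross3 u v - cross3 u (b + v) + cross3 v (a + u)))
      - 4 * ((a + u) \<bullet> cross3 (b + v) (c + w)) =
    2 * (u \<bullet> cross3 v w) - 2 * (q * cross3 u w $ 1 - p * cross3 v w $ 2 + p * v $ 2 + q * u $ 1)"
  unfolding assms
  by (simp add: inner_vec_def sum_3 cross3_def) (simp add: algebra_simps)

theorem cs_coeff_rotated:
  "cs_coeff (lc_form sol_metric (\<lambda>x. sol_frame x ** h x)) x =
    2 * jac x - 2 * (partial 1 (cs_flux 1) x + partial 2 (cs_flux 2) x + partial 3 (cs_flux 3) x)"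
proof -
  define b where "b a x = sol_connection a x + rate a x" for a x
  define T where "T x = transpose (h x)" for x
  define \<beta> where "\<beta> a x = T x *v b a x" for a x
  have Cb: "Ck_on k UNIV (b a)" for k a
  proof -
    have "b a = (\<lambda>x. sol_connection a x + rate a x)" by (simp add: fun_eq_iff b_def)
    then show ?thesis using Ck_on_add[OF Ck_sol_connection Ck_rate] by simp
  qed
  have db: "b a differentiable at x" for a using Cb[of "Suc 0"] by simp
  have T: "T = (\<lambda>x. transpose (h x))" by (simp add: fun_eq_iff T_def)
  have CT: "Ck_on k UNIV T" for k
    unfolding T by (rule Ck_on_bounded_linear[OF bounded_linear_transpose Ck_h])
  have dT: "T differentiable at x" using CT[of "Suc 0"] by simp
  have \<beta>: "\<beta> a = (\<lambda>x. T x *v b a x)" for a by (simp add: fun_eq_iff \<beta>_def)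
  have C\<beta>: "Ck_on k UNIV (\<beta> a)" for k a
    unfolding \<beta> by (rule Ck_on_bilinear[OF bounded_bilinear_matrix_vector_mult CT Cb])
  have d\<beta>: "\<beta> a differentiable at x" for a using C\<beta>[of "Suc 0"] by simp
  have pT: "partial c T x = T x ** transpose (hat (rate c x))" for c
    unfolding T partial_bounded_linear[OF bounded_linear_transpose h_differentiable] partial_h
    by (rule matrix_transpose_mul)
  have skew: "transpose (hat u) *v w = - cross3 u w" for u w
    by (simp add: vec_eq_iff forall_3 hat_def transpose_def matrix_vector_mult_def sum_3 cross3_def)
  have p\<beta>: "partial c (\<beta> a) x = T x *v (partial c (b a) x - cross3 (rate c x) (b a x))" for c a
    unfolding \<beta> partial_bilinear[OF bounded_bilinear_matrix_vector_mult dT db] pT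
      matrix_vector_mul_assoc[symmetric] skew
    by (simp only: matrix_vector_right_distrib[symmetric] add_uminus_conv_diff)
  have "rotation_matrix (T x)" unfolding T_def by (rule rotation_transpose[OF rotation_h])
  note cross = rotation_inner_cross(2)[OF this] and inner = rotation_inner_cross(1)[OF this]
  have pb: "partial c (b a) x = partial c (sol_connection a) x + partial c (rate a) x" for c a
  proof -
    have "sol_connection a differentiable at x" using Ck_sol_connection[of "Suc 0"] by simp
    moreover have "b a = (\<lambda>x. sol_connection a x + rate a x)" by (simp add: fun_eq_iff b_def)
    ultimately show ?thesis by (simp add: partial_add rate_differentiable)
  qed
  have curl: "partial c (\<beta> a) x - partial a (\<beta> c) x = T x *v
      (partial c (sol_connection a) x - partial a (sol_connection c) x + cross3 (rate c x) (rate a x)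
       - cross3 (rate c x) (b a x) + cross3 (rate a x) (b c x))" for c a
  proof -
    have "partial c (\<beta> a) x - partial a (\<beta> c) x =
      T x *v ((partial c (b a) x - cross3 (rate c x) (b a x)) - (partial a (b c) x - cross3 (rate a x) (b c x)))"
      unfolding p\<beta> matrix_vector_mult_diff_distrib ..
    also have "(partial c (b a) x - cross3 (rate c x) (b a x)) - (partial a (b c) x - cross3 (rate a x) (b c x)) =
      partial c (sol_connection a) x - partial a (sol_connection c) x + cross3 (rate c x) (rate a x)
       - cross3 (rate c x) (b a x) + cross3 (rate a x) (b c x)"
      unfolding pb structure_equation[of c a x, symmetric] by simp
    finally show ?thesis .
  qed
  have lc: "lc_form sol_metric (\<lambda>x. sol_frame x ** h x) a = (\<lambda>x. hat (\<beta> a x))" for a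
    unfolding \<beta>_def T_def b_def lc_form_rotated[symmetric] ..
  have "cs_coeff (lc_form sol_metric (\<lambda>x. sol_frame x ** h x)) x =
     - 2 * (\<beta> 1 x \<bullet> (partial 2 (\<beta> 3) x - partial 3 (\<beta> 2) x)
      + \<beta> 2 x \<bullet> (partial 3 (\<beta> 1) x - partial 1 (\<beta> 3) x)
      + \<beta> 3 x \<bullet> (partial 1 (\<beta> 2) x - partial 2 (\<beta> 1) x)) - 4 * (\<beta> 1 x \<bullet> cross3 (\<beta> 2 x) (\<beta> 3 x))"
    by (rule cs_coeff_hat[OF lc d\<beta>])
  \<comment> \<open>All vectors carry the factor \<open>T x\<close>, a rotation, which drops out of
    scalar and triple products; what remains is polynomial in exp z and exp (- z).\<close>
  also have "\<dots> = 2 * jac x - 2 * (exp (- x$3) * cross3 (rate 1 x) (rate 3 x) $ 1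
      - exp (x$3) * cross3 (rate 2 x) (rate 3 x) $ 2 + exp (x$3) * rate 2 x $ 2 + exp (- x$3) * rate 1 x $ 1)"
    unfolding curl unfolding \<beta>_def cross inner unfolding b_def jac_def
    by (rule cs_identity) (simp_all add: sol_connection_def partial_sol_connection vec_eq_iff forall_3)
  finally show ?thesis unfolding divergence_cs_flux .
qed

end

section \<open>Integration over a fundamental domain\<close>

definition sol_invariant :: "(real^3) set \<Rightarrow> (real^3 \<Rightarrow> 'a) \<Rightarrow> bool" where
  "sol_invariant \<Gamma> f \<longleftrightarrow> (\<forall>\<gamma>\<in>\<Gamma>. \<forall>x. f (sol_mult \<gamma> x) = f x)"

text \<open>Every orbit meets both sets exactly once or neither. This is more general than two
  fundamental domains, since the degree argument compares only parts of them. The second clause uses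
  \<open>sol_inv \<gamma>\<close> so that the same \<gamma> describes a pair from either
  end.\<close>

definition same_orbits :: "(real^3) set \<Rightarrow> (real^3) set \<Rightarrow> (real^3) set \<Rightarrow> bool" where
  "same_orbits \<Gamma> A B \<longleftrightarrow> (\<forall>x\<in>A. \<exists>!\<gamma>. \<gamma> \<in> \<Gamma> \<and> sol_mult \<gamma> x \<in> B) \<and>
     (\<forall>y\<in>B. \<exists>!\<gamma>. \<gamma> \<in> \<Gamma> \<and> sol_mult (sol_inv \<gamma>) y \<in> A)"

definition fundamental_domain :: "(real^3) set \<Rightarrow> (real^3) set \<Rightarrow> bool" where
  "fundamental_domain \<Gamma> F \<longleftrightarrow> F \<in> sets borel \<and> (\<forall>x. \<exists>!\<gamma>. \<gamma> \<in> \<Gamma> \<and> sol_mult \<gamma> x \<in> F)"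

lemma sol_mult_inv_cancel [simp]:
  "sol_mult (sol_inv p) (sol_mult p q) = q" "sol_mult p (sol_mult (sol_inv p) q) = q"
  by (simp_all flip: sol_mult_assoc)

lemma sol_inv_inv [simp]: "sol_inv (sol_inv p) = p"
  by (simp add: vec_eq_iff forall_3 flip: exp_add mult.assoc)

lemma subgroup_Sol:
  assumes "subgroup \<Gamma> Sol"
  shows "0 \<in> \<Gamma>" "\<gamma> \<in> \<Gamma> \<Longrightarrow> sol_inv \<gamma> \<in> \<Gamma>" "\<gamma> \<in> \<Gamma> \<Longrightarrow> \<delta> \<in> \<Gamma> \<Longrightarrow> sol_mult \<gamma> \<delta> \<in> \<Gamma>"
  using subgroup.one_closed[OF assms] subgroup.m_inv_closed[OF assms, of \<gamma>] subgroup.m_closed[OF assms, of \<gamma> \<delta>]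
  by simp_all

lemma Basis_real3: "(Basis :: (real^3) set) = {axis 1 1, axis 2 1, axis 3 1}"
  unfolding Basis_vec_def UNIV_3 by auto

lemma sum_Basis_real3:
  fixes f :: "real^3 \<Rightarrow> 'a::comm_monoid_add"
  shows "(\<Sum>b\<in>Basis. f b) = f (axis 1 1) + f (axis 2 1) + f (axis 3 1)"
  unfolding Basis_real3 by (simp add: axis_eq_axis add.assoc)

lemma prod_Basis_real3:
  fixes f :: "real^3 \<Rightarrow> 'a::comm_monoid_mult"
  shows "(\<Prod>b\<in>Basis. f b) = f (axis 1 1) * f (axis 2 1) * f (axis 3 1)"
  unfolding Basis_real3 by (simp add: axis_eq_axis mult.assoc)

text \<open>In these coordinates a left translation is affine, with a diagonal linear part of
  determinant exp (- z) * exp z * 1 = 1: Lebesgue measure is a Haar measure of Sol.\<close>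

lemma nn_integral_sol_left:
  fixes f :: "real^3 \<Rightarrow> ennreal"
  assumes [measurable]: "f \<in> borel_measurable borel"
  shows "(\<integral>\<^sup>+x. f (sol_mult \<gamma> x) \<partial>lborel) = (\<integral>\<^sup>+x. f x \<partial>lborel)"
proof -
  \<comment> \<open>At each basis vector \<open>c\<close> takes the corresponding diagonal
    entry.\<close>
  define c :: "real^3 \<Rightarrow> real" where "c b = b$1 * exp (- \<gamma>$3) + b$2 * exp (\<gamma>$3) + b$3" for b
  define T where "T x = \<gamma> + (\<Sum>j\<in>Basis. (c j * (x \<bullet> j)) *\<^sub>R j)" for x
  have T: "T x = sol_mult \<gamma> x" for x
    unfolding T_def sum_Basis_real3 vec_eq_iff forall_3 inner_axis
    by (simp add: c_def axis_def)
  have "continuous_on UNIV T" unfolding T[abs_def]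
    by (intro continuous_intros)
  then have [measurable]: "T \<in> borel \<rightarrow>\<^sub>M borel" by (rule borel_measurable_continuous_onI)
  have "lborel = density (distr lborel borel T) (\<lambda>_. (\<Prod>j\<in>Basis. \<bar>c j\<bar>))"
    unfolding T_def[abs_def]
    by (rule lborel_affine_euclidean) (auto simp: Basis_real3 c_def axis_def)
  moreover have "(\<Prod>j\<in>Basis. \<bar>c j\<bar>) = 1"
    unfolding prod_Basis_real3 by (simp add: c_def axis_def flip: exp_add)
  ultimately have "lborel = density (distr lborel borel T) (\<lambda>_. 1)" by simp
  then have "(\<integral>\<^sup>+x. f x \<partial>lborel) = (\<integral>\<^sup>+x. f x \<partial>density (distr lborel borel T) (\<lambda>_. 1))" by simp
  also have "\<dots> = (\<integral>\<^sup>+x. f (T x) \<partial>lborel)"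
    by (simp add: nn_integral_density nn_integral_distr)
  finally show ?thesis by (simp add: T)
qed

text \<open>Near \<open>w\<close> distinct points are never related by \<Gamma>, whereas two
  elements of \<Gamma> always are. Having no limit points makes \<Gamma> countable, as the
  interchange of sum and integral requires.\<close>

lemma discrete_subgroup_not_islimpt:
  assumes "subgroup \<Gamma> Sol" "discrete \<Gamma>"
  shows "\<not> w islimpt \<Gamma>"
proof
  assume w: "w islimpt \<Gamma>"
  obtain e where e: "e > 0"
    "\<And>x y. x \<in> ball w e \<Longrightarrow> y \<in> ball w e \<Longrightarrow> sol_mult x (sol_inv y) \<in> \<Gamma> \<Longrightarrow> x = y"
    using sol_quotient_inj_near[OF assms] by metis
  obtain x where x: "x \<in> \<Gamma>" "x \<noteq> w" "dist x w < e" using w e(1) unfolding islimpt_approachable by blast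
  then have "dist x w > 0" by simp
  then obtain y where y: "y \<in> \<Gamma>" "y \<noteq> w" "dist y w < dist x w"
    using w unfolding islimpt_approachable by blast
  have "sol_mult x (sol_inv y) \<in> \<Gamma>" using x(1) y(1) subgroup_Sol[OF assms(1)] by blast
  with e(2)[of x y] x y show False by (auto simp: dist_commute)
qed

text \<open>Integrate \<open>f x\<close> over the pairs \<open>(x, \<gamma>)\<close> with \<open>x \<in> A\<close> and \<open>\<gamma>x \<in> B\<close>, in both orders.\<close>

lemma nn_integral_same_orbits:
  fixes f :: "real^3 \<Rightarrow> ennreal"
  assumes G: "subgroup \<Gamma> Sol" "discrete \<Gamma>" and AB: "same_orbits \<Gamma> A B"
    and [measurable]: "A \<in> sets borel" "B \<in> sets borel" "f \<in> borel_measurable borel"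
    and f: "sol_invariant \<Gamma> f"
  shows "(\<integral>\<^sup>+x. f x * indicator A x \<partial>lborel) = (\<integral>\<^sup>+x. f x * indicator B x \<partial>lborel)"
proof -
  have [measurable]: "sol_mult \<gamma> \<in> borel \<rightarrow>\<^sub>M borel" for \<gamma>
    using continuous_on_sol_mult[of UNIV "\<lambda>_. \<gamma>" "\<lambda>x. x"] by (auto intro: borel_measurable_continuous_onI)
  have count: "countable \<Gamma>" by (rule no_limpt_imp_countable) (rule discrete_subgroup_not_islimpt[OF G])
  have unique: "(\<integral>\<^sup>+\<gamma>. c * indicator U (m \<gamma>) \<partial>count_space \<Gamma>) = c"
    if "\<exists>!\<gamma>. \<gamma> \<in> \<Gamma> \<and> m \<gamma> \<in> U" for c U and m :: "real^3 \<Rightarrow> real^3"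
  proof -
    obtain g where g: "g \<in> \<Gamma>" "\<And>\<gamma>. \<gamma> \<in> \<Gamma> \<Longrightarrow> m \<gamma> \<in> U \<longleftrightarrow> \<gamma> = g" using \<open>\<exists>!\<gamma>. _\<close> by metis
    have "(\<integral>\<^sup>+\<gamma>. c * indicator U (m \<gamma>) \<partial>count_space \<Gamma>) = (\<integral>\<^sup>+\<gamma>. c * indicator {g} \<gamma> \<partial>count_space \<Gamma>)"
      by (intro nn_integral_cong) (auto simp: g indicator_def)
    also have "\<dots> = c" using g(1) by (simp add: nn_integral_cmult_indicator)
    finally show ?thesis .
  qed
  have "(\<integral>\<^sup>+x. f x * indicator A x \<partial>lborel) =
      (\<integral>\<^sup>+x. \<integral>\<^sup>+\<gamma>. f x * indicator A x * indicator B (sol_mult \<gamma> x) \<partial>count_space \<Gamma> \<partial>lborel)"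
  proof (rule nn_integral_cong)
    fix x
    show "f x * indicator A x = (\<integral>\<^sup>+\<gamma>. f x * indicator A x * indicator B (sol_mult \<gamma> x) \<partial>count_space \<Gamma>)"
      using AB unique[of "\<lambda>\<gamma>. sol_mult \<gamma> x" B "f x"] by (cases "x \<in> A") (auto simp: same_orbits_def)
  qed
  also have "\<dots> = (\<integral>\<^sup>+\<gamma>. \<integral>\<^sup>+x. f x * indicator A x * indicator B (sol_mult \<gamma> x) \<partial>lborel \<partial>count_space \<Gamma>)"
    by (rule nn_integral_count_space_nn_integral[OF count]) measurable
  also have "\<dots> = (\<integral>\<^sup>+\<gamma>. \<integral>\<^sup>+y. f y * indicator B y * indicator A (sol_mult (sol_inv \<gamma>) y) \<partial>lborel \<partial>count_space \<Gamma>)"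
  proof (rule nn_integral_cong)
    fix \<gamma> assume "\<gamma> \<in> space (count_space \<Gamma>)"
    then have "f (sol_mult \<gamma> x) = f x" for x using f by (simp add: sol_invariant_def)
    then show "(\<integral>\<^sup>+x. f x * indicator A x * indicator B (sol_mult \<gamma> x) \<partial>lborel) =
        (\<integral>\<^sup>+y. f y * indicator B y * indicator A (sol_mult (sol_inv \<gamma>) y) \<partial>lborel)"
      using nn_integral_sol_left[of "\<lambda>y. f y * indicator B y * indicator A (sol_mult (sol_inv \<gamma>) y)" \<gamma>]
      by (simp add: mult_ac)
  qed
  also have "\<dots> = (\<integral>\<^sup>+y. \<integral>\<^sup>+\<gamma>. f y * indicator B y * indicator A (sol_mult (sol_inv \<gamma>) y) \<partial>count_space \<Gamma> \<partial>lborel)"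
    by (rule nn_integral_count_space_nn_integral[OF count, symmetric]) measurable
  also have "\<dots> = (\<integral>\<^sup>+y. f y * indicator B y \<partial>lborel)"
  proof (rule nn_integral_cong)
    fix y
    show "(\<integral>\<^sup>+\<gamma>. f y * indicator B y * indicator A (sol_mult (sol_inv \<gamma>) y) \<partial>count_space \<Gamma>) = f y * indicator B y"
      using AB unique[of "\<lambda>\<gamma>. sol_mult (sol_inv \<gamma>) y" A "f y"] by (cases "y \<in> B") (auto simp: same_orbits_def)
  qed
  finally show ?thesis .
qed

text \<open>The unsigned version is applied to the positive part, the negative part and the norm;
  the norm decides integrability.\<close>

lemma set_integral_same_orbits:
  fixes f :: "real^3 \<Rightarrow> real"
  assumes G: "subgroup \<Gamma> Sol" "discrete \<Gamma>" and AB: "same_orbits \<Gamma> A B"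
    and [measurable]: "A \<in> sets borel" "B \<in> sets borel" "f \<in> borel_measurable borel"
    and f: "sol_invariant \<Gamma> f"
  shows "set_integrable lborel A f \<longleftrightarrow> set_integrable lborel B f"
    and "(LINT x:A|lborel. f x) = (LINT x:B|lborel. f x)"
proof -
  have eq: "(\<integral>\<^sup>+x. ennreal (g (f x)) * indicator A x \<partial>lborel) = (\<integral>\<^sup>+x. ennreal (g (f x)) * indicator B x \<partial>lborel)"
    if [measurable]: "g \<in> borel_measurable borel" for g
    by (rule nn_integral_same_orbits[OF G AB]) (use f in \<open>auto simp: sol_invariant_def\<close>)
  have ind: "ennreal (g (indicator S x *\<^sub>R f x)) = ennreal (g (f x)) * indicator S x" if "g 0 = 0" for g S x
    using that by (simp add: indicator_def)
  have norm_ind: "ennreal (norm (indicator S x *\<^sub>R f x)) = ennreal (norm (f x)) * indicator S x" for S x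
    by (simp add: indicator_def)
  have eqs: "(\<integral>\<^sup>+x. ennreal (f x) * indicator A x \<partial>lborel) = (\<integral>\<^sup>+x. ennreal (f x) * indicator B x \<partial>lborel)"
    "(\<integral>\<^sup>+x. ennreal (- f x) * indicator A x \<partial>lborel) = (\<integral>\<^sup>+x. ennreal (- f x) * indicator B x \<partial>lborel)"
    "(\<integral>\<^sup>+x. ennreal (norm (f x)) * indicator A x \<partial>lborel) = (\<integral>\<^sup>+x. ennreal (norm (f x)) * indicator B x \<partial>lborel)"
    using eq[of "\<lambda>t. t"] eq[of uminus] eq[of norm] by simp_all
  show *: "set_integrable lborel A f \<longleftrightarrow> set_integrable lborel B f"
    unfolding set_integrable_def integrable_iff_bounded
    using eqs(3) by (simp only: norm_ind) simp
  show "(LINT x:A|lborel. f x) = (LINT x:B|lborel. f x)"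
  proof (cases "set_integrable lborel A f")
    case True
    with * have i: "integrable lborel (\<lambda>x. indicator A x *\<^sub>R f x)" "integrable lborel (\<lambda>x. indicator B x *\<^sub>R f x)"
      by (simp_all add: set_integrable_def)
    show ?thesis
      unfolding set_lebesgue_integral_def real_lebesgue_integral_def[OF i(1)] real_lebesgue_integral_def[OF i(2)]
      using eqs(1,2) by (simp only: ind[of "\<lambda>t. t"] ind[of uminus] minus_zero)
  next
    \<comment> \<open>Without integrability both integrals take the default value 0.\<close>
    case False
    with * show ?thesis
      by (simp add: set_lebesgue_integral_def set_integrable_def not_integrable_integral_eq)
  qed
qed

lemma fundamental_domains_same_orbits:
  assumes G: "subgroup \<Gamma> Sol" and "fundamental_domain \<Gamma> A" "fundamental_domain \<Gamma> B"
  shows "same_orbits \<Gamma> A B"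
  unfolding same_orbits_def
proof (intro conjI ballI)
  fix x
  show "\<exists>!\<gamma>. \<gamma> \<in> \<Gamma> \<and> sol_mult \<gamma> x \<in> B" using assms(3) unfolding fundamental_domain_def by blast
next
  fix y
  have "\<exists>!\<gamma>. \<gamma> \<in> \<Gamma> \<and> sol_mult \<gamma> y \<in> A" using assms(2) unfolding fundamental_domain_def by blast
  then obtain g where g: "g \<in> \<Gamma> \<and> sol_mult g y \<in> A" "\<forall>\<gamma>. \<gamma> \<in> \<Gamma> \<and> sol_mult \<gamma> y \<in> A \<longrightarrow> \<gamma> = g"
    by (elim ex1E) (rule that)
  show "\<exists>!\<gamma>. \<gamma> \<in> \<Gamma> \<and> sol_mult (sol_inv \<gamma>) y \<in> A"
  proof (rule ex1I)
    show "sol_inv g \<in> \<Gamma> \<and> sol_mult (sol_inv (sol_inv g)) y \<in> A"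
      using g(1) subgroup_Sol(2)[OF G, of g] by simp
    fix \<gamma> assume "\<gamma> \<in> \<Gamma> \<and> sol_mult (sol_inv \<gamma>) y \<in> A"
    then have "sol_inv \<gamma> = g" using g(2) subgroup_Sol(2)[OF G, of \<gamma>] by blast
    from arg_cong[OF this, of sol_inv] show "\<gamma> = sol_inv g" by simp
  qed
qed

section \<open>Fundamental domains from charts\<close>

lemma sol_coset_image_iff:
  assumes "subgroup \<Gamma> Sol"
  shows "\<Gamma> #>\<^bsub>Sol\<^esub> x \<in> (\<lambda>p. \<Gamma> #>\<^bsub>Sol\<^esub> p) ` B \<longleftrightarrow> (\<exists>\<gamma>\<in>\<Gamma>. sol_mult \<gamma> x \<in> B)"
  by (auto simp: image_iff sol_coset_eq_iff[OF assms])

lemma openin_sol_quotient_image: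
  assumes "subgroup \<Gamma> Sol" "open B"
  shows "openin (sol_quotient_topology \<Gamma>) ((\<lambda>p. \<Gamma> #>\<^bsub>Sol\<^esub> p) ` B)"
proof -
  have "{p. \<Gamma> #>\<^bsub>Sol\<^esub> p \<in> (\<lambda>p. \<Gamma> #>\<^bsub>Sol\<^esub> p) ` B} = (\<Union>\<gamma>\<in>\<Gamma>. {x. sol_mult \<gamma> x \<in> B})"
    by (auto simp: sol_coset_image_iff[OF assms(1)])
  then show ?thesis using open_sol_left[OF assms(2)] unfolding openin_sol_quotient rcosets_Sol by auto
qed

text \<open>Small balls on which the projection is injective are bounded charts, and compactness of
  the quotient leaves finitely many. Boundedness is recorded because it yields a bounded fundamental
  domain.\<close>

lemma sol_quotient_finite_charts:
  assumes "sol_lattice \<Gamma>"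
  shows "\<exists>C. finite C \<and> C \<subseteq> sol_quotient \<Gamma> \<and> (\<forall>c\<in>C. bounded (fst c)) \<and>
    (\<Union>c\<in>C. snd c ` fst c) = points (sol_quotient \<Gamma>)"
proof -
  have G: "subgroup \<Gamma> Sol" "discrete \<Gamma>" "compact_space (sol_quotient_topology \<Gamma>)"
    using assms by (auto simp: sol_lattice_def)
  let ?\<psi> = "\<lambda>p. \<Gamma> #>\<^bsub>Sol\<^esub> p"
  define \<C> where "\<C> = {c \<in> sol_quotient \<Gamma>. bounded (fst c)}"
  have snd: "snd c = ?\<psi>" "open (fst c)" if "c \<in> \<C>" for c using that by (auto simp: \<C>_def sol_quotient_def)
  have top: "topspace (sol_quotient_topology \<Gamma>) \<subseteq> range ?\<psi>"
    unfolding topspace_def openin_sol_quotient rcosets_Sol by blast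
  have "p \<in> \<Union>(fst ` \<C>)" for p
  proof -
    obtain e where "e > 0" "inj_on ?\<psi> (ball p e)" using sol_quotient_inj_near[OF G(1,2)] by metis
    then have "(ball p e, ?\<psi>) \<in> \<C>" by (auto simp: \<C>_def sol_quotient_def)
    with \<open>e > 0\<close> show ?thesis by force
  qed
  then have "range ?\<psi> \<subseteq> (\<Union>c\<in>\<C>. ?\<psi> ` fst c)" by fastforce
  moreover have "openin (sol_quotient_topology \<Gamma>) U" if "U \<in> (\<lambda>c. ?\<psi> ` fst c) ` \<C>" for U
    using that snd(2) openin_sol_quotient_image[OF G(1)] by auto
  ultimately obtain \<F> where \<F>: "finite \<F>" "\<F> \<subseteq> (\<lambda>c. ?\<psi> ` fst c) ` \<C>" "topspace (sol_quotient_topology \<Gamma>) \<subseteq> \<Union>\<F>"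
    using G(3) top unfolding compact_space_alt by (metis (no_types, lifting) order_trans)
  obtain C where C: "C \<subseteq> \<C>" "finite C" "\<F> = (\<lambda>c. ?\<psi> ` fst c) ` C"
    using finite_subset_image[OF \<F>(1,2)] by auto
  have "?\<psi> p \<in> topspace (sol_quotient_topology \<Gamma>)" for p
    using openin_subset[OF openin_sol_quotient_image[OF G(1) open_UNIV]] by auto
  then have cover: "range ?\<psi> \<subseteq> (\<Union>c\<in>C. ?\<psi> ` fst c)" using \<F>(3) C(3) by auto
  have "(\<Union>c\<in>C. snd c ` fst c) = (\<Union>c\<in>C. ?\<psi> ` fst c)"
    by (rule SUP_cong) (use C(1) snd(1) in auto)
  also have "\<dots> = points (sol_quotient \<Gamma>)"
    unfolding points_sol_quotient[OF G(1,2)] rcosets_Sol using cover by auto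
  finally show ?thesis using C(1,2) by (intro exI[of _ C]) (auto simp: \<C>_def)
qed

text \<open>Add charts one at a time, removing from each new domain the points whose coset is
  already covered. What is removed is a union of translates of open chart domains, so every piece is
  Borel.\<close>

lemma disjoint_chart_pieces:
  assumes "subgroup \<Gamma> Sol" "finite C" "C \<subseteq> sol_quotient \<Gamma>"
  shows "\<exists>B. (\<forall>c\<in>C. B c \<subseteq> fst c \<and> B c \<in> sets borel) \<and> disjoint_family_on (\<lambda>c. snd c ` B c) C \<and>
    (\<Union>c\<in>C. snd c ` B c) = (\<Union>c\<in>C. snd c ` fst c)"
  using assms(2,3)
proof (induction C)
  case empty
  then show ?case by (simp add: disjoint_family_on_def)
next
  case (insert c C)
  let ?\<psi> = "\<lambda>p. \<Gamma> #>\<^bsub>Sol\<^esub> p"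
  obtain B where B: "\<And>d. d \<in> C \<Longrightarrow> B d \<subseteq> fst d" "\<And>d. d \<in> C \<Longrightarrow> B d \<in> sets borel"
    "disjoint_family_on (\<lambda>c. snd c ` B c) C" "(\<Union>c\<in>C. snd c ` B c) = (\<Union>c\<in>C. snd c ` fst c)"
    using insert by auto
  have snd: "snd d = ?\<psi>" "open (fst d)" if "d \<in> insert c C" for d
    using that insert.prems by (auto simp: sol_quotient_def)
  define N where "N = fst c - (\<Union>d\<in>C. \<Union>\<gamma>\<in>\<Gamma>. {x. sol_mult \<gamma> x \<in> fst d})"
  have "open (\<Union>d\<in>C. \<Union>\<gamma>\<in>\<Gamma>. {x. sol_mult \<gamma> x \<in> fst d})"
    by (intro open_UN ballI open_sol_left snd(2)) auto
  then have N: "N \<in> sets borel" unfolding N_def using snd(2)[of c] by auto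
  have "?\<psi> x \<in> (\<Union>d\<in>C. snd d ` fst d) \<longleftrightarrow> x \<in> (\<Union>d\<in>C. \<Union>\<gamma>\<in>\<Gamma>. {x. sol_mult \<gamma> x \<in> fst d})" for x
    using snd(1) sol_coset_image_iff[OF assms(1), of x] by auto
  then have img: "?\<psi> ` N = ?\<psi> ` fst c - (\<Union>d\<in>C. snd d ` fst d)" unfolding N_def by auto
  have neq: "d \<noteq> c" if "d \<in> C" for d using that insert.hyps by auto
  have sc: "snd c = ?\<psi>" using snd(1) by simp
  show ?case
  proof (intro exI[of _ "B(c := N)"] conjI ballI)
    show "(B(c := N)) d \<subseteq> fst d" "(B(c := N)) d \<in> sets borel" if "d \<in> insert c C" for d
      using that B(1)[of d] B(2)[of d] N by (cases "d = c"; auto simp: N_def)+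
    have U: "(\<Union>d\<in>C. snd d ` (B(c := N)) d) = (\<Union>d\<in>C. snd d ` fst d)"
      using neq B(4) by auto
    show "(\<Union>d\<in>insert c C. snd d ` (B(c := N)) d) = (\<Union>c\<in>insert c C. snd c ` fst c)"
      unfolding UN_insert U using img sc by auto
    have "disjoint_family_on (\<lambda>d. snd d ` (B(c := N)) d) C"
      using B(3) neq unfolding disjoint_family_on_def by auto
    moreover have "snd c ` (B(c := N)) c \<inter> (\<Union>d\<in>C. snd d ` (B(c := N)) d) = {}"
      unfolding U using img sc by auto
    ultimately show "disjoint_family_on (\<lambda>d. snd d ` (B(c := N)) d) (insert c C)"
      using insert.hyps by (simp add: disjoint_family_on_insert)
  qed
qed

lemma pieces_fundamental_domain:
  assumes G: "subgroup \<Gamma> Sol" "discrete \<Gamma>" and C: "finite C" "C \<subseteq> sol_quotient \<Gamma>"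
    and B: "\<And>c. c \<in> C \<Longrightarrow> B c \<subseteq> fst c" "\<And>c. c \<in> C \<Longrightarrow> B c \<in> sets borel"
    and disj: "disjoint_family_on (\<lambda>c. snd c ` B c) C" and pts: "(\<Union>c\<in>C. snd c ` B c) = points (sol_quotient \<Gamma>)"
  shows "fundamental_domain \<Gamma> (\<Union>c\<in>C. B c)" and "disjoint_family_on B C"
proof -
  let ?\<psi> = "\<lambda>p. \<Gamma> #>\<^bsub>Sol\<^esub> p"
  have snd: "snd c = ?\<psi>" "inj_on ?\<psi> (fst c)" if "c \<in> C" for c
    using that C(2) by (auto simp: sol_quotient_def)
  show "disjoint_family_on B C"
    unfolding disjoint_family_on_def
  proof (intro ballI impI equals0I)
    fix c d x assume cd: "c \<in> C" "d \<in> C" "c \<noteq> d" "x \<in> B c \<inter> B d"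
    then have "?\<psi> x \<in> snd c ` B c \<inter> snd d ` B d" using snd(1)[OF cd(1)] snd(1)[OF cd(2)] by auto
    with disj cd(1-3) show False unfolding disjoint_family_on_def by blast
  qed
  show "fundamental_domain \<Gamma> (\<Union>c\<in>C. B c)"
    unfolding fundamental_domain_def
  proof (intro conjI allI)
    show "(\<Union>c\<in>C. B c) \<in> sets borel" using C(1) B(2) by auto
    fix x
    have "?\<psi> x \<in> (\<Union>c\<in>C. ?\<psi> ` B c)"
      using pts snd(1) unfolding points_sol_quotient[OF G] rcosets_Sol by auto
    then obtain c g where cg: "c \<in> C" "g \<in> \<Gamma>" "sol_mult g x \<in> B c"
      using sol_coset_image_iff[OF G(1)] by auto
    have coset: "?\<psi> (sol_mult \<gamma> x) = ?\<psi> x" if "\<gamma> \<in> \<Gamma>" for \<gamma>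
      using sol_coset_eq_iff[OF G(1), of x "sol_mult \<gamma> x"] that by auto
    show "\<exists>!\<gamma>. \<gamma> \<in> \<Gamma> \<and> sol_mult \<gamma> x \<in> (\<Union>c\<in>C. B c)"
    proof (rule ex1I[of _ g])
      show "g \<in> \<Gamma> \<and> sol_mult g x \<in> (\<Union>c\<in>C. B c)" using cg by auto
      fix \<gamma> assume "\<gamma> \<in> \<Gamma> \<and> sol_mult \<gamma> x \<in> (\<Union>c\<in>C. B c)"
      then obtain d where d: "\<gamma> \<in> \<Gamma>" "d \<in> C" "sol_mult \<gamma> x \<in> B d" by auto
      have "?\<psi> x \<in> snd c ` B c" "?\<psi> x \<in> snd d ` B d"
        using imageI[OF cg(3), of ?\<psi>] imageI[OF d(3), of ?\<psi>] coset[OF cg(2)] coset[OF d(1)]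
          snd(1)[OF cg(1)] snd(1)[OF d(2)] by simp_all
      then have "c = d" using disj cg(1) d(2) unfolding disjoint_family_on_def by blast
      then have "sol_mult g x \<in> fst c" "sol_mult \<gamma> x \<in> fst c" using cg(3) d(3) B(1)[OF cg(1)] by auto
      then have "sol_mult g x = sol_mult \<gamma> x"
        using inj_onD[OF snd(2)[OF cg(1)], of "sol_mult g x" "sol_mult \<gamma> x"] coset[OF cg(2)] coset[OF d(1)] by simp
      then have "sol_mult (sol_mult g x) (sol_inv x) = sol_mult (sol_mult \<gamma> x) (sol_inv x)" by simp
      then show "\<gamma> = g" by (simp add: sol_mult_assoc)
    qed
  qed
qed

lemma bounded_fundamental_domain:
  assumes "sol_lattice \<Gamma>"
  obtains F where "fundamental_domain \<Gamma> F" "bounded F"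
proof -
  have G: "subgroup \<Gamma> Sol" "discrete \<Gamma>" using assms by (auto simp: sol_lattice_def)
  obtain C where C: "finite C \<and> C \<subseteq> sol_quotient \<Gamma> \<and> (\<forall>c\<in>C. bounded (fst c)) \<and>
    (\<Union>c\<in>C. snd c ` fst c) = points (sol_quotient \<Gamma>)"
    using sol_quotient_finite_charts[OF assms] ..
  then have C': "finite C" "C \<subseteq> sol_quotient \<Gamma>" by simp_all
  obtain B where B: "(\<forall>c\<in>C. B c \<subseteq> fst c \<and> B c \<in> sets borel) \<and> disjoint_family_on (\<lambda>c. snd c ` B c) C \<and>
    (\<Union>c\<in>C. snd c ` B c) = (\<Union>c\<in>C. snd c ` fst c)"
    using disjoint_chart_pieces[OF G(1) C'] ..
  have "bounded (B c)" if "c \<in> C" for c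
    using bounded_subset[of "fst c" "B c"] B C that by simp
  with C'(1) have "bounded (\<Union>c\<in>C. B c)" by (intro bounded_UN) auto
  moreover have "fundamental_domain \<Gamma> (\<Union>c\<in>C. B c)"
    by (rule pieces_fundamental_domain(1)[OF G C']) (use B C in simp_all)
  ultimately show ?thesis using that by metis
qed

text \<open>An arbitrary fundamental domain may be unbounded, but it has the measure of a bounded
  one.\<close>

lemma fundamental_domain_finite_measure:
  assumes "sol_lattice \<Gamma>" "fundamental_domain \<Gamma> F"
  shows "emeasure lborel F < \<infinity>"
proof -
  have G: "subgroup \<Gamma> Sol" "discrete \<Gamma>" using assms by (auto simp: sol_lattice_def)
  obtain A where A: "fundamental_domain \<Gamma> A" "bounded A" by (rule bounded_fundamental_domain[OF assms(1)])
  have [measurable]: "A \<in> sets borel" "F \<in> sets borel" using A(1) assms(2) by (auto simp: fundamental_domain_def)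
  have "(\<integral>\<^sup>+x. 1 * indicator F x \<partial>lborel) = (\<integral>\<^sup>+x. 1 * indicator A x \<partial>lborel)"
    by (rule nn_integral_same_orbits[OF G fundamental_domains_same_orbits[OF G(1) assms(2) A(1)]])
       (auto simp: sol_invariant_def)
  then have "emeasure lborel F = emeasure lborel A" by simp
  with emeasure_bounded_finite[OF A(2)] show ?thesis by simp
qed

lemma sol_invariant_bounded:
  fixes f :: "real^3 \<Rightarrow> 'a::real_normed_vector"
  assumes "sol_lattice \<Gamma>" "continuous_on UNIV f" "sol_invariant \<Gamma> f"
  shows "\<exists>M. \<forall>x. norm (f x) \<le> M"
proof -
  obtain A where A: "fundamental_domain \<Gamma> A" "bounded A" by (rule bounded_fundamental_domain[OF assms(1)])
  have "compact (f ` closure A)"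
    using A(2) assms(2) by (intro compact_continuous_image) (auto intro: continuous_on_subset)
  then obtain M where M: "\<And>y. y \<in> f ` closure A \<Longrightarrow> norm y \<le> M"
    using compact_imp_bounded bounded_iff by metis
  have "norm (f x) \<le> M" for x
  proof -
    obtain \<gamma> where "\<gamma> \<in> \<Gamma>" "sol_mult \<gamma> x \<in> A" using A(1) unfolding fundamental_domain_def by metis
    moreover from this have "f (sol_mult \<gamma> x) = f x" using assms(3) by (simp add: sol_invariant_def)
    moreover have "f (sol_mult \<gamma> x) \<in> f ` closure A"
      using \<open>sol_mult \<gamma> x \<in> A\<close> closure_subset by blast
    ultimately show ?thesis using M[of "f (sol_mult \<gamma> x)"] by simp
  qed
  then show ?thesis by blast
qed

lemma sol_invariant_integrable:
  fixes f :: "real^3 \<Rightarrow> real"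
  assumes "sol_lattice \<Gamma>" "fundamental_domain \<Gamma> F" "continuous_on UNIV f" "sol_invariant \<Gamma> f"
  shows "set_integrable lborel F f"
proof -
  obtain M where M: "\<And>x. norm (f x) \<le> M" using sol_invariant_bounded[OF assms(1,3,4)] by auto
  have [measurable]: "F \<in> sets borel" using assms(2) by (auto simp: fundamental_domain_def)
  have [measurable]: "f \<in> borel_measurable borel" by (rule borel_measurable_continuous_onI[OF assms(3)])
  have "integrable lborel (\<lambda>x. indicator F x *\<^sub>R M)"
    using fundamental_domain_finite_measure[OF assms(1,2)] by (intro integrable_scaleR_left integrable_real_indicator) auto
  then show ?thesis unfolding set_integrable_def
  proof (rule Bochner_Integration.integrable_bound)
    have "\<bar>f x\<bar> \<le> \<bar>M\<bar>" for x using M[of x] by simp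
    then show "AE x in lborel. norm (indicator F x *\<^sub>R f x) \<le> norm (indicator F x *\<^sub>R M)"
      by (intro AE_I2) (simp add: indicator_def)
  qed measurable
qed

lemma fundamental_domain_integral_eq:
  fixes f :: "real^3 \<Rightarrow> real"
  assumes "sol_lattice \<Gamma>" "fundamental_domain \<Gamma> A" "fundamental_domain \<Gamma> B" "continuous_on UNIV f" "sol_invariant \<Gamma> f"
  shows "(LINT x:A|lborel. f x) = (LINT x:B|lborel. f x)"
proof -
  have G: "subgroup \<Gamma> Sol" "discrete \<Gamma>" using assms by (auto simp: sol_lattice_def)
  show ?thesis
    by (rule set_integral_same_orbits(2)[OF G fundamental_domains_same_orbits[OF G(1) assms(2,3)]])
       (use assms borel_measurable_continuous_onI in \<open>auto simp: fundamental_domain_def\<close>)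
qed


section \<open>The divergence theorem for invariant functions\<close>

text \<open>The fields \<open>X, Y, Z\<close> are the coordinate fields multiplied by \<open>frame_coeff\<close>.\<close>

definition frame_coeff :: "3 \<Rightarrow> real^3 \<Rightarrow> real" where
  "frame_coeff a p = (if a = 1 then exp (- p$3) else if a = 2 then exp (p$3) else 1)"

lemma frame_coeff_pos: "frame_coeff a p > 0"
  by (simp add: frame_coeff_def)

lemma frame_coeff_mult: "frame_coeff a (sol_mult \<gamma> p) = frame_coeff a \<gamma> * frame_coeff a p"
  by (simp add: frame_coeff_def flip: exp_add)

lemma continuous_frame_coeff: "continuous_on UNIV (frame_coeff a)"
  using exhaust_3[of a] by (elim disjE; simp add: frame_coeff_def[abs_def]; intro continuous_intros)

text \<open>Left translations stretch the coordinate fields by the constants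
  \<open>frame_coeff a \<gamma>\<close>. So coordinate derivatives of an invariant function are in
  general not invariant, while its derivatives along X, Y, Z are.\<close>

lemma partial_sol_left:
  assumes "\<And>x. f differentiable at x" "\<And>x. f (sol_mult \<gamma> x) = f x"
  shows "partial a f x = frame_coeff a \<gamma> *\<^sub>R partial a f (sol_mult \<gamma> x)"
proof -
  let ?L = "\<lambda>h. vector [exp (- \<gamma>$3) * h$1, exp (\<gamma>$3) * h$2, h$3] :: real^3"
  have "((\<lambda>x. f (sol_mult \<gamma> x)) has_derivative (\<lambda>v. \<Sum>b\<in>UNIV. ?L v $ b *\<^sub>R partial b f (sol_mult \<gamma> x))) (at x)"
    by (rule has_derivative_compose[OF sol_left_translation has_derivative_partial[OF assms(1)]])
  then have "partial a f x = (\<Sum>b\<in>UNIV. ?L (axis a 1) $ b *\<^sub>R partial b f (sol_mult \<gamma> x))"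
    unfolding assms(2) by (rule partial_eqI)
  then show ?thesis
    using exhaust_3[of a] by (elim disjE; simp add: sum_3 axis_def frame_coeff_def)
qed

lemma sol_invariant_frame_partial:
  fixes f :: "real^3 \<Rightarrow> 'a::real_normed_vector"
  assumes "\<And>x. f differentiable at x" "sol_invariant \<Gamma> f"
  shows "sol_invariant \<Gamma> (\<lambda>x. frame_coeff a x *\<^sub>R partial a f x)"
  unfolding sol_invariant_def
proof (intro ballI allI)
  fix \<gamma> x assume "\<gamma> \<in> \<Gamma>"
  then have "partial a f x = frame_coeff a \<gamma> *\<^sub>R partial a f (sol_mult \<gamma> x)"
    using assms(2) by (intro partial_sol_left assms(1)) (simp add: sol_invariant_def)
  then show "frame_coeff a (sol_mult \<gamma> x) *\<^sub>R partial a f (sol_mult \<gamma> x) = frame_coeff a x *\<^sub>R partial a f x"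
    by (simp add: frame_coeff_mult mult.commute)
qed

text \<open>The flow of the a-th field among X, Y, Z: right translation by a one-parameter subgroup.
  It commutes with \<Gamma>, and its orbits are coordinate lines run through at constant
  speed.\<close>

definition right_shift :: "3 \<Rightarrow> real \<Rightarrow> real^3 \<Rightarrow> real^3" where
  "right_shift a t p = sol_mult p (t *\<^sub>R axis a 1)"

lemma right_shift_eq: "right_shift a t p = p + (frame_coeff a p * t) *\<^sub>R axis a 1"
  using exhaust_3[of a]
  by (elim disjE; simp add: right_shift_def frame_coeff_def vec_eq_iff forall_3 axis_def)

lemma right_shift_add: "right_shift a s (right_shift a t p) = right_shift a (t + s) p"
proof -
  have "sol_mult (t *\<^sub>R axis a 1) (s *\<^sub>R axis a 1) = (t + s) *\<^sub>R axis a 1"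
    using exhaust_3[of a] by (elim disjE; simp add: vec_eq_iff forall_3 axis_def)
  then show ?thesis by (simp add: right_shift_def sol_mult_assoc)
qed

lemma right_shift_0 [simp]: "right_shift a 0 p = p"
  by (simp add: right_shift_def)

lemma right_shift_sol_mult: "right_shift a t (sol_mult \<gamma> p) = sol_mult \<gamma> (right_shift a t p)"
  by (simp add: right_shift_def sol_mult_assoc)

lemma frame_coeff_right_shift: "frame_coeff a (right_shift a t p) = frame_coeff a p"
  using exhaust_3[of a] by (elim disjE; simp add: right_shift_def frame_coeff_def axis_def)

lemma continuous_right_shift: "continuous_on UNIV (right_shift a t)"
  unfolding right_shift_def[abs_def] by (intro continuous_intros)

lemma right_shift_image: "right_shift a t ` F = {x. right_shift a (- t) x \<in> F}"
proof (intro equalityI subsetI)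
  fix x assume "x \<in> {x. right_shift a (- t) x \<in> F}"
  then show "x \<in> right_shift a t ` F"
    by (intro image_eqI[of _ _ "right_shift a (- t) x"]) (auto simp: right_shift_add)
qed (auto simp: right_shift_add)

lemma fundamental_domain_right_shift:
  assumes "fundamental_domain \<Gamma> F"
  shows "fundamental_domain \<Gamma> (right_shift a t ` F)"
proof -
  have [measurable]: "F \<in> sets borel" using assms by (simp add: fundamental_domain_def)
  have [measurable]: "right_shift a (- t) \<in> borel \<rightarrow>\<^sub>M borel"
    by (rule borel_measurable_continuous_onI[OF continuous_right_shift])
  have "{x \<in> space borel. right_shift a (- t) x \<in> F} \<in> sets borel" by measurable
  then show ?thesis
    using assms unfolding fundamental_domain_def right_shift_image by (simp add: right_shift_sol_mult)
qed

lemma has_absolute_integral_change_of_variables_real: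
  fixes f :: "real^3 \<Rightarrow> real" and g :: "real^3 \<Rightarrow> real^3"
  assumes S: "S \<in> sets lebesgue"
    and der_g: "\<And>x. x \<in> S \<Longrightarrow> (g has_derivative g' x) (at x within S)"
    and inj: "inj_on g S"
  shows "(\<lambda>x. \<bar>det (matrix (g' x))\<bar> * f (g x)) absolutely_integrable_on S \<and>
           integral S (\<lambda>x. \<bar>det (matrix (g' x))\<bar> * f (g x)) = b
     \<longleftrightarrow> f absolutely_integrable_on (g ` S) \<and> integral (g ` S) f = b"
  using has_absolute_integral_change_of_variables[OF S der_g inj, of "\<lambda>x. vec (f x) :: real^1" "vec b"]
  unfolding absolutely_integrable_on_1_iff integral_on_1_eq
  by (simp add: vec_eq_iff)

lemma set_integrable_lborel_absolutely_integrable: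
  fixes f :: "real^3 \<Rightarrow> real"
  assumes "set_integrable lborel S f"
  shows "f absolutely_integrable_on S"
  using assms unfolding set_integrable_def
  by (simp add: integrable_completion borel_measurable_integrable)

lemma has_derivative_right_shift:
  "(right_shift a t has_derivative
     (\<lambda>v. v + ((if a = 1 then - exp (- x$3) * v$3 else if a = 2 then exp (x$3) * v$3 else 0) * t) *\<^sub>R axis a 1)) (at x)"
proof -
  have n: "((\<lambda>x::real^3. x $ 3) has_derivative (\<lambda>v. v $ 3)) (at x)"
    by (rule bounded_linear_imp_has_derivative) (rule bounded_linear_vec_nth)
  have "(frame_coeff a has_derivative
      (\<lambda>v. if a = 1 then - exp (- x$3) * v$3 else if a = 2 then exp (x$3) * v$3 else 0)) (at x)"
    using exhaust_3[of a] has_derivative_exp_nth[of "-1" 3 x] has_derivative_exp_nth[of 1 3 x]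
    by (elim disjE; simp add: frame_coeff_def[abs_def] mult.commute)
  then show ?thesis unfolding right_shift_eq[abs_def]
    by (intro has_derivative_add has_derivative_ident has_derivative_scaleR_left has_derivative_mult_left)
qed

text \<open>The shift has Jacobian determinant 1 and carries \<open>F\<close> to another fundamental
  domain, over which the invariant \<open>f\<close> has the same integral.\<close>

lemma integral_right_shift:
  fixes f :: "real^3 \<Rightarrow> real"
  assumes L: "sol_lattice \<Gamma>" and F: "fundamental_domain \<Gamma> F" and f: "continuous_on UNIV f" "sol_invariant \<Gamma> f"
  shows "(LINT x:F|lborel. f (right_shift a t x)) = (LINT x:F|lborel. f x)"
proof -
  let ?R = "right_shift a t"
  let ?d = "\<lambda>x v. v + ((if a = 1 then - exp (- x$3) * v$3 else if a = 2 then exp (x$3) * v$3 else 0) * t) *\<^sub>R axis a 1 :: real^3"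
  have det: "det (matrix (?d x)) = 1" for x
    using exhaust_3[of a] by (elim disjE; simp add: det_3 matrix_def axis_def)
  have F': "fundamental_domain \<Gamma> (?R ` F)" by (rule fundamental_domain_right_shift[OF F])
  have fR: "continuous_on UNIV (\<lambda>x. f (?R x))"
    using continuous_on_compose2[OF f(1) continuous_right_shift] by simp
  have fR': "sol_invariant \<Gamma> (\<lambda>x. f (?R x))"
    using f(2) by (simp add: sol_invariant_def right_shift_sol_mult)
  note i1 = sol_invariant_integrable[OF L F fR fR']
  note i2 = sol_invariant_integrable[OF L F' f]
  have inj: "inj_on ?R F"
    by (rule inj_on_inverseI[where g = "right_shift a (- t)"]) (simp add: right_shift_add)
  have "F \<in> sets lebesgue" using F by (auto simp: fundamental_domain_def)
  from has_absolute_integral_change_of_variables_real[OF this has_derivative_at_withinI[OF has_derivative_right_shift] inj,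
      where f = f and b = "integral (?R ` F) f", unfolded det]
  have "integral F (\<lambda>x. f (?R x)) = integral (?R ` F) f"
    using set_integrable_lborel_absolutely_integrable[OF i2] by simp
  then have "(LINT x:F|lborel. f (?R x)) = (LINT x:?R ` F|lborel. f x)"
    using set_borel_integral_eq_integral(2)[OF i1] set_borel_integral_eq_integral(2)[OF i2] by simp
  also have "\<dots> = (LINT x:F|lborel. f x)"
    by (rule fundamental_domain_integral_eq[OF L F' F f])
  finally show ?thesis .
qed

text \<open>
  Right translation along \<open>X\<close>, \<open>Y\<close> or \<open>Z\<close> preserves the integral of an invariant function; the
  derivative of this integral at time 0 is the integral of the derivative along the field.
\<close>

theorem integral_frame_partial_0:
  fixes f :: "real^3 \<Rightarrow> real"
  assumes L: "sol_lattice \<Gamma>" and F: "fundamental_domain \<Gamma> F" and f: "Ck_on 1 UNIV f" "sol_invariant \<Gamma> f"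
  shows "(LINT x:F|lborel. frame_coeff a x * partial a f x) = 0"
proof -
  have d: "f differentiable at x" for x using f(1) by simp
  have cf: "continuous_on UNIV f" using f(1) Ck_on_0 by blast
  define D where "D x = frame_coeff a x * partial a f x" for x
  have cD: "continuous_on UNIV D" unfolding D_def[abs_def]
    using f(1) continuous_frame_coeff by (auto intro!: continuous_intros)
  have iD: "sol_invariant \<Gamma> D"
    unfolding D_def[abs_def] using sol_invariant_frame_partial[OF d f(2)] by simp
  obtain M where M: "\<And>x. norm (D x) \<le> M" using sol_invariant_bounded[OF L cD iD] by auto
  have DR: "((\<lambda>t. f (right_shift a t x)) has_real_derivative D (right_shift a t x)) (at t)" for x t
  proof -
    have "((\<lambda>t. f (x + (frame_coeff a x * t) *\<^sub>R axis a 1)) has_real_derivative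
        partial a f (x + (frame_coeff a x * t) *\<^sub>R axis a 1) * frame_coeff a x) (at t)"
      by (rule DERIV_chain2[OF DERIV_partial_line[OF d]]) (auto intro!: derivative_eq_intros)
    moreover have "D (right_shift a t x) = partial a f (x + (frame_coeff a x * t) *\<^sub>R axis a 1) * frame_coeff a x"
      unfolding D_def frame_coeff_right_shift by (simp add: right_shift_eq)
    ultimately show ?thesis by (simp only: right_shift_eq)
  qed
  define s where "s n x = (f (right_shift a (1 / real (Suc n)) x) - f x) / (1 / real (Suc n))" for n x
  have [measurable]: "F \<in> sets borel" using F by (simp add: fundamental_domain_def)
  have fRc: "continuous_on UNIV (\<lambda>x. f (right_shift a t x))" for t
    using continuous_on_compose2[OF cf continuous_right_shift] by simp
  have fRi: "sol_invariant \<Gamma> (\<lambda>x. f (right_shift a t x))" for t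
    using f(2) by (simp add: sol_invariant_def right_shift_sol_mult)
  have [measurable]: "D \<in> borel_measurable borel" "s n \<in> borel_measurable borel" for n
    using cD fRc cf unfolding s_def[abs_def]
    by (auto intro!: borel_measurable_continuous_onI continuous_intros)
  have "(\<lambda>n. integral\<^sup>L lborel (\<lambda>x. indicator F x *\<^sub>R s n x)) \<longlonglongrightarrow> integral\<^sup>L lborel (\<lambda>x. indicator F x *\<^sub>R D x)"
  proof (rule integral_dominated_convergence)
    show "integrable lborel (\<lambda>x. indicator F x *\<^sub>R M)"
      using fundamental_domain_finite_measure[OF L F] by (intro integrable_scaleR_left integrable_real_indicator) auto
    have "(\<lambda>n. s n x) \<longlonglongrightarrow> D x" for x
    proof -
      have "((\<lambda>h. (f (right_shift a h x) - f x) / h) \<longlongrightarrow> D x) (at 0)"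
        using DR[of x 0] by (simp add: DERIV_def)
      moreover have "filterlim (\<lambda>n. 1 / real (Suc n)) (at 0) sequentially"
        unfolding filterlim_at using LIMSEQ_inverse_real_of_nat by (auto simp: divide_inverse)
      ultimately show ?thesis unfolding s_def by (rule filterlim_compose)
    qed
    then show "AE x in lborel. (\<lambda>n. indicator F x *\<^sub>R s n x) \<longlonglongrightarrow> indicator F x *\<^sub>R D x"
      by (intro AE_I2 tendsto_intros)
    \<comment> \<open>By the mean value theorem along the flow each difference quotient is a value
      of \<open>D\<close>, which is bounded by invariance; on a set of finite measure the constant
      \<open>M\<close> dominates.\<close>
    have "norm (s n x) \<le> M" for n x
    proof -
      define t where "t = 1 / real (Suc n)"
      have t: "t > 0" by (simp add: t_def)
      obtain z where "f (right_shift a t x) - f (right_shift a 0 x) = (t - 0) * D (right_shift a z x)"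
        using MVT2[OF t, of "\<lambda>t. f (right_shift a t x)" "\<lambda>t. D (right_shift a t x)"] DR by auto
      then have "s n x = D (right_shift a z x)" using t unfolding s_def t_def[symmetric] by simp
      then show ?thesis using M by simp
    qed
    then show "AE x in lborel. norm (indicator F x *\<^sub>R s n x) \<le> indicator F x *\<^sub>R M" for n
      by (intro AE_I2) (auto simp: indicator_def)
  qed measurable
  moreover have "integral\<^sup>L lborel (\<lambda>x. indicator F x *\<^sub>R s n x) = 0" for n
  proof -
    have "(LINT x:F|lborel. f (right_shift a (1 / real (Suc n)) x) - f x) = 0"
      using integral_right_shift[OF L F cf f(2)] sol_invariant_integrable[OF L F cf f(2)]
        sol_invariant_integrable[OF L F fRc fRi]
      by (subst set_integral_diff(2)) auto
    then have "(LINT x:F|lborel. s n x) = 0"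
      unfolding s_def by simp
    then show ?thesis by (simp add: set_lebesgue_integral_def)
  qed
  ultimately have "(\<lambda>n::nat. 0) \<longlonglongrightarrow> integral\<^sup>L lborel (\<lambda>x. indicator F x *\<^sub>R D x)"
    by (simp only:)
  then have "integral\<^sup>L lborel (\<lambda>x. indicator F x *\<^sub>R D x) = 0"
    by (simp only: LIMSEQ_const_iff)
  then show ?thesis by (simp add: set_lebesgue_integral_def D_def)
qed

section \<open>Moments of the trace\<close>

context rotation_map
begin

lemma Ck_trace_h: "Ck_on k UNIV (\<lambda>x. trace (h x))"
  by (rule Ck_on_bounded_linear[OF bounded_linear_trace Ck_h])

lemma Ck_axial_h: "Ck_on k UNIV (\<lambda>x. axial (h x))"
  by (rule Ck_on_bounded_linear[OF bounded_linear_axial Ck_h])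

end

locale invariant_rotation_map = rotation_map h for h :: "real^3 \<Rightarrow> real^3^3" +
  fixes \<Gamma> F :: "(real^3) set"
  assumes lattice: "sol_lattice \<Gamma>" and domain: "fundamental_domain \<Gamma> F" and invariant: "sol_invariant \<Gamma> h"
begin

lemma integrable_invariant:
  fixes f :: "real^3 \<Rightarrow> real"
  shows "Ck_on 0 UNIV f \<Longrightarrow> sol_invariant \<Gamma> f \<Longrightarrow> set_integrable lborel F f"
  using sol_invariant_integrable[OF lattice domain] by simp

lemma frame_rate_invariant:
  assumes "\<gamma> \<in> \<Gamma>"
  shows "frame_coeff a (sol_mult \<gamma> x) *\<^sub>R rate a (sol_mult \<gamma> x) = frame_coeff a x *\<^sub>R rate a x"
proof -
  have hg: "h (sol_mult \<gamma> x) = h x" for x using invariant assms by (simp add: sol_invariant_def)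
  have p: "partial a h x = frame_coeff a \<gamma> *\<^sub>R partial a h (sol_mult \<gamma> x)"
    by (rule partial_sol_left[OF h_differentiable hg])
  have "rate a x = (1/2) *\<^sub>R axial ((frame_coeff a \<gamma> *\<^sub>R partial a h (sol_mult \<gamma> x)) ** transpose (h (sol_mult \<gamma> x)))"
    unfolding rate_def hg p[symmetric] ..
  also have "\<dots> = frame_coeff a \<gamma> *\<^sub>R rate a (sol_mult \<gamma> x)"
    unfolding rate_def bounded_bilinear.scaleR_left[OF bounded_bilinear_matrix_mult]
      linear_cmul[OF bounded_linear.linear[OF bounded_linear_axial]] by simp
  finally show ?thesis by (simp add: frame_coeff_mult mult.commute)
qed

text \<open>\<open>G a x / frame_coeff a x\<close> is the component of the 2-form in the
  left-invariant coframe. As \<open>frame_coeff a\<close> does not vary in direction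
  \<open>a\<close>, it passes through \<open>partial a\<close>, and each summand is the derivative
  of an invariant function along X, Y or Z.\<close>

lemma divergence_integral_0:
  fixes G :: "3 \<Rightarrow> real^3 \<Rightarrow> real"
  assumes G: "\<And>k a. Ck_on k UNIV (G a)" and inv: "\<And>a. sol_invariant \<Gamma> (\<lambda>x. G a x / frame_coeff a x)"
  shows "set_integrable lborel F (\<lambda>x. partial 1 (G 1) x + partial 2 (G 2) x + partial 3 (G 3) x)"
    and "(LINT x:F|lborel. partial 1 (G 1) x + partial 2 (G 2) x + partial 3 (G 3) x) = 0"
proof -
  define u where "u a x = 1 / frame_coeff a x" for a x
  have u: "u a = (if a = 1 then (\<lambda>x. exp (1 * x$3)) else if a = 2 then (\<lambda>x. exp ((- 1) * x$3)) else (\<lambda>_. 1))" for a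
    using exhaust_3[of a] by (elim disjE; simp add: u_def[abs_def] frame_coeff_def exp_minus inverse_eq_divide)
  have Cu: "Ck_on k UNIV (u a)" for k a
    unfolding u using Ck_on_exp[of k 1 1 3] Ck_on_exp[of k 1 "-1" 3] Ck_on_const[of k UNIV "1::real"]
    by (simp del: Ck_on.simps)
  have pu: "partial a (u a) x = 0" for a x
    using exhaust_3[of a] partial_eqI[OF has_derivative_exp_nth[of 1 3 x], of a]
      partial_eqI[OF has_derivative_exp_nth[of "-1" 3 x], of a]
    unfolding u by (elim disjE; simp add: axis_def)
  define f where "f a = (\<lambda>x. u a x * G a x)" for a
  have Cf: "Ck_on k UNIV (f a)" for k a unfolding f_def by (rule Ck_on_mult[OF Cu G])
  have fi: "sol_invariant \<Gamma> (f a)" for a using inv[of a] by (simp add: f_def u_def)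
  have du: "u a differentiable at x" "G a differentiable at x" for a x
    using Cu[of "Suc 0" a] G[of "Suc 0" a] by simp_all
  have pf: "frame_coeff a x * partial a (f a) x = partial a (G a) x" for a x
    unfolding f_def partial_mult[OF du] pu using frame_coeff_pos[of a x] by (simp add: u_def)
  have D: "(LINT x:F|lborel. partial a (G a) x) = 0" for a
    using integral_frame_partial_0[OF lattice domain Cf[of 1 a] fi[of a], of a] by (simp only: pf)
  have df: "f a differentiable at x" for a x using Cf[of "Suc 0" a] by simp
  have I: "set_integrable lborel F (\<lambda>x. partial a (G a) x)" for a
  proof (rule integrable_invariant)
    show "Ck_on 0 UNIV (partial a (G a))" by (rule Ck_on_partial[OF G])
    show "sol_invariant \<Gamma> (partial a (G a))"
      using sol_invariant_frame_partial[OF df[of a] fi[of a], of a] by (simp only: real_scaleR_def pf)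
  qed
  show "set_integrable lborel F (\<lambda>x. partial 1 (G 1) x + partial 2 (G 2) x + partial 3 (G 3) x)"
    by (intro set_integral_add(1) I)
  show "(LINT x:F|lborel. partial 1 (G 1) x + partial 2 (G 2) x + partial 3 (G 3) x) = 0"
    by (simp add: set_integral_add I D)
qed

lemma frame_coeff_prod: "frame_coeff 1 x * (frame_coeff 2 x * frame_coeff 3 x) = 1"
  by (simp add: frame_coeff_def flip: exp_add)

text \<open>Possible because the three \<open>frame_coeff\<close> multiply to 1; it expresses
  \<open>jac\<close> by the invariant rates along X, Y, Z.\<close>

lemma jac_frame:
  "jac x = (frame_coeff 1 x *\<^sub>R rate 1 x) \<bullet> cross3 (frame_coeff 2 x *\<^sub>R rate 2 x) (frame_coeff 3 x *\<^sub>R rate 3 x)"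
proof -
  have "(frame_coeff 1 x *\<^sub>R rate 1 x) \<bullet> cross3 (frame_coeff 2 x *\<^sub>R rate 2 x) (frame_coeff 3 x *\<^sub>R rate 3 x) =
    (frame_coeff 1 x * (frame_coeff 2 x * frame_coeff 3 x)) * jac x"
    by (simp add: jac_def cross_mult_left cross_mult_right mult_ac)
  then show ?thesis by (simp add: frame_coeff_prod)
qed

lemma jac_invariant: "sol_invariant \<Gamma> jac"
  unfolding sol_invariant_def jac_frame by (simp add: frame_rate_invariant)

lemma cs_flux_invariant: "sol_invariant \<Gamma> (\<lambda>x. cs_flux a x / frame_coeff a x)"
proof -
  have "cs_flux a x / frame_coeff a x = (if a = 1 then (frame_coeff 3 x *\<^sub>R rate 3 x) $ 1
      else if a = 2 then - ((frame_coeff 3 x *\<^sub>R rate 3 x) $ 2)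
      else (frame_coeff 2 x *\<^sub>R rate 2 x) $ 2 - (frame_coeff 1 x *\<^sub>R rate 1 x) $ 1)" for x
    using exhaust_3[of a] by (elim disjE; simp add: cs_flux_def frame_coeff_def)
  note eq = this
  show ?thesis unfolding sol_invariant_def
  proof (intro ballI allI)
    fix \<gamma> x assume "\<gamma> \<in> \<Gamma>"
    then show "cs_flux a (sol_mult \<gamma> x) / frame_coeff a (sol_mult \<gamma> x) = cs_flux a x / frame_coeff a x"
      unfolding eq by (simp only: frame_rate_invariant)
  qed
qed

lemma integral_cs_coeff:
  "set_integrable lborel F (cs_coeff (lc_form sol_metric (\<lambda>x. sol_frame x ** h x)))"
  "(LINT x:F|lborel. cs_coeff (lc_form sol_metric (\<lambda>x. sol_frame x ** h x)) x) = 2 * (LINT x:F|lborel. jac x)"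
proof -
  have J: "set_integrable lborel F jac" by (rule integrable_invariant[OF Ck_jac jac_invariant])
  note D = divergence_integral_0[of cs_flux, OF Ck_cs_flux cs_flux_invariant]
  have eq: "cs_coeff (lc_form sol_metric (\<lambda>x. sol_frame x ** h x)) =
    (\<lambda>x. 2 * jac x - 2 * (partial 1 (cs_flux 1) x + partial 2 (cs_flux 2) x + partial 3 (cs_flux 3) x))"
    by (rule ext) (rule cs_coeff_rotated)
  show "set_integrable lborel F (cs_coeff (lc_form sol_metric (\<lambda>x. sol_frame x ** h x)))"
    unfolding eq by (intro set_integral_diff(1) set_integrable_mult_right J D(1))
  show "(LINT x:F|lborel. cs_coeff (lc_form sol_metric (\<lambda>x. sol_frame x ** h x)) x) = 2 * (LINT x:F|lborel. jac x)"
    unfolding eq set_integral_diff(2)[OF set_integrable_mult_right[OF J] set_integrable_mult_right[OF D(1)]]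
      set_integral_mult_right D(2) by simp
qed

text \<open>The pullback under \<open>h\<close> of \<open>t\<^sup>n\<close> times the contraction of the volume form with \<open>axial\<close>.\<close>

definition moment_flux :: "nat \<Rightarrow> 3 \<Rightarrow> real^3 \<Rightarrow> real" where
  "moment_flux n a x = trace (h x) ^ n * (axial (h x) \<bullet> (if a = 1 then cross3 (rate 2 x) (rate 3 x)
     else if a = 2 then cross3 (rate 3 x) (rate 1 x) else cross3 (rate 1 x) (rate 2 x)))"

lemma Ck_trace_power: "Ck_on k UNIV (\<lambda>x. trace (h x) ^ n)"
  by (induction n) (simp_all add: Ck_on_const Ck_on_mult[OF Ck_trace_h] del: Ck_on.simps)

lemma Ck_cross_rate: "Ck_on k UNIV (\<lambda>x. cross3 (rate a x) (rate b x))"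
  by (rule Ck_on_bilinear[OF bounded_bilinear_cross3 Ck_rate Ck_rate])

lemma moment_flux_eq:
  "moment_flux n 1 = (\<lambda>x. trace (h x) ^ n * (axial (h x) \<bullet> cross3 (rate 2 x) (rate 3 x)))"
  "moment_flux n 2 = (\<lambda>x. trace (h x) ^ n * (axial (h x) \<bullet> cross3 (rate 3 x) (rate 1 x)))"
  "moment_flux n 3 = (\<lambda>x. trace (h x) ^ n * (axial (h x) \<bullet> cross3 (rate 1 x) (rate 2 x)))"
  by (simp_all add: moment_flux_def fun_eq_iff)

lemma Ck_moment_flux: "Ck_on k UNIV (moment_flux n a)"
proof -
  have "Ck_on k UNIV (\<lambda>x. trace (h x) ^ n * (axial (h x) \<bullet> cross3 (rate b x) (rate c x)))" for b c
    by (rule Ck_on_mult[OF Ck_trace_power Ck_on_bilinear[OF bounded_bilinear_inner Ck_axial_h Ck_cross_rate]])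
  then show ?thesis using exhaust_3[of a] by (elim disjE; simp only: moment_flux_eq)
qed

lemma h_invariant: "\<gamma> \<in> \<Gamma> \<Longrightarrow> h (sol_mult \<gamma> x) = h x"
  using invariant by (simp add: sol_invariant_def)

lemma moment_flux_invariant: "sol_invariant \<Gamma> (\<lambda>x. moment_flux n a x / frame_coeff a x)"
proof -
  define \<rho> where "\<rho> b x = frame_coeff b x *\<^sub>R rate b x" for b x
  have c: "frame_coeff 2 x * frame_coeff 3 x = 1 / frame_coeff 1 x" "frame_coeff 3 x * frame_coeff 1 x = 1 / frame_coeff 2 x"
    "frame_coeff 1 x * frame_coeff 2 x = 1 / frame_coeff 3 x" for x
    by (simp_all add: frame_coeff_def exp_minus inverse_eq_divide)
  have cr: "cross3 (\<rho> b x) (\<rho> c x) = (frame_coeff b x * frame_coeff c x) *\<^sub>R cross3 (rate b x) (rate c x)" for b c x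
    by (simp add: \<rho>_def cross_mult_left cross_mult_right mult.commute)
  have "moment_flux n a x / frame_coeff a x = trace (h x) ^ n * (axial (h x) \<bullet> (if a = 1 then cross3 (\<rho> 2 x) (\<rho> 3 x)
     else if a = 2 then cross3 (\<rho> 3 x) (\<rho> 1 x) else cross3 (\<rho> 1 x) (\<rho> 2 x)))" for x
    using exhaust_3[of a] by (elim disjE; simp add: moment_flux_def cr c)
  moreover have "\<rho> b (sol_mult \<gamma> x) = \<rho> b x" if "\<gamma> \<in> \<Gamma>" for b \<gamma> x
    using frame_rate_invariant[OF that] by (simp add: \<rho>_def)
  ultimately show ?thesis unfolding sol_invariant_def by (simp add: h_invariant)
qed

lemma partial_trace_power:
  "partial a (\<lambda>x. trace (h x) ^ n) x = - (real n * trace (h x) ^ (n - 1) * (rate a x \<bullet> axial (h x)))"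
proof -
  have "(\<lambda>x. trace (h x)) differentiable at x" using Ck_trace_h[of "Suc 0"] by simp
  from partial_eqI[OF has_derivative_power[OF differentiable_frechet[OF this], of n], of a]
  have "partial a (\<lambda>x. trace (h x) ^ n) x = of_nat n * partial a (\<lambda>x. trace (h x)) x * trace (h x) ^ (n - 1)"
    unfolding partial_def .
  then show ?thesis by (simp add: partial_trace)
qed

text \<open>Let V = \<open>axial (h x)\<close>. The derivatives of the rates contribute nothing by
  the Jacobi identity, that of V contributes the trace of u \<mapsto> t u - h u, which is 3t - t =
  2t, and that of t^n contributes - n t^(n-1) |V|^2.\<close>

lemma divergence_moment_flux:
  "partial 1 (moment_flux n 1) x + partial 2 (moment_flux n 2) x + partial 3 (moment_flux n 3) x =
    (2 * trace (h x) * trace (h x) ^ n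
      - real n * trace (h x) ^ (n - 1) * ((3 - trace (h x)) * (1 + trace (h x)))) * jac x"
proof -
  let ?t = "trace (h x)" and ?v = "axial (h x)" and ?H = "h x"
  let ?P = "?t ^ n" and ?Q = "real n * ?t ^ (n - 1)"
  have d: "(\<lambda>x. trace (h x) ^ n) differentiable at x" "(\<lambda>x. axial (h x)) differentiable at x"
    "(\<lambda>x. cross3 (rate b x) (rate c x)) differentiable at x"
    "(\<lambda>x. axial (h x) \<bullet> cross3 (rate b x) (rate c x)) differentiable at x" for b c
    using Ck_trace_power[of "Suc 0"] Ck_axial_h[of "Suc 0"] Ck_cross_rate[of "Suc 0"]
      Ck_on_bilinear[OF bounded_bilinear_inner Ck_axial_h[of "Suc 0"] Ck_cross_rate[of "Suc 0"]] by simp_all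
  define u v w where "u = rate 1 x" and "v = rate 2 x" and "w = rate 3 x"
  have P: "partial a (\<lambda>x. trace (h x) ^ n * (axial (h x) \<bullet> cross3 (rate b x) (rate c x))) x =
     ?P * (?v \<bullet> (cross3 (rate b x) (partial a (rate c) x) + cross3 (partial a (rate b) x) (rate c x))
       + (?t *\<^sub>R rate a x - ?H *v rate a x) \<bullet> cross3 (rate b x) (rate c x))
     - ?Q * (rate a x \<bullet> ?v) * (?v \<bullet> cross3 (rate b x) (rate c x))" for a b c
    unfolding partial_mult[OF d(1,4)] partial_inner[OF d(2,3)] partial_trace_power partial_axial
      partial_bilinear[OF bounded_bilinear_cross3 rate_differentiable rate_differentiable] by simp
  \<comment> \<open>The structure equation turns the antisymmetrised derivatives into double cross
    products, whose cyclic sum vanishes.\<close>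
  have jacobi: "cross3 v (partial 1 (rate 3) x) + cross3 (partial 1 (rate 2) x) w
      + (cross3 w (partial 2 (rate 1) x) + cross3 (partial 2 (rate 3) x) u)
      + (cross3 u (partial 3 (rate 2) x) + cross3 (partial 3 (rate 1) x) v) = 0"
  proof -
    have *: "cross3 v p13 + cross3 p12 w + (cross3 w p21 + cross3 p23 u) + (cross3 u p32 + cross3 p31 v) =
      cross3 (p12 - p21) w + cross3 (p23 - p32) u + cross3 (p31 - p13) v" for p13 p12 p21 p23 p32 p31
      by (simp add: vec_eq_iff forall_3 cross3_def algebra_simps)
    have **: "cross3 (cross3 u v) w + cross3 (cross3 v w) u + cross3 (cross3 w u) v = 0"
      by (simp add: vec_eq_iff forall_3 cross3_def algebra_simps)
    show ?thesis unfolding * structure_equation unfolding u_def[symmetric] v_def[symmetric] w_def[symmetric] by (rule **)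
  qed
  have tr: "(?t *\<^sub>R u - ?H *v u) \<bullet> cross3 v w + (?t *\<^sub>R v - ?H *v v) \<bullet> cross3 w u
      + (?t *\<^sub>R w - ?H *v w) \<bullet> cross3 u v = 2 * ?t * (u \<bullet> cross3 v w)"
  proof -
    have "v \<bullet> cross3 w u = u \<bullet> cross3 v w" "w \<bullet> cross3 u v = u \<bullet> cross3 v w"
      by (simp_all add: cross3_def inner_vec_def sum_3 algebra_simps)
    then show ?thesis using cross3_matrix_trace[of ?H u v w]
      by (simp add: inner_diff_left algebra_simps)
  qed
  \<comment> \<open>Cramer's rule expands \<open>y\<close> times the determinant in
    \<open>u\<close>, \<open>v\<close>, \<open>w\<close>; take the scalar product with
    \<open>y\<close>.\<close>
  have cramer: "(u \<bullet> y) * (y \<bullet> cross3 v w) + (v \<bullet> y) * (y \<bullet> cross3 w u) + (w \<bullet> y) * (y \<bullet> cross3 u v) =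
      (y \<bullet> y) * (u \<bullet> cross3 v w)" for y
    by (simp add: cross3_def inner_vec_def sum_3) algebra
  define A B C where "A = cross3 v (partial 1 (rate 3) x) + cross3 (partial 1 (rate 2) x) w"
    and "B = cross3 w (partial 2 (rate 1) x) + cross3 (partial 2 (rate 3) x) u"
    and "C = cross3 u (partial 3 (rate 2) x) + cross3 (partial 3 (rate 1) x) v"
  have ABC: "?v \<bullet> A + ?v \<bullet> B + ?v \<bullet> C = 0"
    using jacobi unfolding A_def[symmetric] B_def[symmetric] C_def[symmetric]
    by (metis inner_add_right inner_zero_right)
  have "partial 1 (moment_flux n 1) x + partial 2 (moment_flux n 2) x + partial 3 (moment_flux n 3) x =
    ?P * ((?v \<bullet> A + ?v \<bullet> B + ?v \<bullet> C) + ((?t *\<^sub>R u - ?H *v u) \<bullet> cross3 v w + (?t *\<^sub>R v - ?H *v v) \<bullet> cross3 w u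
      + (?t *\<^sub>R w - ?H *v w) \<bullet> cross3 u v)) - ?Q * ((u \<bullet> ?v) * (?v \<bullet> cross3 v w) + (v \<bullet> ?v) * (?v \<bullet> cross3 w u) + (w \<bullet> ?v) * (?v \<bullet> cross3 u v))"
    unfolding moment_flux_eq P unfolding u_def[symmetric] v_def[symmetric] w_def[symmetric]
      A_def[symmetric] B_def[symmetric] C_def[symmetric] by (simp only: distrib_left right_diff_distrib)
  also have "\<dots> = ?P * (2 * ?t * (u \<bullet> cross3 v w)) - ?Q * ((?v \<bullet> ?v) * (u \<bullet> cross3 v w))"
    unfolding ABC tr cramer by simp
  also have "\<dots> = (2 * ?t * ?P - ?Q * ((3 - ?t) * (1 + ?t))) * jac x"
    unfolding rotation_axial_norm[OF rotation_h] jac_def u_def v_def w_def by (simp add: left_diff_distrib)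
  finally show ?thesis .
qed

definition moment :: "nat \<Rightarrow> real" where
  "moment n = (LINT x:F|lborel. trace (h x) ^ n * jac x)"

lemma integrable_trace_power_jac: "set_integrable lborel F (\<lambda>x. trace (h x) ^ n * jac x)"
proof (rule integrable_invariant)
  show "Ck_on 0 UNIV (\<lambda>x. trace (h x) ^ n * jac x)" by (rule Ck_on_mult[OF Ck_trace_power Ck_jac])
  show "sol_invariant \<Gamma> (\<lambda>x. trace (h x) ^ n * jac x)"
    using jac_invariant by (simp add: sol_invariant_def h_invariant)
qed

text \<open>The integrated divergence formula. At \<open>n = 0\<close> the truncated
  \<open>n - 1\<close> is harmless because of the factor \<open>real n\<close>.\<close>

lemma moment_recursion:
  "(real n + 2) * moment (Suc n) = 2 * real n * moment n + 3 * real n * moment (n - 1)"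
proof -
  have "(2 * t * t ^ n - real n * t ^ (n - 1) * ((3 - t) * (1 + t))) * j =
      (real n + 2) * (t ^ Suc n * j) - 2 * real n * (t ^ n * j) - 3 * real n * (t ^ (n - 1) * j)" for t j :: real
    by (cases n) (simp_all add: algebra_simps)
  then have "(LINT x:F|lborel. (real n + 2) * (trace (h x) ^ Suc n * jac x) - 2 * real n * (trace (h x) ^ n * jac x)
      - 3 * real n * (trace (h x) ^ (n - 1) * jac x)) = 0"
    using divergence_integral_0(2)[of "moment_flux n", OF Ck_moment_flux moment_flux_invariant]
    unfolding divergence_moment_flux by simp
  moreover have "(LINT x:F|lborel. (real n + 2) * (trace (h x) ^ Suc n * jac x) - 2 * real n * (trace (h x) ^ n * jac x)
      - 3 * real n * (trace (h x) ^ (n - 1) * jac x)) =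
      (real n + 2) * moment (Suc n) - 2 * real n * moment n - 3 * real n * moment (n - 1)"
    unfolding moment_def
    using integrable_trace_power_jac
    by (subst set_integral_diff(2) set_integral_mult_right; (intro set_integral_diff(1) set_integrable_mult_right)?; blast?)+
  ultimately show ?thesis by linarith
qed

end

text \<open>At \<open>n = 0\<close> the recursion forces the term with index 1 to vanish, so the
  initial term determines all others and the solutions form a line. The crosswise product states
  proportionality without a division.\<close>

lemma moment_recursion_unique:
  fixes a b :: "nat \<Rightarrow> real"
  assumes a: "\<And>n. (real n + 2) * a (Suc n) = 2 * real n * a n + 3 * real n * a (n - 1)"
    and b: "\<And>n. (real n + 2) * b (Suc n) = 2 * real n * b n + 3 * real n * b (n - 1)"
  shows "a n * b 0 = a 0 * b n"
proof (induction n rule: less_induct)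
  case (less n)
  show ?case
  proof (cases n)
    case (Suc m)
    have 1: "a m * b 0 = a 0 * b m" "a (m - 1) * b 0 = a 0 * b (m - 1)" using less Suc by auto
    have "(real m + 2) * (a n * b 0) = ((real m + 2) * a (Suc m)) * b 0" by (simp add: Suc)
    also have "\<dots> = 2 * real m * (a m * b 0) + 3 * real m * (a (m - 1) * b 0)"
      unfolding a by (simp add: algebra_simps)
    also have "\<dots> = a 0 * ((real m + 2) * b (Suc m))"
      unfolding 1 b by (simp add: algebra_simps)
    finally have "(real m + 2) * (a n * b 0) = (real m + 2) * (a 0 * b n)" by (simp add: Suc)
    then show ?thesis by (simp add: add_pos_pos)
  qed simp
qed

text \<open>Up to the factor \<open>8\<pi>\<close>, the Haar integral of \<open>q(trace)\<close> in terms of the rotation angle.\<close>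

definition angle_integral :: "(real \<Rightarrow> real) \<Rightarrow> real" where
  "angle_integral q = integral {0..pi} (\<lambda>\<theta>. q (1 + 2 * cos \<theta>) * (1 - cos \<theta>))"

lemma trace_range: "- 1 \<le> 1 + 2 * cos \<theta>" "1 + 2 * cos \<theta> \<le> (3::real)"
  using cos_ge_minus_one[of \<theta>] cos_le_one[of \<theta>] by linarith+

lemma angle_integrable:
  assumes "continuous_on {-1..3} q"
  shows "(\<lambda>\<theta>. q (1 + 2 * cos \<theta>) * (1 - cos \<theta>)) integrable_on {0..pi}"
proof (rule integrable_continuous_real)
  have "continuous_on {0..pi} (\<lambda>\<theta>. q (1 + 2 * cos \<theta>))"
    by (rule continuous_on_compose2[OF assms]) (auto intro!: continuous_intros simp: trace_range[simplified])
  then show "continuous_on {0..pi} (\<lambda>\<theta>. q (1 + 2 * cos \<theta>) * (1 - cos \<theta>))"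
    by (intro continuous_intros)
qed

text \<open>The primitive is \<open>2 sin \<theta> (1 - cos \<theta>) t\<^sup>n\<close> with \<open>t = 1 + 2 cos \<theta>\<close>, which vanishes at \<open>0\<close> and \<open>\<pi>\<close>.\<close>

lemma angle_integral_recursion:
  "(real n + 2) * angle_integral (\<lambda>t. t ^ Suc n) = 2 * real n * angle_integral (\<lambda>t. t ^ n) + 3 * real n * angle_integral (\<lambda>t. t ^ (n - 1))"
proof -
  have I: "(\<lambda>\<theta>. (1 + 2 * cos \<theta>) ^ m * (1 - cos \<theta>)) integrable_on {0..pi}" for m
    by (rule integrable_continuous_real) (intro continuous_intros)
  let ?g = "\<lambda>\<theta>. 2 * sin \<theta> * (1 - cos \<theta>) * (1 + 2 * cos \<theta>) ^ n"
  let ?g' = "\<lambda>\<theta>. (real n + 2) * ((1 + 2 * cos \<theta>) ^ Suc n * (1 - cos \<theta>)) - 2 * real n * ((1 + 2 * cos \<theta>) ^ n * (1 - cos \<theta>))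
      - 3 * real n * ((1 + 2 * cos \<theta>) ^ (n - 1) * (1 - cos \<theta>))"
  have "(?g' has_integral ?g pi - ?g 0) {0..pi}"
  proof (rule fundamental_theorem_of_calculus)
    fix \<theta> :: real
    have e: "2 * (c * (1 - c) + s * s) * (1 + 2 * c) ^ n + 2 * s * (1 - c) * (real n * (1 + 2 * c) ^ (n - 1) * (2 * (- s)))
      = (real n + 2) * ((1 + 2 * c) ^ Suc n * (1 - c)) - 2 * real n * ((1 + 2 * c) ^ n * (1 - c))
        - 3 * real n * ((1 + 2 * c) ^ (n - 1) * (1 - c))" if "s * s = 1 - c * c" for c s :: real
    proof (cases n)
      case 0
      then show ?thesis using that by (simp add: algebra_simps)
    next
      case (Suc m)
      define p where "p = (1 + 2 * c) ^ m"
      show ?thesis using that unfolding Suc power_Suc diff_Suc_1 p_def[symmetric] by algebra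
    qed
    have ss: "sin \<theta> * sin \<theta> = 1 - cos \<theta> * cos \<theta>" using sin_squared_eq[of \<theta>] by (simp add: power2_eq_square)
    have "(?g has_real_derivative 2 * (cos \<theta> * (1 - cos \<theta>) + sin \<theta> * sin \<theta>) * (1 + 2 * cos \<theta>) ^ n
        + 2 * sin \<theta> * (1 - cos \<theta>) * (real n * (1 + 2 * cos \<theta>) ^ (n - 1) * (2 * (- sin \<theta>)))) (at \<theta> within {0..pi})"
      by (auto intro!: derivative_eq_intros simp: algebra_simps)
    then show "(?g has_vector_derivative ?g' \<theta>) (at \<theta> within {0..pi})"
      unfolding e[OF ss] by (simp add: has_real_derivative_iff_has_vector_derivative)
  qed simp
  then have "integral {0..pi} ?g' = 0" by (simp add: integral_unique)
  moreover have "integral {0..pi} ?g' = (real n + 2) * angle_integral (\<lambda>t. t ^ Suc n) - 2 * real n * angle_integral (\<lambda>t. t ^ n)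
      - 3 * real n * angle_integral (\<lambda>t. t ^ (n - 1))"
    unfolding angle_integral_def
    by (subst integral_diff, (intro integrable_diff integrable_on_mult_right I)+)+
       (simp only: integral_mult_right)
  ultimately show ?thesis by linarith
qed

lemma angle_integral_0: "angle_integral (\<lambda>t. t ^ 0) = pi"
proof -
  have "((\<lambda>\<theta>. 1 - cos \<theta>) has_integral (pi - sin pi) - (0 - sin 0)) {0..pi}"
    by (rule fundamental_theorem_of_calculus)
       (auto intro!: derivative_eq_intros simp: has_real_derivative_iff_has_vector_derivative[symmetric])
  then show ?thesis by (simp add: angle_integral_def integral_unique)
qed

context invariant_rotation_map
begin

lemma moment_eq: "moment n * pi = moment 0 * angle_integral (\<lambda>t. t ^ n)"
  using moment_recursion_unique[of moment "\<lambda>n. angle_integral (\<lambda>t. t ^ n)", OF moment_recursion angle_integral_recursion]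
  unfolding angle_integral_0 .

definition trace_integral :: "(real \<Rightarrow> real) \<Rightarrow> real" where
  "trace_integral q = (LINT x:F|lborel. q (trace (h x)) * jac x)"

lemma trace_h_range: "trace (h x) \<in> {-1..3}"
  using rotation_trace_bounds[OF rotation_h] by simp

lemma integrable_trace_jac:
  assumes q: "continuous_on {-1..3} q"
  shows "set_integrable lborel F (\<lambda>x. q (trace (h x)) * jac x)"
proof (rule sol_invariant_integrable[OF lattice domain])
  have "continuous_on UNIV (\<lambda>x. q (trace (h x)))"
    by (rule continuous_on_compose2[OF q Ck_on_0[OF Ck_trace_h]]) (use trace_h_range in auto)
  then show "continuous_on UNIV (\<lambda>x. q (trace (h x)) * jac x)"
    by (intro continuous_on_mult Ck_on_0[OF Ck_jac])
  show "sol_invariant \<Gamma> (\<lambda>x. q (trace (h x)) * jac x)"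
    using jac_invariant by (simp add: sol_invariant_def h_invariant)
qed

lemma trace_integral_polynomial:
  assumes "real_polynomial_function q"
  shows "trace_integral q * pi = moment 0 * angle_integral q"
proof -
  obtain a n where q: "q = (\<lambda>x. \<Sum>i\<le>n. a i * x ^ i)" using assms real_polynomial_function_iff_sum by blast
  have "trace_integral q = (\<Sum>i\<le>n. a i * moment i)"
  proof -
    have "trace_integral q = integral\<^sup>L lborel (\<lambda>x. \<Sum>i\<le>n. a i * (indicator F x *\<^sub>R (trace (h x) ^ i * jac x)))"
      unfolding trace_integral_def set_lebesgue_integral_def q by (simp add: sum_distrib_left sum_distrib_right mult_ac)
    also have "\<dots> = (\<Sum>i\<le>n. integral\<^sup>L lborel (\<lambda>x. a i * (indicator F x *\<^sub>R (trace (h x) ^ i * jac x))))"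
      using integrable_trace_power_jac unfolding set_integrable_def
      by (intro Bochner_Integration.integral_sum integrable_mult_right)
    finally show ?thesis by (simp add: moment_def set_lebesgue_integral_def)
  qed
  moreover have "angle_integral q = (\<Sum>i\<le>n. a i * angle_integral (\<lambda>t. t ^ i))"
  proof -
    have "angle_integral q = integral {0..pi} (\<lambda>\<theta>. \<Sum>i\<le>n. a i * ((1 + 2 * cos \<theta>) ^ i * (1 - cos \<theta>)))"
      unfolding angle_integral_def q by (simp add: sum_distrib_right mult.assoc)
    also have "\<dots> = (\<Sum>i\<le>n. integral {0..pi} (\<lambda>\<theta>. a i * ((1 + 2 * cos \<theta>) ^ i * (1 - cos \<theta>))))"
      by (intro integral_sum integrable_continuous_real continuous_intros) simp
    finally show ?thesis by (simp add: angle_integral_def)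
  qed
  ultimately show ?thesis
    by (simp add: sum_distrib_left sum_distrib_right moment_eq mult.assoc) (simp add: mult.left_commute)
qed

theorem trace_integral_eq:
  assumes q: "continuous_on {-1..3} q"
  shows "trace_integral q * pi = trace_integral (\<lambda>_. 1) * angle_integral q"
proof -
  have m0: "moment 0 = trace_integral (\<lambda>_. 1)" by (simp add: moment_def trace_integral_def)
  define K where "K = (LINT x:F|lborel. \<bar>jac x\<bar>)"
  \<comment> \<open>If \<open>q\<close> is approximated up to \<open>e\<close>, the two sides change
    by at most \<open>e\<close> times these summands; the \<open>2 * pi\<close> bounds the integral
    of \<open>1 - cos \<theta>\<close>, which is at most 2 on an interval of length pi.\<close>
  define L where "L = K * pi + \<bar>moment 0\<bar> * (2 * pi)"
  have absint: "set_integrable lborel F (\<lambda>x. \<bar>jac x\<bar>)"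
    using set_integrable_abs[OF integrable_invariant[OF Ck_jac jac_invariant]] .
  have K: "K \<ge> 0" unfolding K_def set_lebesgue_integral_def by (rule integral_nonneg_AE) simp
  have bound: "\<bar>trace_integral q * pi - moment 0 * angle_integral q\<bar> \<le> e * L" if e: "e > 0" for e
  proof -
    obtain p where p: "real_polynomial_function p" "\<And>x. x \<in> {-1..3} \<Longrightarrow> \<bar>q x - p x\<bar> < e"
      using Stone_Weierstrass_real_polynomial_function[OF compact_Icc q e] by metis
    have pc: "continuous_on {-1..3} p" using p(1) continuous_on_polymonial_function real_polynomial_function_eq by blast
    have "trace_integral q - trace_integral p = (LINT x:F|lborel. q (trace (h x)) * jac x - p (trace (h x)) * jac x)"
      unfolding trace_integral_def by (simp add: set_integral_diff(2) integrable_trace_jac q pc)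
    also have "\<bar>\<dots>\<bar> \<le> (LINT x:F|lborel. e * \<bar>jac x\<bar>)"
      unfolding set_lebesgue_integral_def real_norm_def[symmetric]
    proof (rule Bochner_Integration.integral_norm_bound_integral)
      show "integrable lborel (\<lambda>x. indicator F x *\<^sub>R (q (trace (h x)) * jac x - p (trace (h x)) * jac x))"
        using set_integral_diff(1)[OF integrable_trace_jac[OF q] integrable_trace_jac[OF pc]] by (simp add: set_integrable_def)
      show "integrable lborel (\<lambda>x. indicator F x *\<^sub>R (e * norm (jac x)))"
        using set_integrable_mult_right[OF absint, of e] by (simp add: set_integrable_def)
      fix x
      have "\<bar>q (trace (h x)) - p (trace (h x))\<bar> * \<bar>jac x\<bar> \<le> e * \<bar>jac x\<bar>"
        using p(2)[OF trace_h_range[of x]] by (intro mult_right_mono) auto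
      then show "norm (indicator F x *\<^sub>R (q (trace (h x)) * jac x - p (trace (h x)) * jac x)) \<le> indicator F x *\<^sub>R (e * norm (jac x))"
        by (simp add: indicator_def abs_mult flip: left_diff_distrib)
    qed
    also have "\<dots> = e * K" by (simp add: K_def)
    finally have 1: "\<bar>trace_integral q - trace_integral p\<bar> \<le> e * K" .
    have "angle_integral q - angle_integral p =
        integral {0..pi} (\<lambda>\<theta>. q (1 + 2 * cos \<theta>) * (1 - cos \<theta>) - p (1 + 2 * cos \<theta>) * (1 - cos \<theta>))"
      unfolding angle_integral_def by (rule integral_diff[symmetric]) (rule angle_integrable[OF q], rule angle_integrable[OF pc])
    also have "norm \<dots> \<le> integral {0..pi} (\<lambda>\<theta>. e * 2)"
    proof (rule integral_norm_bound_integral)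
      show "(\<lambda>\<theta>. q (1 + 2 * cos \<theta>) * (1 - cos \<theta>) - p (1 + 2 * cos \<theta>) * (1 - cos \<theta>)) integrable_on {0..pi}"
        by (rule integrable_diff[OF angle_integrable[OF q] angle_integrable[OF pc]])
      fix \<theta> :: real
      have "\<bar>q (1 + 2 * cos \<theta>) - p (1 + 2 * cos \<theta>)\<bar> * \<bar>1 - cos \<theta>\<bar> \<le> e * 2"
        using p(2)[of "1 + 2 * cos \<theta>"] trace_range[of \<theta>] cos_ge_minus_one[of \<theta>] cos_le_one[of \<theta>] by (intro mult_mono) auto
      then show "norm (q (1 + 2 * cos \<theta>) * (1 - cos \<theta>) - p (1 + 2 * cos \<theta>) * (1 - cos \<theta>)) \<le> e * 2"
        by (simp add: abs_mult flip: left_diff_distrib)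
    qed (rule integrable_const_ivl)
    finally have 2: "\<bar>angle_integral q - angle_integral p\<bar> \<le> e * (2 * pi)" by (simp add: mult_ac)
    have "trace_integral q * pi - moment 0 * angle_integral q =
      (trace_integral q - trace_integral p) * pi - moment 0 * (angle_integral q - angle_integral p)"
      using trace_integral_polynomial[OF p(1)] by (simp add: algebra_simps)
    also have "\<bar>\<dots>\<bar> \<le> \<bar>trace_integral q - trace_integral p\<bar> * pi + \<bar>moment 0\<bar> * \<bar>angle_integral q - angle_integral p\<bar>"
      using abs_triangle_ineq4[of "(trace_integral q - trace_integral p) * pi" "moment 0 * (angle_integral q - angle_integral p)"] by (simp add: abs_mult)
    also have "\<dots> \<le> (e * K) * pi + \<bar>moment 0\<bar> * (e * (2 * pi))"
      using 1 2 by (intro add_mono mult_mono) auto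
    finally show ?thesis by (simp add: L_def algebra_simps)
  qed
  have L: "L \<ge> 0" using K by (simp add: L_def)
  have "\<bar>trace_integral q * pi - moment 0 * angle_integral q\<bar> \<le> 0 + e" if e: "e > 0" for e
  proof -
    \<comment> \<open>Dividing by \<open>L + 1\<close> also covers \<open>L = 0\<close>.\<close>
    have "e / (L + 1) * L \<le> e" using e L by (simp add: field_simps)
    then show ?thesis using bound[of "e / (L + 1)"] e L by (simp add: add_nonneg_pos)
  qed
  then have "\<bar>trace_integral q * pi - moment 0 * angle_integral q\<bar> \<le> 0"
    by (rule field_le_epsilon)
  then show ?thesis by (simp add: m0)
qed

end

section \<open>The Haar integral in Cayley coordinates\<close>

lemma emeasure_ball3:
  assumes "r \<ge> 0"
  shows "emeasure lborel (ball (0::real^3) r) = ennreal (4/3 * pi * r^3)"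
    and "emeasure lborel (cball (0::real^3) r) = ennreal (4/3 * pi * r^3)"
  using assms by (simp_all add: emeasure_ball emeasure_cball unit_ball_vol_3)

text \<open>Polar coordinates for radial functions: it suffices to compare the measures of
  half-lines, and the volume of a ball is a primitive of the density
  \<open>4 * pi * r\<^sup>2\<close>.\<close>

lemma distr_norm_ball3:
  assumes d: "d > 0"
  shows "distr (density lborel (indicator (ball (0::real^3) d))) borel norm =
    density lborel (\<lambda>r. ennreal (4 * pi * r\<^sup>2) * indicator {0..d} r)" (is "?M = ?N")
proof (rule measure_eqI_lessThan)
  show "sets ?M = sets borel" "sets ?N = sets borel" by simp_all
  have M: "emeasure ?M {a<..} = (if a < d then ennreal (4/3 * pi * (d^3 - (max a 0)^3)) else 0)" for a
  proof -
    have "emeasure ?M {a<..} = emeasure lborel (ball 0 d \<inter> (norm -` {a<..} \<inter> space (lborel :: (real^3) measure)))"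
    proof -
      have [measurable]: "norm -` {a<..} \<in> sets (borel :: (real^3) measure)"
        by (intro borel_open open_vimage continuous_on_norm_id) auto
      show ?thesis
        by (subst emeasure_distr) (simp_all add: emeasure_restricted)
    qed
    also have "ball 0 d \<inter> (norm -` {a<..} \<inter> space lborel) = {x::real^3. norm x < d \<and> a < norm x}" by auto
    also have "emeasure lborel {x::real^3. norm x < d \<and> a < norm x} =
        (if a < d then ennreal (4/3 * pi * (d^3 - (max a 0)^3)) else 0)"
    proof (cases "a < 0 \<or> d \<le> a")
      case True
      then have "{x::real^3. norm x < d \<and> a < norm x} = (if a < 0 then ball 0 d else {})"
        using d by (auto intro: less_le_trans)
      with True d show ?thesis by (auto simp: emeasure_ball3)
    next
      case False
      then have a: "0 \<le> a" "a < d" by auto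
      have "{x::real^3. norm x < d \<and> a < norm x} = ball 0 d - cball 0 a" by auto
      also have "emeasure lborel \<dots> = emeasure lborel (ball (0::real^3) d) - emeasure lborel (cball (0::real^3) a)"
        by (rule emeasure_Diff) (use a in \<open>auto simp: emeasure_ball3\<close>)
      also have "\<dots> = ennreal (4/3 * pi * d^3 - 4/3 * pi * a^3)"
        using a d by (simp add: emeasure_ball3 ennreal_minus)
      finally show ?thesis using a by (simp add: right_diff_distrib max_def)
    qed
    finally show ?thesis .
  qed
  have N: "emeasure ?N {a<..} = (if a < d then ennreal (4/3 * pi * (d^3 - (max a 0)^3)) else 0)" for a
  proof (cases "a < d")
    case True
    define m where "m = max a 0"
    have m: "m \<ge> 0" "m \<le> d" using True d by (auto simp: m_def)
    have "emeasure ?N {a<..} = (\<integral>\<^sup>+r. ennreal (4 * pi * r\<^sup>2) * indicator {0..d} r * indicator {a<..} r \<partial>lborel)"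
      by (simp add: emeasure_density)
    also have "\<dots> = (\<integral>\<^sup>+r. ennreal (4 * pi * r\<^sup>2) * indicator {m..d} r \<partial>lborel)"
    proof (rule nn_integral_cong_AE)
      \<comment> \<open>The open half-line and the closed interval may differ at the endpoint
        \<open>a\<close>.\<close>
      have "AE r in lborel. r \<noteq> a" by (rule AE_lborel_singleton)
      then show "AE r in lborel. ennreal (4 * pi * r\<^sup>2) * indicator {0..d} r * indicator {a<..} r = ennreal (4 * pi * r\<^sup>2) * indicator {m..d} r"
        by eventually_elim (auto simp: indicator_def m_def)
    qed
    also have "\<dots> = ennreal (4/3 * pi * d^3 - 4/3 * pi * m^3)"
      by (rule nn_integral_FTC_Icc[OF _ _ _ m(2)])
         (auto intro!: derivative_eq_intros simp: power2_eq_square)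
    finally show ?thesis using True by (simp add: right_diff_distrib m_def)
  next
    case False
    have "emeasure ?N {a<..} = (\<integral>\<^sup>+r. ennreal (4 * pi * r\<^sup>2) * indicator {0..d} r * indicator {a<..} r \<partial>lborel)"
      by (simp add: emeasure_density)
    also have "\<dots> = nn_integral lborel (\<lambda>r::real. 0)"
      by (rule nn_integral_cong) (use False in \<open>auto simp: indicator_def\<close>)
    finally show ?thesis using False by simp
  qed
  show "emeasure ?M {a<..} < \<infinity>" for a unfolding M by simp
  show "emeasure ?M {a<..} = emeasure ?N {a<..}" for a unfolding M N ..
qed

lemma integral_ball3_radial:
  fixes g :: "real \<Rightarrow> real"
  assumes d: "d > 0" and g: "continuous_on UNIV g"
  shows "integral (ball (0::real^3) d) (\<lambda>x. g (norm x)) = integral {0..d} (\<lambda>r. 4 * pi * r\<^sup>2 * g r)"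
proof -
  have [measurable]: "g \<in> borel_measurable borel" by (rule borel_measurable_continuous_onI[OF g])
  have I1: "set_integrable lborel (ball (0::real^3) d) (\<lambda>x. g (norm x))"
  proof (rule set_integrable_subset)
    show "set_integrable lborel (cball (0::real^3) d) (\<lambda>x. g (norm x))"
      by (rule borel_integrable_compact[unfolded set_integrable_def[symmetric]])
         (auto intro!: continuous_on_compose2[OF g] continuous_intros)
  qed auto
  have I2: "set_integrable lborel {0..d} (\<lambda>r. 4 * pi * r\<^sup>2 * g r)"
    by (rule borel_integrable_compact[unfolded set_integrable_def[symmetric]])
       (auto intro!: continuous_intros continuous_on_subset[OF g])
  have "(LINT x:ball (0::real^3) d|lborel. g (norm x)) =
      integral\<^sup>L (density lborel (\<lambda>x. ennreal (indicator (ball (0::real^3) d) x))) (\<lambda>x. g (norm x))"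
    unfolding set_lebesgue_integral_def by (subst integral_density) (auto intro!: borel_measurable_indicator)
  also have "(\<lambda>x. ennreal (indicator (ball (0::real^3) d) x)) = indicator (ball 0 d)"
    by (auto simp: fun_eq_iff indicator_def)
  also have "integral\<^sup>L (density lborel (indicator (ball (0::real^3) d))) (\<lambda>x. g (norm x)) =
      integral\<^sup>L (distr (density lborel (indicator (ball (0::real^3) d))) borel norm) g"
    by (subst integral_distr) auto
  also have "\<dots> = integral\<^sup>L (density lborel (\<lambda>r. ennreal (4 * pi * r\<^sup>2 * indicator {0..d} r))) g"
    unfolding distr_norm_ball3[OF d]
    by (rule arg_cong2[where f = "integral\<^sup>L"], rule arg_cong2[where f = density])
       (auto simp: fun_eq_iff indicator_def)
  also have "\<dots> = (LINT r:{0..d}|lborel. 4 * pi * r\<^sup>2 * g r)"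
    unfolding set_lebesgue_integral_def by (subst integral_density) (auto simp: mult_ac)
  finally show ?thesis
    using set_borel_integral_eq_integral(2)[OF I1] set_borel_integral_eq_integral(2)[OF I2] by simp
qed

text \<open>The function \<open>q(trace)\<close> times the density of the Haar measure in the coordinates of \<open>cayley\<close>.\<close>

definition haar_density :: "(real \<Rightarrow> real) \<Rightarrow> real^3 \<Rightarrow> real" where
  "haar_density q k = q ((3 - k \<bullet> k) / (1 + k \<bullet> k)) * 8 / (1 + k \<bullet> k)\<^sup>2"

lemma cos_tan_half:
  fixes \<theta> :: real
  assumes "cos (\<theta> / 2) \<noteq> 0"
  shows "1 + (tan (\<theta> / 2))\<^sup>2 = 1 / (cos (\<theta> / 2))\<^sup>2"
    "cos \<theta> = (1 - (tan (\<theta> / 2))\<^sup>2) / (1 + (tan (\<theta> / 2))\<^sup>2)"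
proof -
  show 1: "1 + (tan (\<theta> / 2))\<^sup>2 = 1 / (cos (\<theta> / 2))\<^sup>2"
    using tan_sec[OF assms] by (simp add: inverse_eq_divide power_divide)
  have "cos \<theta> = (cos (\<theta> / 2))\<^sup>2 - (sin (\<theta> / 2))\<^sup>2" using cos_double[of "\<theta> / 2"] by simp
  also have "\<dots> = (1 - (tan (\<theta> / 2))\<^sup>2) * (cos (\<theta> / 2))\<^sup>2"
    using assms by (simp add: tan_def power_divide left_diff_distrib)
  finally show "cos \<theta> = (1 - (tan (\<theta> / 2))\<^sup>2) / (1 + (tan (\<theta> / 2))\<^sup>2)"
    unfolding 1 by simp
qed

text \<open>Substitute r = tan (\<theta>/2). The trace becomes 1 + 2 cos \<theta>, and 4 pi r^2 *
  8/(1 + r^2)^2 * (1 + r^2)/2 = 16 pi r^2/(1 + r^2) = 8 pi (1 - cos \<theta>).\<close>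

lemma integral_haar_density_angle:
  assumes d: "d > 0" and q: "continuous_on UNIV q"
  shows "integral (ball 0 d) (haar_density q) =
    8 * pi * integral {0..2 * arctan d} (\<lambda>\<theta>. q (1 + 2 * cos \<theta>) * (1 - cos \<theta>))"
proof -
  define g where "g r = q ((3 - r\<^sup>2) / (1 + r\<^sup>2)) * 8 / (1 + r\<^sup>2)\<^sup>2" for r :: real
  have s: "1 + r\<^sup>2 \<noteq> 0" for r :: real using zero_le_power2[of r] by linarith
  have g: "continuous_on UNIV g"
    unfolding g_def[abs_def] using s
    by (intro continuous_intros continuous_on_compose2[OF q]) auto
  have "haar_density q = (\<lambda>k. g (norm k))"
    by (simp add: fun_eq_iff haar_density_def g_def power2_norm_eq_inner)
  then have "integral (ball 0 d) (haar_density q) = integral {0..d} (\<lambda>r. 4 * pi * r\<^sup>2 * g r)"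
    using integral_ball3_radial[OF d g] by simp
  also have "\<dots> = integral {0..2 * arctan d} (\<lambda>\<theta>. 8 * pi * (q (1 + 2 * cos \<theta>) * (1 - cos \<theta>)))"
  proof -
    have half: "\<theta> / 2 \<in> {0..arctan d}" "cos (\<theta> / 2) > 0" if "\<theta> \<in> {0..2 * arctan d}" for \<theta>
    proof -
      show "\<theta> / 2 \<in> {0..arctan d}" using that by auto
      then show "cos (\<theta> / 2) > 0" using arctan_ubound[of d] by (intro cos_gt_zero_pi) (auto simp: less_le_trans)
    qed
    have "((\<lambda>\<theta>. ((1 + (tan (\<theta> / 2))\<^sup>2) / 2) *\<^sub>R (4 * pi * (tan (\<theta> / 2))\<^sup>2 * g (tan (\<theta> / 2)))) has_integral
        integral {tan (0 / 2)..tan (2 * arctan d / 2)} (\<lambda>r. 4 * pi * r\<^sup>2 * g r)) {0..2 * arctan d}"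
    proof (rule has_integral_substitution[where c = 0 and d = d and g = "\<lambda>\<theta>. tan (\<theta> / 2)"])
      show "(\<lambda>\<theta>. tan (\<theta> / 2)) ` {0..2 * arctan d} \<subseteq> {0..d}"
      proof (rule image_subsetI)
        fix \<theta> assume \<theta>: "\<theta> \<in> {0..2 * arctan d}"
        have "tan (\<theta> / 2) \<le> tan (arctan d)"
          using half(1)[OF \<theta>] arctan_ubound[of d] by (intro tan_mono_le) auto
        moreover have "0 \<le> tan (\<theta> / 2)"
          using half(1)[OF \<theta>] arctan_ubound[of d] tan_mono_le[of 0 "\<theta> / 2"] by auto
        ultimately show "tan (\<theta> / 2) \<in> {0..d}" by (simp add: tan_arctan)
      qed
      show "continuous_on {0..d} (\<lambda>r. 4 * pi * r\<^sup>2 * g r)"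
        by (intro continuous_intros continuous_on_subset[OF g]) auto
      fix \<theta> assume "\<theta> \<in> {0..2 * arctan d}"
      then show "((\<lambda>\<theta>. tan (\<theta> / 2)) has_real_derivative (1 + (tan (\<theta> / 2))\<^sup>2) / 2) (at \<theta> within {0..2 * arctan d})"
        using half(2)[of \<theta>] by (auto intro!: derivative_eq_intros simp: cos_tan_half(1) inverse_eq_divide)
    qed (use d in \<open>simp_all add: tan_arctan\<close>)
    moreover have "tan (0 / 2) = (0::real)" "tan (2 * arctan d / 2) = d" by (simp_all add: tan_arctan)
    ultimately have "integral {0..d} (\<lambda>r. 4 * pi * r\<^sup>2 * g r) =
        integral {0..2 * arctan d} (\<lambda>\<theta>. ((1 + (tan (\<theta> / 2))\<^sup>2) / 2) *\<^sub>R (4 * pi * (tan (\<theta> / 2))\<^sup>2 * g (tan (\<theta> / 2))))"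
      by (simp only: integral_unique)
    also have "\<dots> = integral {0..2 * arctan d} (\<lambda>\<theta>. 8 * pi * (q (1 + 2 * cos \<theta>) * (1 - cos \<theta>)))"
    proof (rule Henstock_Kurzweil_Integration.integral_cong)
      fix \<theta> assume \<theta>: "\<theta> \<in> {0..2 * arctan d}"
      define T where "T = (tan (\<theta> / 2))\<^sup>2"
      have T: "1 + T > 0" by (simp add: T_def add_pos_nonneg)
      have c: "cos \<theta> = (1 - T) / (1 + T)" using cos_tan_half(2)[of \<theta>] half(2)[OF \<theta>] by (simp add: T_def)
      have e: "1 + 2 * cos \<theta> = (3 - T) / (1 + T)" "1 - cos \<theta> = 2 * T / (1 + T)"
        unfolding c using T by (simp_all add: field_simps)
      define Q where "Q = q ((3 - T) / (1 + T))"
      have "s / 2 * (4 * pi * T * (Q * 8 / s\<^sup>2)) = 8 * pi * (Q * (2 * T / s))" if "s \<noteq> 0" for s :: real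
        using that by (simp add: power2_eq_square)
      from this[of "1 + T"] show "((1 + (tan (\<theta> / 2))\<^sup>2) / 2) *\<^sub>R (4 * pi * (tan (\<theta> / 2))\<^sup>2 * g (tan (\<theta> / 2))) = 8 * pi * (q (1 + 2 * cos \<theta>) * (1 - cos \<theta>))"
        unfolding e g_def T_def[symmetric] Q_def[symmetric] using T by simp
    qed
    finally show ?thesis .
  qed
  finally show ?thesis by simp
qed

text \<open>On the sphere |k| = d the trace is (3 - d^2)/(1 + d^2), and it decreases as |k| grows.
  If \<open>q\<close> vanishes up to this value, rotations outside the ball do not count and the
  ball carries the full Haar integral.\<close>

lemma integral_haar_density:
  assumes d: "d > 0" and q: "continuous_on UNIV q"
    and 0: "\<And>t. t \<le> (3 - d\<^sup>2) / (1 + d\<^sup>2) \<Longrightarrow> q t = 0"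
  shows "integral (ball 0 d) (haar_density q) = 8 * pi * angle_integral q"
proof -
  let ?f = "\<lambda>\<theta>. q (1 + 2 * cos \<theta>) * (1 - cos \<theta>)"
  have b: "0 \<le> 2 * arctan d" "2 * arctan d \<le> pi" using d arctan_ubound[of d] by auto
  have int: "?f integrable_on {0..pi}" by (rule angle_integrable[OF continuous_on_subset[OF q]]) auto
  have c: "cos (2 * arctan d) = (1 - d\<^sup>2) / (1 + d\<^sup>2)"
    using cos_tan_half(2)[of "2 * arctan d"] by (simp add: tan_arctan)
  have "?f \<theta> = 0" if "\<theta> \<in> {2 * arctan d..pi}" for \<theta>
  proof -
    have "cos \<theta> \<le> cos (2 * arctan d)" using that b by (intro cos_monotone_0_pi_le) auto
    then have "1 + 2 * cos \<theta> \<le> 1 + 2 * ((1 - d\<^sup>2) / (1 + d\<^sup>2))" unfolding c by linarith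
    also have "\<dots> = (3 - d\<^sup>2) / (1 + d\<^sup>2)"
    proof -
      have "1 + d\<^sup>2 \<noteq> 0" using zero_le_power2[of d] by linarith
      then show ?thesis by (simp add: field_simps)
    qed
    finally show ?thesis using 0 by simp
  qed
  then have "integral {2 * arctan d..pi} ?f = integral {2 * arctan d..pi} (\<lambda>_. 0)"
    by (rule Henstock_Kurzweil_Integration.integral_cong)
  with Henstock_Kurzweil_Integration.integral_combine[OF b int]
  have "angle_integral q = integral {0..2 * arctan d} ?f" by (simp add: angle_integral_def)
  then show ?thesis using integral_haar_density_angle[OF d q] by simp
qed

text \<open>The integrand is continuous and nonnegative but not identically zero. The degree will be
  isolated by dividing by this integral.\<close>

lemma angle_integral_ramp_pos:
  assumes "- 1 \<le> \<tau>" "\<tau> < 3"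
  shows "angle_integral (\<lambda>t. max 0 (t - \<tau>)) \<noteq> 0"
proof
  let ?f = "\<lambda>\<theta>. max 0 (1 + 2 * cos \<theta> - \<tau>) * (1 - cos \<theta>)"
  assume "angle_integral (\<lambda>t. max 0 (t - \<tau>)) = 0"
  then have "integral {0..pi} ?f = 0" by (simp add: angle_integral_def)
  moreover have "continuous_on {0..pi} ?f" by (intro continuous_intros)
  ultimately have 0: "?f \<theta> = 0" if "\<theta> \<in> {0..pi}" for \<theta>
    using integral_eq_0_iff[of 0 pi ?f] that by simp
  \<comment> \<open>The angle at which the trace 1 + 2 cos \<theta> is halfway between \<tau> and
    3.\<close>
  define \<theta> where "\<theta> = arccos (((\<tau> + 3) / 2 - 1) / 2)"
  have "- 1 \<le> ((\<tau> + 3) / 2 - 1) / 2" "((\<tau> + 3) / 2 - 1) / 2 \<le> 1" using assms by auto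
  then have "cos \<theta> = ((\<tau> + 3) / 2 - 1) / 2" "\<theta> \<in> {0..pi}"
    using arccos_lbound arccos_ubound by (auto simp: \<theta>_def cos_arccos)
  moreover from this have "?f \<theta> > 0" using assms by (intro mult_pos_pos) (auto simp: field_simps)
  ultimately show False using 0 by fastforce
qed

section \<open>The degree at a regular value\<close>

context rotation_map
begin

definition coord :: "real^3 \<Rightarrow> real^3" where
  "coord x = cayley_coord (h x)"

definition coord_deriv :: "real^3 \<Rightarrow> real^3 \<Rightarrow> real^3" where
  "coord_deriv x v = (\<Sum>a\<in>UNIV. v $ a *\<^sub>R cayley_diff (coord x) (rate a x))"

lemma open_trace_gt: "open {x. trace (h x) > c}"
  using open_vimage[OF open_greaterThan Ck_on_0[OF Ck_trace_h], of c] by (simp add: vimage_def)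

lemma coord_has_derivative:
  assumes t: "trace (h x) > - 1"
  shows "(coord has_derivative coord_deriv x) (at x)"
proof -
  let ?s = "\<lambda>y. 1 + trace (h y)"
  have dt: "(\<lambda>y. trace (h y)) differentiable at x" "(\<lambda>y. axial (h y)) differentiable at x"
    using Ck_trace_h[of "Suc 0"] Ck_axial_h[of "Suc 0"] by simp_all
  have 1: "(?s has_derivative (\<lambda>v. \<Sum>a\<in>UNIV. v $ a *\<^sub>R partial a (\<lambda>y. trace (h y)) x)) (at x)"
    using has_derivative_add[OF has_derivative_const has_derivative_partial[OF dt(1)], of 1] by simp
  have s: "?s x \<noteq> 0" using t by simp
  have 2: "((\<lambda>y. inverse (?s y)) has_derivative
      (\<lambda>v. - (inverse (?s x) * (\<Sum>a\<in>UNIV. v $ a *\<^sub>R partial a (\<lambda>y. trace (h y)) x) * inverse (?s x)))) (at x)"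
    by (rule Deriv.has_derivative_inverse[OF s 1])
  have 3: "((\<lambda>y. inverse (?s y) *\<^sub>R axial (h y)) has_derivative
      (\<lambda>v. inverse (?s x) *\<^sub>R (\<Sum>a\<in>UNIV. v $ a *\<^sub>R partial a (\<lambda>y. axial (h y)) x)
        + (- (inverse (?s x) * (\<Sum>a\<in>UNIV. v $ a *\<^sub>R partial a (\<lambda>y. trace (h y)) x) * inverse (?s x))) *\<^sub>R axial (h x))) (at x)"
    by (rule has_derivative_scaleR[OF 2 has_derivative_partial[OF dt(2)]])
  have C: "coord x = inverse (?s x) *\<^sub>R axial (h x)" for x
    by (simp add: coord_def cayley_coord_def inverse_eq_divide)
  have D: "cayley_diff (coord x) (rate a x) = inverse (?s x) *\<^sub>R partial a (\<lambda>y. axial (h y)) x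
      + (- (inverse (?s x) * partial a (\<lambda>y. trace (h y)) x * inverse (?s x))) *\<^sub>R axial (h x)" for a
    unfolding coord_def cayley_diff_eq[OF rotation_h t, symmetric] partial_axial partial_trace
    by (simp add: cayley_coord_def inverse_eq_divide inner_commute)
  have "coord_deriv x v = inverse (?s x) *\<^sub>R (\<Sum>a\<in>UNIV. v $ a *\<^sub>R partial a (\<lambda>y. axial (h y)) x)
        + (- (inverse (?s x) * (\<Sum>a\<in>UNIV. v $ a *\<^sub>R partial a (\<lambda>y. trace (h y)) x) * inverse (?s x))) *\<^sub>R axial (h x)" for v
    unfolding coord_deriv_def D
    by (simp add: sum_3 vec_eq_iff algebra_simps)
  then have E: "coord_deriv x = (\<lambda>v. inverse (?s x) *\<^sub>R (\<Sum>a\<in>UNIV. v $ a *\<^sub>R partial a (\<lambda>y. axial (h y)) x)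
        + (- (inverse (?s x) * (\<Sum>a\<in>UNIV. v $ a *\<^sub>R partial a (\<lambda>y. trace (h y)) x) * inverse (?s x))) *\<^sub>R axial (h x))"
    by (rule ext)
  show ?thesis using 3 unfolding E C[abs_def] .
qed

text \<open>The columns are \<open>cayley_diff\<close> of the three rates. Off the half turns,
  \<open>jac\<close> is thus nonzero exactly where \<open>coord\<close> is regular, and the factor
  in front cancels the Haar density.\<close>

lemma det_coord_deriv: "det (matrix (coord_deriv x)) = (1 + coord x \<bullet> coord x)\<^sup>2 / 8 * jac x"
proof -
  let ?d = "\<lambda>a. cayley_diff (coord x) (rate a x)"
  have "matrix (coord_deriv x) = transpose (vector [?d 1, ?d 2, ?d 3])"
    by (simp add: vec_eq_iff forall_3 matrix_def coord_deriv_def sum_3 axis_def transpose_def)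
  then show ?thesis by (simp add: det_transpose det_cayley_diff jac_def)
qed

lemma coord_eq_0_iff:
  assumes "trace (h x) > - 1"
  shows "coord x = 0 \<longleftrightarrow> h x = mat 1"
proof
  assume "coord x = 0"
  then have "1 + trace (h x) = 4" using trace_cayley_coord[OF rotation_h assms] by (simp add: coord_def)
  then show "h x = mat 1" using rotation_trace_3[OF rotation_h] by simp
next
  assume "h x = mat 1"
  then show "coord x = 0" by (simp add: coord_def cayley_coord_def axial_def mat_def vec_eq_iff forall_3)
qed

lemma continuous_coord: "continuous_on {x. trace (h x) > - 1} coord"
  by (rule continuous_at_imp_continuous_on) (use coord_has_derivative has_derivative_continuous in blast)

text \<open>The inverse function theorem for \<open>coord\<close>, on a neighbourhood where the
  Cayley chart is defined and \<open>jac\<close> keeps its sign. A ball in the image is recorded so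
  that several such charts can be cut down to one radius.\<close>

lemma local_chart:
  assumes p: "h p = mat 1" "jac p \<noteq> 0" and O: "open S" "p \<in> S"
  obtains U d where "open U" "p \<in> U" "U \<subseteq> S" "inj_on coord U" "d > 0" "ball 0 d \<subseteq> coord ` U"
    "\<And>x. x \<in> U \<Longrightarrow> trace (h x) > - 1" "\<And>x. x \<in> U \<Longrightarrow> sgn (jac x) = sgn (jac p)"
proof -
  define R where "R = S \<inter> {x. trace (h x) > - 1} \<inter> {x. jac x * jac p > 0}"
  have cj: "continuous_on UNIV (\<lambda>x. jac x * jac p)" by (intro continuous_intros Ck_on_0[OF Ck_jac])
  have "open {x. jac x * jac p > 0}"
    using open_vimage[OF open_greaterThan cj, of 0] by (simp add: vimage_def)
  then have oR: "open R" unfolding R_def using O(1) open_trace_gt by blast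
  have tp: "trace (h p) > - 1" by (simp add: p(1) trace_def mat_def sum_3)
  have pR: "p \<in> R" using O(2) p(2) tp by (auto simp: R_def zero_less_mult_iff linorder_neq_iff)
  have bl: "bounded_linear (coord_deriv x)" if "x \<in> R" for x
    using has_derivative_bounded_linear[OF coord_has_derivative] that by (simp add: R_def)
  define f' where "f' x = Blinfun (coord_deriv x)" for x
  have f': "blinfun_apply (f' x) = coord_deriv x" if "x \<in> R" for x
    unfolding f'_def by (rule bounded_linear_Blinfun_apply[OF bl[OF that]])
  have cf': "continuous_on R f'"
  proof (rule continuous_on_blinfun_componentwise)
    fix i :: "real^3" assume "i \<in> Basis"
    have "continuous_on R (\<lambda>x. cayley_diff (coord x) (rate a x))" for a
      unfolding cayley_diff_def
      by (intro continuous_intros bounded_bilinear.continuous_on[OF bounded_bilinear_cross3]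
          continuous_on_subset[OF continuous_coord] continuous_on_subset[OF Ck_on_0[OF Ck_rate]])
         (auto simp: R_def)
    then have "continuous_on R (\<lambda>x. coord_deriv x i)"
      unfolding coord_deriv_def by (intro continuous_intros)
    then show "continuous_on R (\<lambda>x. blinfun_apply (f' x) i)"
      by (subst continuous_on_cong[OF refl, of R _ "\<lambda>x. coord_deriv x i"]) (simp_all add: f')
  qed
  have "det (matrix (coord_deriv p)) \<noteq> 0"
    using p(2) one_plus_inner_pos[of "coord p"] by (simp add: det_coord_deriv)
  then obtain B where B: "B ** matrix (coord_deriv p) = mat 1"
    by (metis invertible_det_nz invertible_left_inverse)
  define invf where "invf = Blinfun ((*v) B)"
  have invf: "blinfun_apply invf = (*v) B"
    unfolding invf_def by (rule bounded_linear_Blinfun_apply) (simp add: linear_conv_bounded_linear[symmetric])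
  have "B *v coord_deriv p v = v" for v
  proof -
    have "coord_deriv p v = matrix (coord_deriv p) *v v"
      using bl[OF pR] by (simp add: bounded_linear.linear)
    then show ?thesis using B by (simp add: matrix_vector_mul_assoc)
  qed
  then have inv: "invf o\<^sub>L f' p = id_blinfun"
    by (intro blinfun_eqI) (simp add: f'[OF pR] invf)
  have der: "(coord has_derivative blinfun_apply (f' x)) (at x)" if "x \<in> R" for x
    unfolding f'[OF that] using that coord_has_derivative by (simp add: R_def)
  obtain U V g g' where U: "open U" "U \<subseteq> R" "p \<in> U" "open V" "coord p \<in> V" "homeomorphism U V coord g"
    using inverse_function_theorem[OF oR der cf' pR inv] by metis
  have c0: "coord p = 0" using coord_eq_0_iff[OF tp] p(1) by simp
  obtain d where d: "d > 0" "ball 0 d \<subseteq> V" using U(4,5) c0 open_contains_ball by metis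
  show ?thesis
  proof (rule that[OF U(1,3) _ _ d(1)])
    show "U \<subseteq> S" using U(2) by (auto simp: R_def)
    show "inj_on coord U" using U(6) unfolding homeomorphism_def by (metis inj_on_inverseI)
    show "ball 0 d \<subseteq> coord ` U" using d(2) U(6) by (auto simp: homeomorphism_def)
    show "trace (h x) > - 1" if "x \<in> U" for x using that U(2) by (auto simp: R_def)
    show "sgn (jac x) = sgn (jac p)" if "x \<in> U" for x
      using that U(2) by (auto simp: R_def zero_less_mult_iff)
  qed
qed

lemma continuous_haar_density:
  assumes "continuous_on UNIV q"
  shows "continuous_on UNIV (haar_density q)"
proof -
  have "1 + k \<bullet> k \<noteq> 0" for k :: "real^3" using one_plus_inner_pos[of k] by simp
  then show ?thesis unfolding haar_density_def[abs_def]
    by (intro continuous_intros continuous_on_compose2[OF assms]) auto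
qed

text \<open>Change of variables under \<open>coord\<close>: the absolute Jacobian times
  \<open>haar_density q\<close> is \<open>s * jac x\<close> times \<open>q\<close> of the trace, and
  a second factor \<open>s\<close> removes the sign.\<close>

lemma integral_local_chart:
  assumes q: "continuous_on UNIV q" and U: "open U" "inj_on coord U" "ball 0 d \<subseteq> coord ` U"
    and tr: "\<And>x. x \<in> U \<Longrightarrow> trace (h x) > - 1" and s: "\<And>x. x \<in> U \<Longrightarrow> sgn (jac x) = s" and ss: "s * s = 1"
    and d: "0 < e" "e \<le> d"
  defines "W \<equiv> {x \<in> U. coord x \<in> ball 0 e}"
  shows "open W" and "set_integrable lborel W (\<lambda>x. q (trace (h x)) * jac x)"
    and "(LINT x:W|lborel. q (trace (h x)) * jac x) = s * integral (ball 0 e) (haar_density q)"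
proof -
  have cU: "continuous_on U coord"
    by (rule continuous_on_subset[OF continuous_coord]) (use tr in auto)
  have "W = coord -` ball 0 e \<inter> U" by (auto simp: W_def)
  then show oW: "open W" using continuous_open_preimage[OF cU U(1) open_ball[of 0 e]] by (simp add: Int_commute)
  then have [measurable]: "W \<in> sets borel" by simp
  have "ball 0 e \<subseteq> coord ` U" using subset_ball[OF d(2), of 0] U(3) by blast
  then have img: "coord ` W = ball 0 e" unfolding W_def by blast
  have inj: "inj_on coord W" using U(2) by (rule inj_on_subset) (auto simp: W_def)
  have der: "(coord has_derivative coord_deriv x) (at x within W)" if "x \<in> W" for x
    using that tr coord_has_derivative by (auto simp: W_def intro: has_derivative_at_withinI)
  have pull: "\<bar>det (matrix (coord_deriv x))\<bar> * haar_density q (coord x) = s * (q (trace (h x)) * jac x)" if "x \<in> W" for x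
  proof -
    define N where "N = 1 + coord x \<bullet> coord x"
    have N: "N > 0" using one_plus_inner_pos by (simp add: N_def)
    have x: "trace (h x) > - 1" "sgn (jac x) = s" using that tr s by (auto simp: W_def)
    have "1 + trace (h x) = 4 / N" using trace_cayley_coord[OF rotation_h x(1)] by (simp add: N_def coord_def)
    then have t: "(3 - coord x \<bullet> coord x) / (1 + coord x \<bullet> coord x) = trace (h x)"
      using N unfolding N_def[symmetric] by (simp add: N_def field_simps)
    have "\<bar>jac x\<bar> = s * jac x" using x(2) by (simp add: abs_sgn mult.commute)
    then show ?thesis
      unfolding haar_density_def t unfolding det_coord_deriv N_def[symmetric] using N by (simp add: abs_mult)
  qed
  have hd: "haar_density q absolutely_integrable_on ball 0 e"
  proof (rule set_integrable_subset)
    show "haar_density q absolutely_integrable_on cball 0 e"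
      by (rule set_integrable_lborel_absolutely_integrable, unfold set_integrable_def,
          rule borel_integrable_compact[OF compact_cball continuous_on_subset[OF continuous_haar_density[OF q] subset_UNIV]])
  qed auto
  have cv: "(\<lambda>x. \<bar>det (matrix (coord_deriv x))\<bar> * haar_density q (coord x)) absolutely_integrable_on W \<and>
      integral W (\<lambda>x. \<bar>det (matrix (coord_deriv x))\<bar> * haar_density q (coord x)) = integral (ball 0 e) (haar_density q)"
    using has_absolute_integral_change_of_variables_real[OF _ der inj, of "haar_density q" "integral (ball 0 e) (haar_density q)"]
      hd oW by (simp add: img)
  have ai: "(\<lambda>x. s * (q (trace (h x)) * jac x)) absolutely_integrable_on W"
  proof -
    have "(\<lambda>x. \<bar>det (matrix (coord_deriv x))\<bar> * haar_density q (coord x)) absolutely_integrable_on W \<longleftrightarrow>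
        (\<lambda>x. s * (q (trace (h x)) * jac x)) absolutely_integrable_on W"
      by (rule set_integrable_cong[OF refl refl pull])
    with cv show ?thesis by blast
  qed
  have iW: "integral W (\<lambda>x. s * (q (trace (h x)) * jac x)) = integral (ball 0 e) (haar_density q)"
    using cv Henstock_Kurzweil_Integration.integral_cong[of W, OF pull] by simp
  show si: "set_integrable lborel W (\<lambda>x. q (trace (h x)) * jac x)"
  proof -
    have cont: "continuous_on UNIV (\<lambda>x. q (trace (h x)) * jac x)"
      by (intro continuous_intros continuous_on_compose2[OF q Ck_on_0[OF Ck_trace_h]] Ck_on_0[OF Ck_jac]) auto
    then have [measurable]: "(\<lambda>x. q (trace (h x)) * jac x) \<in> borel_measurable borel"
      by (rule borel_measurable_continuous_onI)
    have "(\<lambda>x. s * (s * (q (trace (h x)) * jac x))) absolutely_integrable_on W"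
      by (rule set_integrable_mult_right) (rule ai)
    then have "(\<lambda>x. q (trace (h x)) * jac x) absolutely_integrable_on W"
      by (simp only: mult.assoc[symmetric] ss mult_1)
    then show ?thesis unfolding set_integrable_def
      by (subst (asm) integrable_completion) auto
  qed
  show "(LINT x:W|lborel. q (trace (h x)) * jac x) = s * integral (ball 0 e) (haar_density q)"
  proof -
    have "integral W (\<lambda>x. s * (q (trace (h x)) * jac x)) = s * (LINT x:W|lborel. q (trace (h x)) * jac x)"
      using set_borel_integral_eq_integral(2)[OF si] by simp
    then show ?thesis using iW ss by (metis mult.assoc mult_1)
  qed
qed

end

text \<open>Distinct points of \<open>F\<close> lie in different orbits and \<Gamma> is closed,
  which separates each pair; for a point paired with itself a ball of injectivity serves. As
  \<open>T\<close> is finite, one radius works for all pairs.\<close>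

lemma separated_orbits:
  assumes G: "subgroup \<Gamma> Sol" "discrete \<Gamma>" and F: "fundamental_domain \<Gamma> F" and T: "finite T" "T \<subseteq> F"
  obtains e where "e > 0"
    "\<And>p p' x y. p \<in> T \<Longrightarrow> p' \<in> T \<Longrightarrow> x \<in> ball p e \<Longrightarrow> y \<in> ball p' e \<Longrightarrow> sol_mult x (sol_inv y) \<in> \<Gamma> \<Longrightarrow> x = y \<and> p = p'"
proof -
  have "\<exists>e>0. \<forall>x\<in>ball p e. \<forall>y\<in>ball p' e. sol_mult x (sol_inv y) \<in> \<Gamma> \<longrightarrow> x = y \<and> p = p'"
    if p: "p \<in> T" "p' \<in> T" for p p'
  proof (cases "p = p'")
    case True
    obtain e where "e > 0" "\<And>x y. x \<in> ball p e \<Longrightarrow> y \<in> ball p e \<Longrightarrow> sol_mult x (sol_inv y) \<in> \<Gamma> \<Longrightarrow> x = y"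
      by (rule sol_quotient_inj_near[OF G, of p]) blast
    with True show ?thesis by blast
  next
    case False
    have "sol_mult p (sol_inv p') \<notin> \<Gamma>"
    proof
      assume g: "sol_mult p (sol_inv p') \<in> \<Gamma>"
      have "sol_mult (sol_mult p (sol_inv p')) p' \<in> F" using p T by (auto simp: sol_mult_assoc)
      moreover have "sol_mult 0 p' \<in> F" "0 \<in> \<Gamma>" using p T subgroup_Sol(1)[OF G(1)] by auto
      moreover have "\<exists>!\<gamma>. \<gamma> \<in> \<Gamma> \<and> sol_mult \<gamma> p' \<in> F" using F unfolding fundamental_domain_def by blast
      ultimately have "sol_mult p (sol_inv p') = 0" using g by blast
      then have "sol_mult (sol_mult p (sol_inv p')) p' = p'" by simp
      then have "p = p'" by (simp add: sol_mult_assoc)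
      with False show False ..
    qed
    then obtain e where "e > 0" "\<And>x y. x \<in> ball p e \<Longrightarrow> y \<in> ball p' e \<Longrightarrow> sol_mult x (sol_inv y) \<in> - \<Gamma>"
      using sol_near[of "- \<Gamma>" p p'] discrete_subgroup_closed[OF G] by auto
    then show ?thesis by blast
  qed
  then obtain E where E: "\<And>p p'. p \<in> T \<Longrightarrow> p' \<in> T \<Longrightarrow> E p p' > 0 \<and>
      (\<forall>x\<in>ball p (E p p'). \<forall>y\<in>ball p' (E p p'). sol_mult x (sol_inv y) \<in> \<Gamma> \<longrightarrow> x = y \<and> p = p')"
    by metis
  define e where "e = Min (insert 1 ((\<lambda>(p, p'). E p p') ` (T \<times> T)))"
  have fin: "finite (insert 1 ((\<lambda>(p, p'). E p p') ` (T \<times> T)))" using T(1) by simp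
  have "e > 0" unfolding e_def using fin E by (subst Min_gr_iff) auto
  moreover have "e \<le> E p p'" if "p \<in> T" "p' \<in> T" for p p'
    unfolding e_def by (rule Min_le[OF fin]) (use that in auto)
  then have "ball p e \<subseteq> ball p (E p p')" "ball p' e \<subseteq> ball p' (E p p')" if "p \<in> T" "p' \<in> T" for p p'
    using that by (auto intro: subset_ball[THEN subsetD])
  ultimately show ?thesis using E by (intro that[of e]) blast+
qed

context invariant_rotation_map
begin

text \<open>\<open>coord\<close> vanishes on the fibre and is injective near each of its points, so
  these are isolated; the fibre is also closed.\<close>

lemma not_islimpt_regular_fibre:
  assumes reg: "\<And>x. h x = mat 1 \<Longrightarrow> jac x \<noteq> 0"
  shows "\<not> z islimpt {x. h x = mat 1}"
proof
  assume z: "z islimpt {x. h x = mat 1}"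
  have "closed {x. h x = mat 1}"
    using closed_vimage[OF closed_singleton Ck_on_0[OF Ck_h], of "mat 1"] by (simp add: vimage_def)
  then have hz: "h z = mat 1" using z closed_limpt by blast
  obtain U d where U: "open U" "z \<in> U" "inj_on coord U" "\<And>x. x \<in> U \<Longrightarrow> trace (h x) > - 1"
    by (rule local_chart[OF hz reg[OF hz] open_UNIV UNIV_I]) blast
  obtain y where y: "y \<in> U" "y \<noteq> z" "h y = mat 1" using z U(1,2) unfolding islimpt_def by blast
  then have "coord y = coord z" using coord_eq_0_iff U(2,4) hz by metis
  with U(2,3) y show False unfolding inj_on_def by blast
qed

theorem degree_at_regular_value:
  assumes reg: "\<And>x. h x = mat 1 \<Longrightarrow> jac x \<noteq> 0"
  shows "\<exists>N::int. (LINT x:F|lborel. jac x) = 8 * pi\<^sup>2 * of_int N"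
proof -
  have G: "subgroup \<Gamma> Sol" "discrete \<Gamma>" using lattice by (auto simp: sol_lattice_def)
  \<comment> \<open>\<open>F\<close> may be unbounded; the finiteness of \<open>T\<close> and the
    bound \<tau> come from the compact closure of a bounded domain.\<close>
  obtain F0 where F0: "fundamental_domain \<Gamma> F0" "bounded F0" by (rule bounded_fundamental_domain[OF lattice])
  have cF0: "compact (closure F0)" using F0(2) by simp
  define T where "T = F0 \<inter> {x. h x = mat 1}"
  have "finite (closure F0 \<inter> {x. h x = mat 1})"
    by (rule finite_not_islimpt_in_compact[OF cF0]) (rule not_islimpt_regular_fibre[OF reg])
  then have finT: "finite T" unfolding T_def by (rule finite_subset[rotated]) (use closure_subset in blast)
  obtain e where e: "e > 0"
    "\<And>p p' x y. p \<in> T \<Longrightarrow> p' \<in> T \<Longrightarrow> x \<in> ball p e \<Longrightarrow> y \<in> ball p' e \<Longrightarrow> sol_mult x (sol_inv y) \<in> \<Gamma> \<Longrightarrow> x = y \<and> p = p'"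
    by (rule separated_orbits[OF G F0(1) finT]) (auto simp: T_def)
  define chart where "chart p U d \<longleftrightarrow> open U \<and> p \<in> U \<and> U \<subseteq> ball p e \<and> inj_on coord U \<and> d > 0 \<and>
      ball 0 d \<subseteq> coord ` U \<and> (\<forall>x\<in>U. trace (h x) > - 1) \<and> (\<forall>x\<in>U. sgn (jac x) = sgn (jac p))" for p U d
  have "\<exists>U d. chart p U d" if "p \<in> T" for p
  proof -
    have p: "h p = mat 1" using that by (simp add: T_def)
    show ?thesis
    proof (rule local_chart[OF p reg[OF p] open_ball, of p e])
      show "p \<in> ball p e" using e(1) by simp
      fix U d
      assume "open U" "p \<in> U" "U \<subseteq> ball p e" "inj_on coord U" "0 < d" "ball 0 d \<subseteq> coord ` U"
        "\<And>x. x \<in> U \<Longrightarrow> - 1 < trace (h x)" "\<And>x. x \<in> U \<Longrightarrow> sgn (jac x) = sgn (jac p)"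
      then have "chart p U d" unfolding chart_def by blast
      then show ?thesis by blast
    qed
  qed
  then obtain U d where Ud: "\<And>p. p \<in> T \<Longrightarrow> chart p (U p) (d p)" by metis
  have U: "open (U p)" "p \<in> U p" "U p \<subseteq> ball p e" "inj_on coord (U p)" "d p > 0" "ball 0 (d p) \<subseteq> coord ` U p"
    "\<And>x. x \<in> U p \<Longrightarrow> trace (h x) > - 1" "\<And>x. x \<in> U p \<Longrightarrow> sgn (jac x) = sgn (jac p)" if "p \<in> T" for p
    using Ud[OF that] unfolding chart_def by blast+
  \<comment> \<open>With a common radius \<open>coord\<close> maps every \<open>W p\<close>
    bijectively onto the same ball.\<close>
  define \<delta> where "\<delta> = Min (insert 1 (d ` T))"
  have \<delta>: "\<delta> > 0" unfolding \<delta>_def using finT U(5) by (subst Min_gr_iff) auto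
  have \<delta>d: "\<delta> \<le> d p" if "p \<in> T" for p unfolding \<delta>_def by (rule Min_le) (use that finT in auto)
  define W where "W p = {x \<in> U p. coord x \<in> ball 0 \<delta>}" for p
  have sgnp: "sgn (jac p) * sgn (jac p) = 1" if "p \<in> T" for p
    using reg[of p] that by (simp add: T_def sgn_if)
  have chart: "open (W p)" "set_integrable lborel (W p) (\<lambda>x. q (trace (h x)) * jac x)"
    "(LINT x:W p|lborel. q (trace (h x)) * jac x) = sgn (jac p) * integral (ball 0 \<delta>) (haar_density q)"
    if "p \<in> T" "continuous_on UNIV q" for p q
    unfolding W_def
    by (rule integral_local_chart[OF that(2) U(1)[OF that(1)] U(4)[OF that(1)] U(6)[OF that(1)] U(7)[OF that(1)]
        U(8)[OF that(1)] sgnp[OF that(1)] \<delta> \<delta>d[OF that(1)]]; assumption)+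
  have oW: "open (W p)" if "p \<in> T" for p by (rule chart(1)[OF that continuous_on_const])
  define A where "A = (\<Union>p\<in>T. W p)"
  \<comment> \<open>The saturation of \<open>A\<close> under \<Gamma>; it contains the whole fibre
    over the identity.\<close>
  define S where "S = {x. \<exists>\<gamma>\<in>\<Gamma>. sol_mult \<gamma> x \<in> A}"
  have oA: "open A" unfolding A_def using oW by blast
  have "S = (\<Union>\<gamma>\<in>\<Gamma>. {x. sol_mult \<gamma> x \<in> A})" by (auto simp: S_def)
  then have oS: "open S" using open_sol_left[OF oA] by auto
  have [measurable]: "A \<in> sets borel" "S \<in> sets borel" "F \<in> sets borel"
    using oA oS domain by (auto simp: fundamental_domain_def)
  have hF0: "\<exists>\<gamma>\<in>\<Gamma>. sol_mult \<gamma> x \<in> F0" for x using F0(1) unfolding fundamental_domain_def by blast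
  have Smult: "x \<in> S" if x: "\<gamma> \<in> \<Gamma>" "sol_mult \<gamma> x \<in> S" for \<gamma> x
  proof -
    obtain \<gamma>' where "\<gamma>' \<in> \<Gamma>" "sol_mult \<gamma>' (sol_mult \<gamma> x) \<in> A" using x(2) by (auto simp: S_def)
    then show ?thesis using x(1) subgroup_Sol(3)[OF G(1), of \<gamma>' \<gamma>] unfolding S_def
      by (auto simp: sol_mult_assoc intro!: bexI[of _ "sol_mult \<gamma>' \<gamma>"])
  qed
  have TS: "x \<in> S" if "h x = mat 1" for x
  proof -
    obtain \<gamma> where \<gamma>: "\<gamma> \<in> \<Gamma>" "sol_mult \<gamma> x \<in> F0" using hF0 by blast
    then have y: "sol_mult \<gamma> x \<in> T" using that h_invariant[OF \<gamma>(1)] by (simp add: T_def)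
    then have "coord (sol_mult \<gamma> x) = 0"
      using coord_eq_0_iff[OF U(7)[OF y U(2)[OF y]]] by (simp add: T_def)
    then have "sol_mult \<gamma> x \<in> W (sol_mult \<gamma> x)" using U(2)[OF y] \<delta> by (simp add: W_def)
    then have "sol_mult \<gamma> x \<in> A" using y by (auto simp: A_def)
    with \<gamma>(1) show ?thesis by (auto simp: S_def)
  qed
  \<comment> \<open>Outside \<open>S\<close> the map avoids the identity, the only rotation of trace
    3, so compactness bounds the trace away from 3. The value -1 serves when \<open>S\<close>
    contains the closure.\<close>
  obtain \<tau> where \<tau>: "- 1 \<le> \<tau>" "\<tau> < 3" "\<And>x. x \<in> closure F0 - S \<Longrightarrow> trace (h x) \<le> \<tau>"
  proof (cases "closure F0 - S = {}")
    case True
    then show ?thesis using that[of "-1"] by auto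
  next
    case False
    have "compact (closure F0 - S)" using cF0 oS by (rule compact_diff)
    then obtain x0 where x0: "x0 \<in> closure F0 - S" "\<forall>y\<in>closure F0 - S. trace (h y) \<le> trace (h x0)"
      using continuous_attains_sup[OF _ False continuous_on_subset[OF Ck_on_0[OF Ck_trace_h] subset_UNIV]] by blast
    have "trace (h x0) \<noteq> 3" using x0(1) TS rotation_trace_3[OF rotation_h] by blast
    then show ?thesis using that[of "trace (h x0)"] x0(2) trace_h_range[of x0] by auto
  qed
  have near: "x \<in> S" if "trace (h x) > \<tau>" for x
  proof -
    obtain \<gamma> where \<gamma>: "\<gamma> \<in> \<Gamma>" "sol_mult \<gamma> x \<in> F0" using hF0 by blast
    then have "sol_mult \<gamma> x \<in> S"
      using \<tau>(3)[of "sol_mult \<gamma> x"] that h_invariant[OF \<gamma>(1)] closure_subset by force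
    with \<gamma>(1) show ?thesis by (rule Smult)
  qed
  \<comment> \<open>The bound \<tau> puts the support of \<open>q (trace (h x))\<close> inside
    \<open>S\<close>; the other value is the trace on the sphere |k| = \<delta>, so that the ball of
    radius \<delta> carries the whole Haar integral of \<open>q\<close>.\<close>
  define \<sigma> where "\<sigma> = max \<tau> ((3 - \<delta>\<^sup>2) / (1 + \<delta>\<^sup>2))"
  define q where "q t = max 0 (t - \<sigma>)" for t :: real
  have "(3 - \<delta>\<^sup>2) / (1 + \<delta>\<^sup>2) < 3"
  proof -
    have pos: "\<delta>\<^sup>2 > 0" using \<delta> by simp
    then have "1 + \<delta>\<^sup>2 > 0" by linarith
    from pos_divide_less_eq[OF this] show ?thesis using pos by simp
  qed
  then have \<sigma>: "- 1 \<le> \<sigma>" "\<sigma> < 3" using \<tau> by (auto simp: \<sigma>_def)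
  have cq: "continuous_on D q" for D unfolding q_def[abs_def] by (intro continuous_intros)
  have ball: "integral (ball 0 \<delta>) (haar_density q) = 8 * pi * angle_integral q"
    by (rule integral_haar_density[OF \<delta> cq]) (simp add: q_def \<sigma>_def max_def)
  let ?f = "\<lambda>x. q (trace (h x)) * jac x"
  have cf: "continuous_on UNIV ?f"
    by (intro continuous_intros continuous_on_compose2[OF cq[of UNIV] Ck_on_0[OF Ck_trace_h]] Ck_on_0[OF Ck_jac]) auto
  have fi: "sol_invariant \<Gamma> ?f" using jac_invariant by (simp add: sol_invariant_def h_invariant)
  have fS: "?f x = 0" if "x \<notin> S" for x using near[of x] that by (force simp: q_def \<sigma>_def)
  \<comment> \<open>By the choice of \<open>e\<close> an orbit meets \<open>A\<close> at most once,
    and it meets \<open>A\<close> precisely if it lies in \<open>S\<close>.\<close>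
  have orbits: "same_orbits \<Gamma> (F \<inter> S) A"
    unfolding same_orbits_def
  proof (intro conjI ballI)
    fix x assume "x \<in> F \<inter> S"
    then obtain \<gamma> where \<gamma>: "\<gamma> \<in> \<Gamma>" "sol_mult \<gamma> x \<in> A" by (auto simp: S_def)
    show "\<exists>!\<gamma>. \<gamma> \<in> \<Gamma> \<and> sol_mult \<gamma> x \<in> A"
    proof (rule ex1I)
      show "\<gamma> \<in> \<Gamma> \<and> sol_mult \<gamma> x \<in> A" using \<gamma> by simp
      fix \<beta> assume \<beta>: "\<beta> \<in> \<Gamma> \<and> sol_mult \<beta> x \<in> A"
      obtain p p' where "p \<in> T" "p' \<in> T" "sol_mult \<beta> x \<in> ball p e" "sol_mult \<gamma> x \<in> ball p' e"
        using \<beta> \<gamma>(2) U(3) unfolding A_def W_def by blast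
      moreover have "sol_mult (sol_mult \<beta> x) (sol_inv (sol_mult \<gamma> x)) \<in> \<Gamma>"
      proof -
        have "sol_mult (sol_mult \<beta> x) (sol_inv (sol_mult \<gamma> x)) = sol_mult \<beta> (sol_inv \<gamma>)"
          using group.inv_mult_group[OF group_Sol, of \<gamma> x] by (simp add: sol_mult_assoc)
        then show ?thesis using \<beta> \<gamma>(1) subgroup_Sol[OF G(1)] by auto
      qed
      ultimately have "sol_mult \<beta> x = sol_mult \<gamma> x" using e(2) by blast
      then have "sol_mult (sol_mult \<beta> x) (sol_inv x) = sol_mult (sol_mult \<gamma> x) (sol_inv x)" by simp
      then show "\<beta> = \<gamma>" by (simp add: sol_mult_assoc)
    qed
  next
    fix y assume y: "y \<in> A"
    have "\<exists>!\<gamma>. \<gamma> \<in> \<Gamma> \<and> sol_mult \<gamma> y \<in> F" using domain unfolding fundamental_domain_def by blast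
    then obtain g where g: "g \<in> \<Gamma> \<and> sol_mult g y \<in> F" "\<forall>\<gamma>. \<gamma> \<in> \<Gamma> \<and> sol_mult \<gamma> y \<in> F \<longrightarrow> \<gamma> = g"
      by (elim ex1E) (rule that)
    have gi: "sol_inv g \<in> \<Gamma>" using g(1) subgroup_Sol(2)[OF G(1)] by blast
    show "\<exists>!\<gamma>. \<gamma> \<in> \<Gamma> \<and> sol_mult (sol_inv \<gamma>) y \<in> F \<inter> S"
    proof (rule ex1I)
      have "sol_mult g y \<in> S" using gi y unfolding S_def by (auto intro!: bexI[of _ "sol_inv g"])
      then show "sol_inv g \<in> \<Gamma> \<and> sol_mult (sol_inv (sol_inv g)) y \<in> F \<inter> S" using g(1) gi by simp
      fix \<gamma> assume "\<gamma> \<in> \<Gamma> \<and> sol_mult (sol_inv \<gamma>) y \<in> F \<inter> S"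
      then have "sol_inv \<gamma> = g" using g(2) subgroup_Sol(2)[OF G(1), of \<gamma>] by blast
      from arg_cong[OF this, of sol_inv] show "\<gamma> = sol_inv g" by simp
    qed
  qed
  have "trace_integral q = (LINT x:F \<inter> S|lborel. ?f x)"
    unfolding trace_integral_def set_lebesgue_integral_def
    by (rule Bochner_Integration.integral_cong[OF refl]) (use fS in \<open>auto simp: indicator_def\<close>)
  also have "\<dots> = (LINT x:A|lborel. ?f x)"
    by (rule set_integral_same_orbits(2)[OF G orbits _ _ borel_measurable_continuous_onI[OF cf] fi]) measurable
  also have "\<dots> = (\<Sum>p\<in>T. LINT x:W p|lborel. ?f x)"
    unfolding A_def
  proof (rule set_integral_finite_UN_AE[OF finT])
    have "p = p'" if p: "p \<in> T" "p' \<in> T" "x \<in> W p" "x \<in> W p'" for p p' x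
    proof -
      have "x \<in> ball p e" "x \<in> ball p' e" using p(3,4) U(3)[OF p(1)] U(3)[OF p(2)] by (auto simp: W_def)
      then show ?thesis using e(2)[OF p(1,2), of x x] subgroup_Sol(1)[OF G(1)] by simp
    qed
    then show "AE x in lborel. x \<in> W p \<and> x \<in> W p' \<longrightarrow> p = p'" if "p \<in> T" "p' \<in> T" for p p'
      using that by (intro AE_I2) blast
    show "W p \<in> sets lborel" if "p \<in> T" for p using oW[OF that] by simp
    show "set_integrable lborel (W p) ?f" if "p \<in> T" for p by (rule chart(2)[OF that cq])
  qed
  also have "\<dots> = (\<Sum>p\<in>T. sgn (jac p)) * (8 * pi * angle_integral q)"
    unfolding sum_distrib_right by (rule sum.cong[OF refl]) (simp add: chart(3)[OF _ cq] ball)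
  finally have tq: "trace_integral q = (\<Sum>p\<in>T. sgn (jac p)) * (8 * pi * angle_integral q)" .
  define N :: int where "N = (\<Sum>p\<in>T. if jac p > 0 then 1 else if jac p = 0 then 0 else - 1)"
  have "(\<Sum>p\<in>T. sgn (jac p)) = of_int N"
    unfolding N_def of_int_sum by (rule sum.cong) (auto simp: sgn_if)
  \<comment> \<open>Both evaluations of \<open>trace_integral q\<close> contain the nonzero factor
    \<open>angle_integral q\<close>; cancelling it leaves the sum of signs as the degree.\<close>
  then have "of_int N * (8 * pi * angle_integral q) * pi = trace_integral (\<lambda>_. 1) * angle_integral q"
    using trace_integral_eq[OF cq] tq by simp
  moreover have "angle_integral q \<noteq> 0"
    using angle_integral_ramp_pos[OF \<sigma>] by (simp add: q_def[abs_def])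
  ultimately have "trace_integral (\<lambda>_. 1) = 8 * pi\<^sup>2 * of_int N" by (simp add: power2_eq_square mult_ac)
  then show ?thesis unfolding trace_integral_def by (intro exI[of _ N]) simp
qed

end

text \<open>Sard's theorem for \<open>coord\<close> on the critical points off the half turns: their
  image is negligible in R^3 and so misses some \<open>k\<close>. As \<open>cayley k\<close> is
  never a half turn, no critical point of \<open>h\<close> over it is overlooked.\<close>

lemma (in rotation_map) regular_cayley_value:
  obtains k where "\<And>x. h x = cayley k \<Longrightarrow> jac x \<noteq> 0"
proof -
  define C where "C = {x. trace (h x) > - 1 \<and> jac x = 0}"
  have "negligible (coord ` C)"
  proof (rule baby_Sard)
    fix x assume "x \<in> C"
    then have x: "trace (h x) > - 1" "jac x = 0" by (auto simp: C_def)
    show "(coord has_derivative coord_deriv x) (at x within C)"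
      using coord_has_derivative[OF x(1)] by (rule has_derivative_at_withinI)
    show "rank (matrix (coord_deriv x)) < CARD(3)"
      using det_coord_deriv[of x] x(2) det_eq_0_rank[of "matrix (coord_deriv x)"] by simp
  qed simp
  then obtain k where k: "k \<notin> coord ` C" using non_negligible_UNIV by (metis UNIV_eq_I)
  have "jac x \<noteq> 0" if hx: "h x = cayley k" for x
  proof
    assume "jac x = 0"
    moreover have "1 + trace (cayley k) > 0"
      unfolding one_plus_trace_cayley using one_plus_inner_pos[of k] by simp
    then have "trace (h x) > - 1" unfolding hx by linarith
    ultimately have "x \<in> C" by (simp add: C_def)
    moreover have "coord x = k" by (simp add: coord_def hx cayley_coord_cayley)
    ultimately show False using k by blast
  qed
  then show ?thesis by (rule that)
qed

text \<open>Multiply \<open>h\<close> on the left by the inverse of the regular value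
  \<open>cayley k\<close>. All rates are rotated by the constant matrix \<open>R\<close>, so their
  triple product \<open>jac\<close> is unchanged while the regular value moves to the
  identity.\<close>

theorem (in invariant_rotation_map) integral_jac:
  "\<exists>N::int. (LINT x:F|lborel. jac x) = 8 * pi\<^sup>2 * of_int N"
proof -
  obtain k where k: "\<And>x. h x = cayley k \<Longrightarrow> jac x \<noteq> 0" by (rule regular_cayley_value) blast
  define R where "R = transpose (cayley k)"
  have R: "rotation_matrix R" unfolding R_def by (rule rotation_transpose[OF rotation_cayley])
  interpret shifted: invariant_rotation_map "\<lambda>x. R ** h x" \<Gamma> F
  proof
    show "Ck_on n UNIV (\<lambda>x. R ** h x)" for n
      by (rule Ck_on_bilinear[OF bounded_bilinear_matrix_mult Ck_on_const Ck_h])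
    show "rotation_matrix (R ** h x)" for x by (rule rotation_mult[OF R rotation_h])
    show "sol_invariant \<Gamma> (\<lambda>x. R ** h x)" using invariant by (simp add: sol_invariant_def)
  qed (rule lattice, rule domain)
  have rate: "shifted.rate a x = R *v rate a x" for a x
  proof -
    have "(R ** (hat (rate a x) ** h x)) ** transpose (R ** h x) = R ** hat (rate a x) ** (h x ** transpose (h x)) ** transpose R"
      by (simp add: matrix_transpose_mul matrix_mul_assoc)
    also have "\<dots> = hat (R *v rate a x)"
      by (simp add: rotation_inverse(2)[OF rotation_h] rotation_hat_conjugate[OF R])
    finally have *: "(R ** (hat (rate a x) ** h x)) ** transpose (R ** h x) = hat (R *v rate a x)" .
    have "partial a (\<lambda>x. R ** h x) x = R ** (hat (rate a x) ** h x)"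
      using partial_bilinear[OF bounded_bilinear_matrix_mult _ h_differentiable, of "\<lambda>_. R"]
      by (simp add: partial_h bounded_bilinear.zero_left[OF bounded_bilinear_matrix_mult])
    then show ?thesis unfolding shifted.rate_def by (simp add: * axial_hat)
  qed
  have jac: "shifted.jac = jac"
    by (simp add: fun_eq_iff shifted.jac_def jac_def rate rotation_inner_cross[OF R])
  have "shifted.jac x \<noteq> 0" if "R ** h x = mat 1" for x
  proof -
    have "cayley k ** (R ** h x) = h x"
      unfolding R_def by (simp add: matrix_mul_assoc rotation_inverse(2)[OF rotation_cayley])
    then have "h x = cayley k" using that by simp
    then show ?thesis using k jac by simp
  qed
  from shifted.degree_at_regular_value[OF this] show ?thesis unfolding jac .
qed

section \<open>Frames on the quotient\<close>

definition sol_left_jacobian :: "real^3 \<Rightarrow> real^3^3" where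
  "sol_left_jacobian \<gamma> = vector [vector [exp (- \<gamma>$3), 0, 0], vector [0, exp (\<gamma>$3), 0], vector [0, 0, 1]]"

lemma Ck_on_subset: "Ck_on k UNIV f \<Longrightarrow> Ck_on k D f"
  by (induction k arbitrary: f) (auto intro: continuous_on_subset)

text \<open>A section agrees with the rotated frame only on a chart domain, so the connection form
  must be seen to depend on the germ of the frame alone.\<close>

lemma lc_form_cong_open:
  assumes "open U" "x \<in> U" "\<And>y. y \<in> U \<Longrightarrow> E y = E' y"
  shows "lc_form G E a x = lc_form G E' a x"
proof -
  have "partial a (\<lambda>y. column j (E y)) x = partial a (\<lambda>y. column j (E' y)) x" for j
    by (rule partial_cong_open[OF assms(1,2)]) (simp add: assms(3))
  then show ?thesis by (simp add: lc_form_def cov_deriv_def assms(2,3))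
qed

lemma cs_coeff_cong_open:
  assumes "open U" "x \<in> U" "\<And>a y. y \<in> U \<Longrightarrow> A a y = A' a y"
  shows "cs_coeff A x = cs_coeff A' x"
proof -
  have "partial b (A c) x = partial b (A' c) x" for b c
    by (rule partial_cong_open[OF assms(1,2)]) (simp add: assms(3))
  then show ?thesis by (simp add: cs_coeff_def assms(2,3))
qed

lemma frame_section_translate:
  assumes G: "subgroup \<Gamma> Sol" and s: "frame_section (sol_quotient \<Gamma>) sol_quotient_metric s"
    and cd: "c \<in> sol_quotient \<Gamma>" "d \<in> sol_quotient \<Gamma>" and x: "\<gamma> \<in> \<Gamma>" "x \<in> fst c" "sol_mult \<gamma> x \<in> fst d"
  shows "s d (sol_mult \<gamma> x) = sol_left_jacobian \<gamma> ** s c x"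
proof -
  have "x \<in> overlap c d" unfolding sol_quotient_overlap(1)[OF G cd] using x by blast
  then have "s d (transition c d x) = jacobian (transition c d) (at x) ** s c x"
    using s cd unfolding frame_section_def by blast
  then show ?thesis
    unfolding sol_quotient_overlap(2)[OF G cd x] jacobian_transition[OF G cd x] sol_left_jacobian_def .
qed

lemma sol_left_jacobian_0: "sol_left_jacobian 0 = mat 1"
  by (simp add: sol_left_jacobian_def vec_eq_iff forall_3 mat_def)

lemma sol_frame_sol_mult: "sol_frame (sol_mult \<gamma> x) = sol_left_jacobian \<gamma> ** sol_frame x"
  by (simp add: sol_frame_def sol_left_jacobian_def vec_eq_iff forall_3 sum_3 matrix_matrix_mult_def flip: exp_add)

lemma sol_coframe:
  "transpose (sol_frame x) ** sol_metric x = vector [vector [exp (x$3), 0, 0], vector [0, exp (- x$3), 0], vector [0, 0, 1]]"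
  by (simp add: sol_frame_def sol_metric_def vec_eq_iff forall_3 sum_3 matrix_matrix_mult_def transpose_def flip: exp_add)

lemma sol_frame_coframe: "sol_frame x ** (transpose (sol_frame x) ** sol_metric x) = mat 1"
  unfolding sol_coframe
  by (simp add: sol_frame_def vec_eq_iff forall_3 sum_3 matrix_matrix_mult_def mat_def flip: exp_add)

lemma sol_coframe_sol_mult:
  "(transpose (sol_frame (sol_mult \<gamma> x)) ** sol_metric (sol_mult \<gamma> x)) ** sol_left_jacobian \<gamma> = transpose (sol_frame x) ** sol_metric x"
  unfolding sol_coframe
  by (simp add: sol_left_jacobian_def vec_eq_iff forall_3 sum_3 matrix_matrix_mult_def flip: exp_add)

lemma Ck_diagonal_exp:
  "Ck_on k UNIV (\<lambda>x. vector [vector [exp (c * x$3), 0, 0], vector [0, exp (d * x$3), 0], vector [0, 0, 1]] :: real^3^3)"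
proof (intro Ck_on_componentwise)
  fix i j :: 3
  show "Ck_on k UNIV (\<lambda>x. (vector [vector [exp (c * x$3), 0, 0], vector [0, exp (d * x$3), 0], vector [0, 0, 1]] :: real^3^3) $ i $ j)"
    using exhaust_3[of i] exhaust_3[of j] Ck_on_exp[of k 1 c 3] Ck_on_exp[of k 1 d 3]
      Ck_on_const[of k UNIV "0::real"] Ck_on_const[of k UNIV "1::real"]
    by (elim disjE; simp del: Ck_on.simps)
qed

text \<open>For the identity of \<Gamma> the transition rule makes the local expressions agree on
  overlaps, so they glue to one frame field on Sol; for the other elements it makes this field
  equivariant. Its components with respect to X, Y, Z are then invariant.\<close>

lemma frame_section_rotation:
  assumes L: "sol_lattice \<Gamma>" and s: "frame_section (sol_quotient \<Gamma>) sol_quotient_metric s"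
  obtains h where "rotation_map h" "sol_invariant \<Gamma> h"
    "\<And>c x. c \<in> sol_quotient \<Gamma> \<Longrightarrow> x \<in> fst c \<Longrightarrow> s c x = sol_frame x ** h x"
proof -
  have G: "subgroup \<Gamma> Sol" "discrete \<Gamma>" using L by (auto simp: sol_lattice_def)
  have "\<exists>c\<in>sol_quotient \<Gamma>. p \<in> fst c" for p
  proof -
    obtain e where "e > 0" "inj_on (\<lambda>p. \<Gamma> #>\<^bsub>Sol\<^esub> p) (ball p e)" using sol_quotient_inj_near[OF G] by metis
    then show ?thesis unfolding sol_quotient_def by (auto intro!: exI[of _ "ball p e"])
  qed
  then obtain ch where ch: "\<And>p. ch p \<in> sol_quotient \<Gamma>" "\<And>p. p \<in> fst (ch p)" by metis
  define S where "S p = s (ch p) p" for p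
  have trans: "s d (sol_mult \<gamma> x) = sol_left_jacobian \<gamma> ** s c x"
    if "c \<in> sol_quotient \<Gamma>" "d \<in> sol_quotient \<Gamma>" "\<gamma> \<in> \<Gamma>" "x \<in> fst c" "sol_mult \<gamma> x \<in> fst d" for c d \<gamma> x
    by (rule frame_section_translate[OF G(1) s that])
  have S: "s c x = S x" if "c \<in> sol_quotient \<Gamma>" "x \<in> fst c" for c x
    using trans[OF ch(1)[of x] that(1) subgroup_Sol(1)[OF G(1)] ch(2)] that(2) by (simp add: S_def sol_left_jacobian_0)
  have S_mult: "S (sol_mult \<gamma> x) = sol_left_jacobian \<gamma> ** S x" if "\<gamma> \<in> \<Gamma>" for \<gamma> x
    unfolding S_def by (rule trans[OF ch(1) ch(1) that ch(2) ch(2)])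
  have op: "open (fst c)" if "c \<in> sol_quotient \<Gamma>" for c using that by (auto simp: sol_quotient_def)
  have CS: "Ck_on k UNIV S" for k
  proof (rule Ck_on_local)
    fix x
    have "Ck_on k (fst (ch x)) (s (ch x))" using s ch(1)[of x] unfolding frame_section_def smooth_on_def by blast
    then show "\<exists>U h. open U \<and> x \<in> U \<and> Ck_on k U h \<and> (\<forall>y\<in>U. S y = h y)"
      using op[OF ch(1)] ch(2) S[OF ch(1)] by (intro exI[of _ "fst (ch x)"] exI[of _ "s (ch x)"]) auto
  qed
  have SO: "transpose (S x) ** sol_metric x ** S x = mat 1" "det (S x) > 0" for x
  proof -
    have "transpose (s (ch x) x) ** sol_quotient_metric (ch x) x ** s (ch x) x = mat 1 \<and> det (s (ch x) x) > 0"
      using s ch unfolding frame_section_def by blast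
    then show "transpose (S x) ** sol_metric x ** S x = mat 1" "det (S x) > 0"
      by (simp_all add: S_def sol_quotient_metric_def)
  qed
  \<comment> \<open>The coframe dual to X, Y, Z: inverse to \<open>sol_frame\<close> by
    orthonormality, and diagonal with exponential entries, hence smooth.\<close>
  define M where "M x = transpose (sol_frame x) ** sol_metric x" for x
  define h where "h x = M x ** S x" for x
  have FM: "sol_frame x ** M x = mat 1" for x unfolding M_def by (rule sol_frame_coframe)
  have MF: "M x ** sol_frame x = mat 1" for x unfolding M_def by (rule sol_frame_orthonormal)
  have Sh: "S x = sol_frame x ** h x" for x by (simp add: h_def matrix_mul_assoc FM)
  have hh: "transpose (h x) ** h x = mat 1" for x
  proof -
    have "transpose (S x) ** sol_metric x ** S x = transpose (h x) ** (transpose (sol_frame x) ** sol_metric x ** sol_frame x) ** h x"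
      unfolding Sh by (simp only: matrix_transpose_mul matrix_mul_assoc)
    then show ?thesis using SO(1) by (simp add: sol_frame_orthonormal)
  qed
  have dh: "det (h x) = 1" for x
  proof -
    have "orthogonal_matrix (h x)" using hh by (simp add: orthogonal_matrix)
    moreover have "det (h x) > 0" using SO(2)[of x] by (simp add: Sh det_mul sol_frame_positive)
    ultimately show ?thesis using det_orthogonal_matrix by fastforce
  qed
  have CM: "Ck_on k UNIV M" for k
  proof -
    have "M = (\<lambda>x. vector [vector [exp (1 * x$3), 0, 0], vector [0, exp ((- 1) * x$3), 0], vector [0, 0, 1]])"
      unfolding M_def[abs_def] sol_coframe by simp
    then show ?thesis using Ck_diagonal_exp[of k 1 "-1"] by simp
  qed
  have "rotation_map h"
  proof
    show "Ck_on k UNIV h" for k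
      unfolding h_def[abs_def] by (rule Ck_on_bilinear[OF bounded_bilinear_matrix_mult CM CS])
    show "rotation_matrix (h x)" for x
      using hh dh by (simp add: rotation_matrix_def orthogonal_matrix)
  qed
  moreover have "sol_invariant \<Gamma> h"
    unfolding sol_invariant_def
  proof (intro ballI allI)
    fix \<gamma> x assume "\<gamma> \<in> \<Gamma>"
    then have "h (sol_mult \<gamma> x) = (M (sol_mult \<gamma> x) ** sol_left_jacobian \<gamma>) ** S x"
      by (simp add: h_def S_mult matrix_mul_assoc)
    then show "h (sol_mult \<gamma> x) = h x" unfolding M_def sol_coframe_sol_mult by (simp add: h_def M_def)
  qed
  moreover have "s c x = sol_frame x ** h x" if "c \<in> sol_quotient \<Gamma>" "x \<in> fst c" for c x
    using S[OF that] Sh by simp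
  ultimately show ?thesis by (rule that)
qed

lemma cs_form_eq:
  assumes s: "\<And>c x. c \<in> sol_quotient \<Gamma> \<Longrightarrow> x \<in> fst c \<Longrightarrow> s c x = sol_frame x ** h x"
    and c: "c \<in> sol_quotient \<Gamma>" "x \<in> fst c"
  shows "cs_form sol_quotient_metric s c x = cs_coeff (lc_form sol_metric (\<lambda>x. sol_frame x ** h x)) x"
proof -
  have o: "open (fst c)" using c by (auto simp: sol_quotient_def)
  have "sol_quotient_metric c = sol_metric" by (simp add: sol_quotient_metric_def)
  then show ?thesis unfolding cs_form_def
    by (simp only:) (rule cs_coeff_cong_open[OF o c(2)], rule lc_form_cong_open[OF o], simp_all add: s[OF c(1)])
qed

text \<open>The decomposition stays arbitrary, as in \<open>has_form_integral\<close>. The unit 16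
  pi^2 is twice the 8 pi^2 found for \<open>jac\<close>, the exact part having integral 0.\<close>

lemma cs_form_integrals:
  assumes L: "sol_lattice \<Gamma>" and s: "frame_section (sol_quotient \<Gamma>) sol_quotient_metric s"
    and C: "finite C" "C \<subseteq> sol_quotient \<Gamma>"
    and B: "\<And>c. c \<in> C \<Longrightarrow> B c \<subseteq> fst c" "\<And>c. c \<in> C \<Longrightarrow> B c \<in> sets borel"
    and disj: "disjoint_family_on (\<lambda>c. snd c ` B c) C" and pts: "(\<Union>c\<in>C. snd c ` B c) = points (sol_quotient \<Gamma>)"
  shows "\<And>c. c \<in> C \<Longrightarrow> cs_form sol_quotient_metric s c absolutely_integrable_on B c"
    and "\<exists>N::int. (\<Sum>c\<in>C. integral (B c) (cs_form sol_quotient_metric s c)) = 16 * pi\<^sup>2 * of_int N"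
proof -
  have G: "subgroup \<Gamma> Sol" "discrete \<Gamma>" using L by (auto simp: sol_lattice_def)
  obtain h where h: "rotation_map h" "sol_invariant \<Gamma> h"
    "\<And>c x. c \<in> sol_quotient \<Gamma> \<Longrightarrow> x \<in> fst c \<Longrightarrow> s c x = sol_frame x ** h x"
    by (rule frame_section_rotation[OF L s]) blast
  define F where "F = (\<Union>c\<in>C. B c)"
  have F: "fundamental_domain \<Gamma> F" "disjoint_family_on B C"
    unfolding F_def by (rule pieces_fundamental_domain[OF G C B disj pts]; assumption)+
  interpret rotation_map h by (rule h(1))
  interpret invariant_rotation_map h \<Gamma> F
    by unfold_locales (rule L, rule F(1), rule h(2))
  define cs where "cs = cs_coeff (lc_form sol_metric (\<lambda>x. sol_frame x ** h x))"
  have eq: "cs_form sol_quotient_metric s c x = cs x" if "c \<in> C" "x \<in> B c" for c x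
    unfolding cs_def using that C(2) B(1)[OF that(1)] by (intro cs_form_eq[OF h(3)]) auto
  have intF: "set_integrable lborel F cs" using integral_cs_coeff(1) by (simp add: cs_def)
  have int: "set_integrable lborel (B c) cs" if "c \<in> C" for c
    by (rule set_integrable_subset[OF intF]) (use that B(2) in \<open>auto simp: F_def\<close>)
  show "cs_form sol_quotient_metric s c absolutely_integrable_on B c" if "c \<in> C" for c
  proof -
    have "cs_form sol_quotient_metric s c absolutely_integrable_on B c \<longleftrightarrow> cs absolutely_integrable_on B c"
      by (rule set_integrable_cong[OF refl refl eq[OF that]])
    then show ?thesis using set_integrable_lborel_absolutely_integrable[OF int[OF that]] by blast
  qed
  have "(\<Sum>c\<in>C. integral (B c) (cs_form sol_quotient_metric s c)) = (\<Sum>c\<in>C. LINT x:B c|lborel. cs x)"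
  proof (rule sum.cong[OF refl])
    fix c assume c: "c \<in> C"
    have "integral (B c) (cs_form sol_quotient_metric s c) = integral (B c) cs"
      by (rule Henstock_Kurzweil_Integration.integral_cong) (rule eq[OF c])
    then show "integral (B c) (cs_form sol_quotient_metric s c) = (LINT x:B c|lborel. cs x)"
      using set_borel_integral_eq_integral(2)[OF int[OF c]] by simp
  qed
  also have "\<dots> = (LINT x:F|lborel. cs x)"
    unfolding F_def
  proof (rule set_integral_finite_UN_AE[OF C(1), symmetric])
    show "AE x in lborel. x \<in> B c \<and> x \<in> B d \<longrightarrow> c = d" if "c \<in> C" "d \<in> C" for c d
      using F(2) that unfolding disjoint_family_on_def by (intro AE_I2) blast
    show "B c \<in> sets lborel" if "c \<in> C" for c using B(2)[OF that] by simp
    show "set_integrable lborel (B c) cs" if "c \<in> C" for c by (rule int[OF that])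
  qed
  also have "\<dots> = 2 * (LINT x:F|lborel. jac x)"
    unfolding cs_def by (rule integral_cs_coeff(2))
  finally have sum: "(\<Sum>c\<in>C. integral (B c) (cs_form sol_quotient_metric s c)) = 2 * (LINT x:F|lborel. jac x)" .
  obtain N :: int where "(LINT x:F|lborel. jac x) = 8 * pi\<^sup>2 * of_int N" using integral_jac by blast
  then show "\<exists>N::int. (\<Sum>c\<in>C. integral (B c) (cs_form sol_quotient_metric s c)) = 16 * pi\<^sup>2 * of_int N"
    unfolding sum by (intro exI[of _ N]) simp
qed

text \<open>Guarantees that \<open>chern_simons\<close> is not a union over the empty set.\<close>

lemma frame_section_sol_frame:
  assumes L: "sol_lattice \<Gamma>"
  shows "frame_section (sol_quotient \<Gamma>) sol_quotient_metric (\<lambda>_. sol_frame)"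
proof -
  have G: "subgroup \<Gamma> Sol" using L by (auto simp: sol_lattice_def)
  have "sol_frame = (\<lambda>x. vector [vector [exp ((- 1) * x$3), 0, 0], vector [0, exp (1 * x$3), 0], vector [0, 0, 1]])"
    by (simp add: fun_eq_iff sol_frame_def)
  then have "Ck_on k UNIV sol_frame" for k using Ck_diagonal_exp[of k "-1" 1] by simp
  then have "smooth_on D sol_frame" for D unfolding smooth_on_def using Ck_on_subset by blast
  moreover have "sol_frame (transition c d x) = jacobian (transition c d) (at x) ** sol_frame x"
    if cd: "c \<in> sol_quotient \<Gamma>" "d \<in> sol_quotient \<Gamma>" and x: "x \<in> overlap c d" for c d x
  proof -
    obtain \<gamma> where g: "\<gamma> \<in> \<Gamma>" "x \<in> fst c" "sol_mult \<gamma> x \<in> fst d"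
      using x unfolding sol_quotient_overlap(1)[OF G cd] by auto
    show ?thesis
      unfolding sol_quotient_overlap(2)[OF G cd g] jacobian_transition[OF G cd g] sol_frame_sol_mult sol_left_jacobian_def ..
  qed
  ultimately show ?thesis
    unfolding frame_section_def
    by (auto simp: sol_quotient_metric_def sol_frame_orthonormal sol_frame_positive)
qed

lemma mod_Z_of_int: "mod_Z (- 1 / (16 * pi\<^sup>2) * (16 * pi\<^sup>2 * of_int N)) = mod_Z 0"
proof -
  have "- 1 / (16 * pi\<^sup>2) * (16 * pi\<^sup>2 * of_int N) = of_int (- N)" by simp
  moreover have "[of_int (- N) = 0 :: real] (rmod 1)"
    unfolding rcong_def rmod_def by simp
  ultimately show ?thesis unfolding mod_Z_def rcong_def by simp
qed

theorem proposition4p6: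
  fixes \<Gamma> :: "(real^3) set"
  assumes "sol_lattice \<Gamma>"
  shows "chern_simons (sol_quotient \<Gamma>) sol_quotient_metric = mod_Z 0"
proof
  note L = assms
  have G: "subgroup \<Gamma> Sol" using L by (auto simp: sol_lattice_def)
  have residue: "mod_Z (- 1 / (16 * pi\<^sup>2) * I) = mod_Z 0"
    if s: "frame_section (sol_quotient \<Gamma>) sol_quotient_metric s"
      and I: "has_form_integral (sol_quotient \<Gamma>) (cs_form sol_quotient_metric s) I" for s I
  proof -
    obtain C B where CB: "finite C" "C \<subseteq> sol_quotient \<Gamma>"
      "\<forall>c\<in>C. B c \<subseteq> fst c \<and> B c \<in> sets borel \<and> cs_form sol_quotient_metric s c absolutely_integrable_on B c"
      "disjoint_family_on (\<lambda>c. snd c ` B c) C" "(\<Union>c\<in>C. snd c ` B c) = points (sol_quotient \<Gamma>)"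
      "I = (\<Sum>c\<in>C. integral (B c) (cs_form sol_quotient_metric s c))"
      using I unfolding has_form_integral_def by (elim exE conjE) (rule that)
    obtain N :: int where "I = 16 * pi\<^sup>2 * of_int N"
      using cs_form_integrals(2)[OF L s CB(1,2) _ _ CB(4,5)] CB(3,6) by blast
    then show ?thesis using mod_Z_of_int by simp
  qed
  then show "chern_simons (sol_quotient \<Gamma>) sol_quotient_metric \<subseteq> mod_Z 0"
    unfolding chern_simons_def by blast
  \<comment> \<open>For the reverse inclusion one section with an integral suffices, since
    \<open>residue\<close> identifies the class of every such pair.\<close>
  let ?s = "\<lambda>_ :: (real^3) set chart. sol_frame"
  have s: "frame_section (sol_quotient \<Gamma>) sol_quotient_metric ?s" by (rule frame_section_sol_frame[OF L])
  obtain C where C: "finite C" "C \<subseteq> sol_quotient \<Gamma>" "(\<Union>c\<in>C. snd c ` fst c) = points (sol_quotient \<Gamma>)"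
    using sol_quotient_finite_charts[OF L] by blast
  obtain B where B: "(\<forall>c\<in>C. B c \<subseteq> fst c \<and> B c \<in> sets borel) \<and> disjoint_family_on (\<lambda>c. snd c ` B c) C \<and>
    (\<Union>c\<in>C. snd c ` B c) = (\<Union>c\<in>C. snd c ` fst c)"
    using disjoint_chart_pieces[OF G C(1,2)] ..
  have "cs_form sol_quotient_metric ?s c absolutely_integrable_on B c" if "c \<in> C" for c
    by (rule cs_form_integrals(1)[OF L s C(1,2) _ _ _ _ that]) (use B C(3) in simp_all)
  then have I: "has_form_integral (sol_quotient \<Gamma>) (cs_form sol_quotient_metric ?s)
      (\<Sum>c\<in>C. integral (B c) (cs_form sol_quotient_metric ?s c))"
    unfolding has_form_integral_def using B C by (intro exI[of _ C] exI[of _ B]) simp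
  show "mod_Z 0 \<subseteq> chern_simons (sol_quotient \<Gamma>) sol_quotient_metric"
    unfolding chern_simons_def using residue[OF s I] s I by blast
qed

end
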